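(* Let $d\ge 2$ be a fixed integer and, for each $i\in\mathbb N$, let $2\le d_i\le d$ and let $A_i$ be a $d_i\times d_i$ matrix acting on $\mathbb R^{d_i}$. Let $\{A_i\}_{i\in\mathbb N}$ be a family of uniformly normalizable matrices, and suppose the real parts of the eigenvalues of the matrices $A_1,A_2,\dots$ are negative. Let $\theta>0$. Then the system $$\dot x_i=A_ix_i+w_i,\qquad x_i(0)=x_{i0}\in\mathbb R^{d_i},\qquad i=1,2,\dots,\tag{S}$$ with $x_0=(x_{10},x_{20},\dots)\in\ell^2$, is globally asymptotically stable and null-controllable in large. A time optimal control exists and can be constructed explicitly.
   Context: $\ell^2$ denotes the Hilbert space of sequences $x=(x_1,x_2,\dots)$ with $x_i\in\mathbb R^{d_i}$ and $\|x\|^2=\sum_{i=1}^\infty\|x_i\|^2<\infty$, where $\|x_i\|$ is the Euclidean norm on $\mathbb R^{d_i}$. Uniformly normalizable: there exist a family $\{P_i\}_{i\in\mathbb N}$ of non-singular matrices and a constant $C\ge 1$ such that $\|P_i\|\cdot\|P_i^{-1}\|\le C$ and $P_iA_iP_i^{-1}$ is a matrix in Jordan normal form for all $i\in\mathbb N$. Admissible controls: for $\theta>0$, $B(\theta)$ is the set of all functions $w=(w_1,w_2,\dots):[0,T]\to\ell^2$ (on the time interval $[0,T]$ under consideration) with measurable coordinates $w_i:[0,T]\to\mathbb R^{d_i}$ such that $\sum_{i=1}^\infty\int_0^T\|w_i(s)\|^2\,ds\le\theta^2$. The solution of (S) with initial state $x_0\in\ell^2$ is the function $x=(x_1,x_2,\dots)$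 with values in $\ell^2$ with components $x_i(t)=e^{tA_i}x_{i0}+\int_0^te^{(t-s)A_i}w_i(s)\,ds$. Globally asymptotically stable: $\lim_{t\to+\infty}x(t)=0$ for the solution $x(t)$ of (S) with any initial condition $x_0\in\ell^2$ and $w_i\equiv 0$ for all $i\in\mathbb N$. Null-controllable from $x_0\in\ell^2$: there exist an admissible control $u\in B(\theta)$ and $T=T(u)\in\mathbb R_+$ such that the solution of (S) with $w=u$ starting from $x_0$ satisfies $x(T)=0$. Null-controllable in large: null-controllable from any $x_0\in\ell^2$. Optimal time of translation: $\inf_{u\in B(\theta)}T(u)$ (for given $x_0$). Time optimal control: a control $u\in B(\theta)$ realizing this minimum.
   Formalization: Global asymptotic stability is claimed only if the real parts of eigenvalues having a Jordan block of size at least 2 are at most some -ε<0 uniformly in i; without this it fails, e.g. for 2×2 Jordan blocks with eigenvalue -1/i and x_{i0}=(0,1/i). *)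

theory Defs
  imports
    "HOL-Analysis.Analysis"
    "Jordan_Normal_Form.Jordan_Normal_Form"
    "Jordan_Normal_Form.Gauss_Jordan_Elimination"
begin

(* Vectors and matrices are those of Jordan_Normal_Form.Matrix, because the dimensions vary
   with the index i. Several short names also exist in HOL-Analysis, hence the qualifiers. *)

section \<open>Norms, Jordan forms and the matrix exponential\<close>

definition euclidean_norm :: "'a::real_normed_vector Matrix.vec \<Rightarrow> real" where
  "euclidean_norm v = L2_set (\<lambda>k. norm (vec_index v k)) {..<dim_vec v}"

definition op_norm :: "'a::real_normed_field Matrix.mat \<Rightarrow> real" where
  "op_norm M = (SUP v\<in>{v \<in> carrier_vec (dim_col M). euclidean_norm v \<le> 1}. euclidean_norm (M *\<^sub>v v))"

abbreviation complex_mat :: "real Matrix.mat \<Rightarrow> complex Matrix.mat" where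
  "complex_mat M \<equiv> map_mat complex_of_real M"

(* The eigenvalues may be non-real, so the normal form is taken over the complex numbers.
   Q i is the inverse of P i, and the first conjunct says that P i * A i * Q i is the Jordan
   matrix with the list bs of (size, eigenvalue) pairs. *)
definition uniformly_normalizable :: "(nat \<Rightarrow> real Matrix.mat) \<Rightarrow> bool" where
  "uniformly_normalizable A \<longleftrightarrow>
     (\<exists>(P :: nat \<Rightarrow> complex Matrix.mat) Q C. C \<ge> 1 \<and>
       (\<forall>i. (\<exists>bs. 0 \<notin> fst ` set bs \<and>
              similar_mat_wit (jordan_matrix bs) (complex_mat (A i)) (P i) (Q i)) \<and>
            op_norm (P i) * op_norm (Q i) \<le> C))"

(* Some Jordan block for z has size at least 2: z has a generalized eigenvector of rank 2.
   This is needed for asymptotic stability: with A i the 2 x 2 Jordan block for -1/(i+1), all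
   eigenvalues are negative and P i = 1 normalizes, but the solution without control from
   x0 i = (0, 1/(i+1)) has norm tending to infinity. Stability requires that the real parts of
   the defective eigenvalues stay away from 0 uniformly in i. *)
definition defective_eigenvalue :: "complex Matrix.mat \<Rightarrow> complex \<Rightarrow> bool" where
  "defective_eigenvalue M z \<longleftrightarrow>
     (\<exists>v \<in> carrier_vec (dim_row M).
        char_matrix M z *\<^sub>v v \<noteq> 0\<^sub>v (dim_row M) \<and>
        char_matrix M z *\<^sub>v (char_matrix M z *\<^sub>v v) = 0\<^sub>v (dim_row M))"

definition mat_exp :: "real Matrix.mat \<Rightarrow> real Matrix.mat" where
  "mat_exp M = Matrix.mat (dim_row M) (dim_row M) (\<lambda>kl. \<Sum>m. (M ^\<^sub>m m) $$ kl / fact m)"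

section \<open>The state space\<close>

(* A state is a sequence x with x i in the Euclidean space of dimension d i; indices start at 0. *)
definition ell2 :: "(nat \<Rightarrow> nat) \<Rightarrow> (nat \<Rightarrow> real Matrix.vec) set" where
  "ell2 d = {x. (\<forall>i. x i \<in> carrier_vec (d i)) \<and> summable (\<lambda>i. (euclidean_norm (x i))\<^sup>2)}"

definition ell2_norm :: "(nat \<Rightarrow> real Matrix.vec) \<Rightarrow> real" where
  "ell2_norm x = sqrt (\<Sum>i. (euclidean_norm (x i))\<^sup>2)"

definition zero_state :: "(nat \<Rightarrow> nat) \<Rightarrow> nat \<Rightarrow> real Matrix.vec" where
  "zero_state d = (\<lambda>i. 0\<^sub>v (d i))"

section \<open>Controls and solutions\<close>

(* The set B(\<theta>) on the time interval [0,T]; the values of a control outside [0,T] are irrelevant.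
   The energy is an extended nonnegative real, so the bound includes its finiteness. *)
definition admissible_controls ::
    "(nat \<Rightarrow> nat) \<Rightarrow> real \<Rightarrow> real \<Rightarrow> (real \<Rightarrow> nat \<Rightarrow> real Matrix.vec) set" where
  "admissible_controls d \<theta> T =
     {w. (\<forall>s\<in>{0..T}. w s \<in> ell2 d) \<and>
         (\<forall>i. \<forall>k<d i. (\<lambda>s. vec_index (w s i) k) \<in> borel_measurable (lebesgue_on {0..T})) \<and>
         (\<Sum>i. \<integral>\<^sup>+ s. ennreal ((euclidean_norm (w s i))\<^sup>2) \<partial>lebesgue_on {0..T}) \<le> ennreal (\<theta>\<^sup>2)}"

definition trajectory ::
    "(nat \<Rightarrow> real Matrix.mat) \<Rightarrow> (nat \<Rightarrow> real Matrix.vec) \<Rightarrow> (real \<Rightarrow> nat \<Rightarrow> real Matrix.vec) \<Rightarrow>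
     real \<Rightarrow> nat \<Rightarrow> real Matrix.vec" where
  "trajectory A x0 w t i =
     mat_exp (t \<cdot>\<^sub>m A i) *\<^sub>v x0 i +
     Matrix.vec (dim_row (A i))
       (\<lambda>k. LINT s|lebesgue_on {0..t}. vec_index (mat_exp ((t - s) \<cdot>\<^sub>m A i) *\<^sub>v w s i) k)"

definition solution_on ::
    "real set \<Rightarrow> (nat \<Rightarrow> nat) \<Rightarrow> (nat \<Rightarrow> real Matrix.mat) \<Rightarrow> (nat \<Rightarrow> real Matrix.vec) \<Rightarrow>
     (real \<Rightarrow> nat \<Rightarrow> real Matrix.vec) \<Rightarrow> (real \<Rightarrow> nat \<Rightarrow> real Matrix.vec) \<Rightarrow> bool" where
  "solution_on I d A x0 w x \<longleftrightarrow> (\<forall>t\<in>I. x t \<in> ell2 d \<and> x t = trajectory A x0 w t)"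

section \<open>Stability, controllability and time optimality\<close>

definition globally_asymptotically_stable ::
    "(nat \<Rightarrow> nat) \<Rightarrow> (nat \<Rightarrow> real Matrix.mat) \<Rightarrow> bool" where
  "globally_asymptotically_stable d A \<longleftrightarrow>
     (\<forall>x0\<in>ell2 d. \<exists>x. solution_on {0..} d A x0 (\<lambda>s. zero_state d) x \<and>
        ((\<lambda>t. ell2_norm (x t)) \<longlongrightarrow> 0) at_top)"

definition steers_to_zero ::
    "(nat \<Rightarrow> nat) \<Rightarrow> (nat \<Rightarrow> real Matrix.mat) \<Rightarrow> real \<Rightarrow> (nat \<Rightarrow> real Matrix.vec) \<Rightarrow>
     (real \<Rightarrow> nat \<Rightarrow> real Matrix.vec) \<Rightarrow> real \<Rightarrow> bool" where
  "steers_to_zero d A \<theta> x0 u T \<longleftrightarrow>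
     T \<ge> 0 \<and> u \<in> admissible_controls d \<theta> T \<and>
     (\<exists>x. solution_on {0..T} d A x0 u x \<and> x T = zero_state d)"

definition null_controllable_from ::
    "(nat \<Rightarrow> nat) \<Rightarrow> (nat \<Rightarrow> real Matrix.mat) \<Rightarrow> real \<Rightarrow> (nat \<Rightarrow> real Matrix.vec) \<Rightarrow> bool" where
  "null_controllable_from d A \<theta> x0 \<longleftrightarrow> (\<exists>u T. steers_to_zero d A \<theta> x0 u T)"

definition null_controllable_in_large ::
    "(nat \<Rightarrow> nat) \<Rightarrow> (nat \<Rightarrow> real Matrix.mat) \<Rightarrow> real \<Rightarrow> bool" where
  "null_controllable_in_large d A \<theta> \<longleftrightarrow> (\<forall>x0\<in>ell2 d. null_controllable_from d A \<theta> x0)"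

definition optimal_time ::
    "(nat \<Rightarrow> nat) \<Rightarrow> (nat \<Rightarrow> real Matrix.mat) \<Rightarrow> real \<Rightarrow> (nat \<Rightarrow> real Matrix.vec) \<Rightarrow> real" where
  "optimal_time d A \<theta> x0 = Inf {T. \<exists>u. steers_to_zero d A \<theta> x0 u T}"

definition time_optimal_control ::
    "(nat \<Rightarrow> nat) \<Rightarrow> (nat \<Rightarrow> real Matrix.mat) \<Rightarrow> real \<Rightarrow> (nat \<Rightarrow> real Matrix.vec) \<Rightarrow>
     (real \<Rightarrow> nat \<Rightarrow> real Matrix.vec) \<Rightarrow> bool" where
  "time_optimal_control d A \<theta> x0 u \<longleftrightarrow> steers_to_zero d A \<theta> x0 u (optimal_time d A \<theta> x0)"

section \<open>The explicit control\<close>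

(* The integral over [0,T] of exp(-s M) exp(-s M)^T. *)
definition gramian :: "real Matrix.mat \<Rightarrow> real \<Rightarrow> real Matrix.mat" where
  "gramian M T = Matrix.mat (dim_row M) (dim_row M)
     (\<lambda>kl. LINT s|lebesgue_on {0..T}.
        (mat_exp ((- s) \<cdot>\<^sub>m M) * transpose_mat (mat_exp ((- s) \<cdot>\<^sub>m M))) $$ kl)"

definition gramian_inv :: "real Matrix.mat \<Rightarrow> real \<Rightarrow> real Matrix.mat" where
  "gramian_inv M T = the (mat_inverse (gramian M T))"

(* The control of least energy that brings x0 to zero at time T. *)
definition gramian_control ::
    "(nat \<Rightarrow> real Matrix.mat) \<Rightarrow> (nat \<Rightarrow> real Matrix.vec) \<Rightarrow> real \<Rightarrow> real \<Rightarrow> nat \<Rightarrow> real Matrix.vec" where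
  "gramian_control A x0 T s i =
     - (transpose_mat (mat_exp ((- s) \<cdot>\<^sub>m A i)) *\<^sub>v (gramian_inv (A i) T *\<^sub>v x0 i))"

(* The energy of the i-th coordinate of that control. *)
definition gramian_energy ::
    "(nat \<Rightarrow> real Matrix.mat) \<Rightarrow> (nat \<Rightarrow> real Matrix.vec) \<Rightarrow> real \<Rightarrow> nat \<Rightarrow> real" where
  "gramian_energy A x0 T i = scalar_prod (x0 i) (gramian_inv (A i) T *\<^sub>v x0 i)"

end

theory Submission
  imports Defs "HOL-Real_Asymp.Real_Asymp"
begin

text \<open>
  The entries of the exponential of a Jordan matrix are $t^j e^{tz} / j!$, so uniform
  normalizability bounds $\|e^{tA_i}\|$ by a constant times $e^t$, uniformly in \<open>i\<close>; for fixed \<open>i\<close> it tends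
  to 0, and if the defective eigenvalues stay away from the imaginary axis it is bounded uniformly in
  \<open>i\<close> and \<open>t\<close>. Stability is then dominated convergence for series.

  Since \<open>v = (e\<^sup>s\<^sup>A)\<^sup>T (e\<^sup>-\<^sup>s\<^sup>A)\<^sup>T v\<close>, upper bounds for \<open>e\<^sup>s\<^sup>A\<close> are lower bounds for the
  Gramian \<open>W(T)\<close>. Steering \<open>x\<close> to 0 in time \<open>T\<close> costs at least the energy
  \<open>x \<bullet> W(T)\<^sup>-\<^sup>1 x = sup\<^sub>y (2 x \<bullet> y - y \<bullet> W(T) y)\<close>, attained by the Gramian control. By this
  variational formula the energy is strictly decreasing and locally Lipschitz in \<open>T\<close>; it
  blows up at 0 and tends to 0 at infinity. The same holds, again by dominated convergence, for the
  sum over \<open>i\<close>, and the optimal time is where this sum equals \<open>\<theta>\<^sup>2\<close>.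
\<close>

text \<open>Two features of the family shape the proof. The eigenvalues may approach the imaginary
  axis, so no decay rate, and without the gap not even a time-independent bound, is common to all
  \<open>i\<close>. Their real parts may also tend to minus infinity, so the norms of
  \<open>e^(-sA_i)\<close> need not be bounded in \<open>i\<close> for a fixed s > 0. Hence the
  estimates uniform in \<open>i\<close> are upper bounds for \<open>e^(sA_i)\<close>, that is, lower
  bounds for the Gramians and upper bounds for the energies; they make the total energy finite at
  each positive time. Upper bounds for the Gramians, which give the Lipschitz constants and the
  blow-up, hold for one coordinate at a time. This suffices: since energies decrease in
  \<open>T\<close>, their values at one earlier time dominate, and one nonzero coordinate gives
  blow-up and strict decrease of the sum. Two times are always compared by inserting the optimal
  \<open>y\<close> for one of them into the variational formula for the other, so
  \<open>gramian_inv\<close> is never differentiated.\<close>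

unbundle no inner_syntax and no vec_syntax

section \<open>Euclidean norms\<close>

lemma euclidean_norm_nonneg [simp]: "0 \<le> euclidean_norm v"
  by (simp add: euclidean_norm_def)

lemma euclidean_norm_sq:
  assumes "v \<in> carrier_vec n"
  shows "(euclidean_norm v)\<^sup>2 = (\<Sum>k<n. (norm (vec_index v k))\<^sup>2)"
  using assms by (auto simp: euclidean_norm_def L2_set_def sum_nonneg)

lemma euclidean_norm_sq_real:
  fixes v :: "real Matrix.vec"
  shows "(euclidean_norm v)\<^sup>2 = scalar_prod v v"
  unfolding euclidean_norm_sq[OF carrier_vec_dim_vec]
  by (simp add: scalar_prod_def lessThan_atLeast0) (simp add: power2_eq_square)

lemma norm_vec_index_le:
  assumes "v \<in> carrier_vec n" "k < n"
  shows "norm (vec_index v k) \<le> euclidean_norm v"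
  using assms member_le_L2_set[of "{..<n}" k "\<lambda>k. norm (vec_index v k)"]
  by (auto simp: euclidean_norm_def)

lemma euclidean_norm_zero [simp]: "euclidean_norm (0\<^sub>v n) = 0"
  by (simp add: euclidean_norm_def L2_set_def)

lemma euclidean_norm_eq_0:
  assumes "v \<in> carrier_vec n" "euclidean_norm v = 0"
  shows "v = 0\<^sub>v n"
  using norm_vec_index_le[OF assms(1)] assms by (intro eq_vecI) auto

lemma euclidean_norm_pos:
  fixes y :: "real Matrix.vec"
  assumes "y \<in> carrier_vec n" "y \<noteq> 0\<^sub>v n"
  shows "0 < euclidean_norm y"
  using euclidean_norm_eq_0[OF assms(1)] assms(2) by (auto simp: less_le)

lemma euclidean_norm_smult:
  fixes c :: "'a::real_normed_field"
  shows "euclidean_norm (c \<cdot>\<^sub>v v) = norm c * euclidean_norm v"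
proof -
  have "L2_set (\<lambda>k. norm c * norm (vec_index v k)) {..<dim_vec v} =
      norm c * L2_set (\<lambda>k. norm (vec_index v k)) {..<dim_vec v}"
    by (simp add: L2_set_right_distrib)
  moreover have "L2_set (\<lambda>k. norm (vec_index (c \<cdot>\<^sub>v v) k)) {..<dim_vec v} =
      L2_set (\<lambda>k. norm c * norm (vec_index v k)) {..<dim_vec v}"
    by (intro L2_set_cong) (auto simp: norm_mult)
  ultimately show ?thesis by (simp add: euclidean_norm_def)
qed

lemma euclidean_norm_uminus [simp]: "euclidean_norm (- v) = euclidean_norm v"
  by (auto simp: euclidean_norm_def intro!: L2_set_cong)

lemma euclidean_norm_add_le:
  assumes "v \<in> carrier_vec n" "w \<in> carrier_vec n"
  shows "euclidean_norm (v + w) \<le> euclidean_norm v + euclidean_norm w"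
proof -
  have "euclidean_norm (v + w) \<le> L2_set (\<lambda>k. norm (vec_index v k) + norm (vec_index w k)) {..<n}"
    using assms unfolding euclidean_norm_def
    by (auto intro!: L2_set_mono norm_triangle_ineq)
  also have "\<dots> \<le> euclidean_norm v + euclidean_norm w"
    using assms L2_set_triangle_ineq[of "\<lambda>k. norm (vec_index v k)" "\<lambda>k. norm (vec_index w k)" "{..<n}"]
    by (auto simp: euclidean_norm_def)
  finally show ?thesis .
qed

lemma euclidean_norm_map_complex [simp]:
  "euclidean_norm (map_vec complex_of_real v) = euclidean_norm v"
  by (auto simp: euclidean_norm_def intro!: L2_set_cong)

lemma norm_scalar_prod_le:
  fixes v :: "'a::real_normed_field Matrix.vec"
  assumes "v \<in> carrier_vec n" "w \<in> carrier_vec n"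
  shows "norm (scalar_prod v w) \<le> euclidean_norm v * euclidean_norm w"
proof -
  have "norm (scalar_prod v w) \<le> (\<Sum>k<n. norm (vec_index v k) * norm (vec_index w k))"
    using assms unfolding scalar_prod_def
    by (auto simp: lessThan_atLeast0 norm_mult intro!: sum_norm_le)
  also have "\<dots> \<le> euclidean_norm v * euclidean_norm w"
    using assms L2_set_mult_ineq[of "\<lambda>k. norm (vec_index v k)" "\<lambda>k. norm (vec_index w k)" "{..<n}"]
    by (auto simp: euclidean_norm_def)
  finally show ?thesis .
qed

text \<open>Only a constant depending on the dimensions is wanted: the Euclidean norm is at most the
  sum of \<open>m\<close> coordinates, and each row contributes \<open>n\<close> products.\<close>

lemma euclidean_norm_mult_mat_vec_le:
  fixes M :: "'a::real_normed_field Matrix.mat"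
  assumes M: "M \<in> carrier_mat m n" and v: "v \<in> carrier_vec n"
    and B: "\<And>k l. k < m \<Longrightarrow> l < n \<Longrightarrow> norm (M $$ (k, l)) \<le> B" and B0: "0 \<le> B"
  shows "euclidean_norm (M *\<^sub>v v) \<le> real m * real n * B * euclidean_norm v"
proof -
  have "norm (vec_index (M *\<^sub>v v) k) \<le> real n * B * euclidean_norm v" if k: "k < m" for k
  proof -
    have "norm (scalar_prod (row M k) v) \<le> (\<Sum>l<n. B * euclidean_norm v)"
      unfolding scalar_prod_def using M v k B B0 norm_vec_index_le[OF v]
      by (auto simp: lessThan_atLeast0 norm_mult simp del: sum_constant intro!: sum_norm_le mult_mono)
    then show ?thesis using M k by simp
  qed
  moreover have "euclidean_norm (M *\<^sub>v v) \<le> (\<Sum>k<m. norm (vec_index (M *\<^sub>v v) k))"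
    using M L2_set_le_sum[of "{..<m}" "\<lambda>k. norm (vec_index (M *\<^sub>v v) k)"]
    by (auto simp: euclidean_norm_def)
  ultimately show ?thesis
    using sum_bounded_above[of "{..<m}" "\<lambda>k. norm (vec_index (M *\<^sub>v v) k)" "real n * B * euclidean_norm v"]
    by (auto simp: mult.assoc)
qed

text \<open>The supremum in \<open>op_norm\<close> is meaningful only over a bounded set of reals;
  the entrywise bound supplies that, and scaling \<open>v\<close> to norm 1 does the rest.\<close>

lemma op_norm_bound:
  fixes M :: "'a::real_normed_field Matrix.mat"
  assumes M: "M \<in> carrier_mat m n" and v: "v \<in> carrier_vec n"
  shows "euclidean_norm (M *\<^sub>v v) \<le> op_norm M * euclidean_norm v"
proof (cases "euclidean_norm v = 0")
  case True
  then have "v = 0\<^sub>v n" using euclidean_norm_eq_0[OF v] by simp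
  then have "M *\<^sub>v v = 0\<^sub>v m" using M by auto
  then show ?thesis using True by simp
next
  case False
  \<comment> \<open>The inserted 0 keeps \<open>Max\<close> meaningful for an empty matrix and makes
    \<open>B\<close> nonnegative.\<close>
  define B where "B = Max (insert 0 ((\<lambda>(k,l). norm (M $$ (k, l))) ` ({..<m} \<times> {..<n})))"
  have B: "norm (M $$ (k, l)) \<le> B" if "k < m" "l < n" for k l
    unfolding B_def using that by (intro Max_ge) auto
  have B0: "0 \<le> B" unfolding B_def by (intro Max_ge) auto
  let ?S = "{v :: 'a Matrix.vec. v \<in> carrier_vec (dim_col M) \<and> euclidean_norm v \<le> 1}"
  have bdd: "bdd_above ((\<lambda>v. euclidean_norm (M *\<^sub>v v)) ` ?S)"
  proof (rule bdd_aboveI2)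
    fix w assume w: "w \<in> ?S"
    then have "euclidean_norm (M *\<^sub>v w) \<le> real m * real n * B * euclidean_norm w"
      using M by (intro euclidean_norm_mult_mat_vec_le[OF M _ B B0]) auto
    also have "\<dots> \<le> real m * real n * B * 1" using w B0 by (intro mult_left_mono) auto
    finally show "euclidean_norm (M *\<^sub>v w) \<le> real m * real n * B * 1" .
  qed
  define c where "c = euclidean_norm v"
  have c: "c > 0" using False by (simp add: c_def less_le)
  have "euclidean_norm (M *\<^sub>v (of_real (inverse c) \<cdot>\<^sub>v v)) \<le> op_norm M"
    unfolding op_norm_def using M v c
    by (intro cSUP_upper[OF _ bdd]) (auto simp: euclidean_norm_smult c_def simp flip: of_real_inverse)
  also have "M *\<^sub>v (of_real (inverse c) \<cdot>\<^sub>v v) = of_real (inverse c) \<cdot>\<^sub>v (M *\<^sub>v v)"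
    using mult_mat_vec[OF M v] .
  finally have "inverse c * euclidean_norm (M *\<^sub>v v) \<le> op_norm M"
    using c by (simp add: euclidean_norm_smult del: of_real_inverse)
  then show ?thesis using c by (simp add: c_def field_simps)
qed

lemma op_norm_nonneg:
  fixes M :: "'a::real_normed_field Matrix.mat"
  assumes "0 < dim_col M"
  shows "0 \<le> op_norm M"
proof -
  let ?e = "unit_vec (dim_col M) 0 :: 'a Matrix.vec"
  have "vec_index ?e 0 = 1" using assms by simp
  then have "1 \<le> euclidean_norm ?e"
    using norm_vec_index_le[of ?e "dim_col M" 0] assms by simp
  moreover have "0 \<le> op_norm M * euclidean_norm ?e"
    using op_norm_bound[of M "dim_row M" "dim_col M" ?e]
    by (simp add: order_trans[OF euclidean_norm_nonneg])
  ultimately show ?thesis by (simp add: zero_le_mult_iff)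
qed

section \<open>The matrix exponential\<close>

lemma pow_mat_smult:
  assumes "(A :: 'a::comm_ring_1 Matrix.mat) \<in> carrier_mat n n"
  shows "(t \<cdot>\<^sub>m A) ^\<^sub>m m = t ^ m \<cdot>\<^sub>m (A ^\<^sub>m m)"
proof (induction m)
  case 0
  then show ?case using assms by auto
next
  case (Suc m)
  have "(t ^ m \<cdot>\<^sub>m (A ^\<^sub>m m)) * (t \<cdot>\<^sub>m A) = t \<cdot>\<^sub>m (t ^ m \<cdot>\<^sub>m (A ^\<^sub>m m * A))"
    using assms by (simp add: mult_smult_distrib[of _ n n] mult_smult_assoc_mat[of _ n n])
  also have "\<dots> = t ^ Suc m \<cdot>\<^sub>m (A ^\<^sub>m m * A)"
    by (intro eq_matI) auto
  finally show ?case using Suc by simp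
qed

lemma pow_mat_add:
  assumes "(A :: 'a::semiring_1 Matrix.mat) \<in> carrier_mat n n"
  shows "A ^\<^sub>m (i + j) = A ^\<^sub>m i * A ^\<^sub>m j"
proof (induction j)
  case 0
  then show ?case using assms right_mult_one_mat[of "A ^\<^sub>m i" n n] by simp
next
  case (Suc j)
  then show ?case
    using assms assoc_mult_mat[of "A ^\<^sub>m i" n n "A ^\<^sub>m j" n A n] by simp
qed

lemma index_mult_mat_sum:
  assumes "M \<in> carrier_mat m n" "N \<in> carrier_mat n p" "k < m" "l < p"
  shows "(M * N) $$ (k, l) = (\<Sum>j<n. M $$ (k, j) * N $$ (j, l))"
  using assms by (simp add: scalar_prod_def lessThan_atLeast0)

lemma index_mult_mat_vec_sum:
  assumes "M \<in> carrier_mat m n" "v \<in> carrier_vec n" "k < m"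
  shows "vec_index (M *\<^sub>v v) k = (\<Sum>j<n. M $$ (k, j) * vec_index v j)"
  using assms by (simp add: scalar_prod_def lessThan_atLeast0)

lemma norm_pow_mat_index_le:
  fixes A :: "'a::real_normed_field Matrix.mat"
  assumes A: "A \<in> carrier_mat n n"
    and B: "\<And>k l. k < n \<Longrightarrow> l < n \<Longrightarrow> norm (A $$ (k, l)) \<le> B" and kl: "k < n" "l < n"
  shows "norm ((A ^\<^sub>m m) $$ (k, l)) \<le> (real n * B) ^ m"
  using kl(2)
proof (induction m arbitrary: l)
  case 0
  then show ?case using A kl by simp
next
  case (Suc m)
  have B0: "0 \<le> B"
    using B[OF kl] by (rule order_trans[OF norm_ge_zero])
  have "norm (\<Sum>j<n. (A ^\<^sub>m m) $$ (k, j) * A $$ (j, l)) \<le> (\<Sum>j<n. (real n * B) ^ m * B)"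
    using Suc B B0 by (intro sum_norm_le) (auto simp: norm_mult intro!: mult_mono)
  also have "(\<Sum>j<n. (A ^\<^sub>m m) $$ (k, j) * A $$ (j, l)) = (A ^\<^sub>m Suc m) $$ (k, l)"
    using index_mult_mat_sum[OF pow_carrier_mat[OF A] A kl(1) Suc.prems] by simp
  finally show ?case by (simp add: mult_ac)
qed

text \<open>Written as a power series in \<open>t\<close>, so that convergence everywhere yields
  continuity in \<open>t\<close>. The scalar field is general because the series is also needed for
  complex Jordan matrices.\<close>

lemma summable_pow_mat_index:
  fixes A :: "'a::{real_normed_field,banach} Matrix.mat"
  assumes A: "A \<in> carrier_mat n n" and kl: "k < n" "l < n"
  shows "summable (\<lambda>m. norm ((A ^\<^sub>m m) $$ (k, l) / fact m * t ^ m))"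
proof -
  define B where "B = Max ((\<lambda>(k,l). norm (A $$ (k, l))) ` ({..<n} \<times> {..<n}))"
  have B: "norm (A $$ (k, l)) \<le> B" if "k < n" "l < n" for k l
    unfolding B_def using that by (intro Max_ge) auto
  show ?thesis
  proof (rule summable_comparison_test'[of _ 0])
    show "summable (\<lambda>m. norm ((real n * B * norm t) ^ m /\<^sub>R fact m))"
      by (rule summable_norm_exp)
    fix m
    have "0 \<le> B"
      using B[OF kl] by (rule order_trans[OF norm_ge_zero])
    then have "norm ((real n * B * norm t) ^ m /\<^sub>R fact m) = (real n * B) ^ m * (norm t ^ m / fact m)"
      by (simp add: abs_mult power_mult_distrib divide_inverse mult_ac)
    moreover have "norm ((A ^\<^sub>m m) $$ (k, l) / fact m * t ^ m) =
        norm ((A ^\<^sub>m m) $$ (k, l)) * (norm t ^ m / fact m)"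
      by (simp add: norm_mult norm_divide norm_power)
    moreover have "norm ((A ^\<^sub>m m) $$ (k, l)) * (norm t ^ m / fact m) \<le> (real n * B) ^ m * (norm t ^ m / fact m)"
      by (intro mult_right_mono norm_pow_mat_index_le[OF A B kl]) auto
    ultimately show "norm (norm ((A ^\<^sub>m m) $$ (k, l) / fact m * t ^ m))
        \<le> norm ((real n * B * norm t) ^ m /\<^sub>R fact m)"
      by simp
  qed
qed

lemma mat_exp_carrier [simp]: "A \<in> carrier_mat n n \<Longrightarrow> mat_exp A \<in> carrier_mat n n"
  by (simp add: mat_exp_def)

lemma mat_exp_dim [simp]: "dim_row (mat_exp A) = dim_row A" "dim_col (mat_exp A) = dim_row A"
  by (simp_all add: mat_exp_def)

lemma mat_exp_mult_vec_carrier [simp]: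
  assumes "A \<in> carrier_mat n n"
  shows "mat_exp (t \<cdot>\<^sub>m A) *\<^sub>v v \<in> carrier_vec n"
    and "transpose_mat (mat_exp (t \<cdot>\<^sub>m A)) *\<^sub>v v \<in> carrier_vec n"
  using assms by (simp_all add: carrier_vecI)

lemma mat_exp_smult_index:
  assumes "A \<in> carrier_mat n n" "k < n" "l < n"
  shows "mat_exp (t \<cdot>\<^sub>m A) $$ (k, l) = (\<Sum>m. (A ^\<^sub>m m) $$ (k, l) / fact m * t ^ m)"
  using assms by (auto simp: mat_exp_def pow_mat_smult[of A n] mult_ac intro!: suminf_cong)

text \<open>Entrywise Cauchy products for each inner index \<open>j\<close>. Summing over
  \<open>j\<close> recombines \<open>A ^\<^sub>m i * A ^\<^sub>m (m - i)\<close> into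
  \<open>A ^\<^sub>m m\<close>, which leaves the scalar binomial identity for
  \<open>(s + t) ^ m / fact m\<close>.\<close>

lemma mat_exp_add:
  assumes A: "A \<in> carrier_mat n n"
  shows "mat_exp ((s + t) \<cdot>\<^sub>m A) = mat_exp (s \<cdot>\<^sub>m A) * mat_exp (t \<cdot>\<^sub>m A)"
proof (rule eq_matI)
  fix k l
  assume "k < dim_row (mat_exp (s \<cdot>\<^sub>m A) * mat_exp (t \<cdot>\<^sub>m A))"
    and "l < dim_col (mat_exp (s \<cdot>\<^sub>m A) * mat_exp (t \<cdot>\<^sub>m A))"
  then have kl: "k < n" "l < n" using A by (auto simp: mat_exp_def)
  define a where "a t k l m = (A ^\<^sub>m m) $$ (k, l) / fact m * t ^ m" for t k l m
  have sm: "summable (\<lambda>m. norm (a t k l m))" if "k < n" "l < n" for t k l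
    unfolding a_def using summable_pow_mat_index[OF A that] .
  have conv: "(\<Sum>j<n. \<Sum>i\<le>m. a s k j i * a t j l (m - i)) = a (s + t) k l m" for m
  proof -
    have "(\<Sum>j<n. \<Sum>i\<le>m. a s k j i * a t j l (m - i)) =
        (\<Sum>i\<le>m. \<Sum>j<n. a s k j i * a t j l (m - i))"
      by (rule sum.swap)
    also have "\<dots> = (\<Sum>i\<le>m. (A ^\<^sub>m m) $$ (k, l) * ((s ^ i /\<^sub>R fact i) * (t ^ (m - i) /\<^sub>R fact (m - i))))"
    proof (rule sum.cong[OF refl])
      fix i assume "i \<in> {..m}"
      then have "(A ^\<^sub>m m) $$ (k, l) = (\<Sum>j<n. (A ^\<^sub>m i) $$ (k, j) * (A ^\<^sub>m (m - i)) $$ (j, l))"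
        using pow_mat_add[OF A, of i "m - i"] index_mult_mat_sum[of "A ^\<^sub>m i" n n "A ^\<^sub>m (m - i)" n k l] A kl
        by simp
      then show "(\<Sum>j<n. a s k j i * a t j l (m - i)) =
          (A ^\<^sub>m m) $$ (k, l) * ((s ^ i /\<^sub>R fact i) * (t ^ (m - i) /\<^sub>R fact (m - i)))"
        by (simp add: a_def sum_distrib_left divide_inverse mult_ac)
    qed
    also have "\<dots> = (A ^\<^sub>m m) $$ (k, l) * ((s + t) ^ m /\<^sub>R fact m)"
      by (subst exp_series_add_commuting) (simp_all add: sum_distrib_left mult.commute)
    finally show ?thesis by (simp add: a_def divide_inverse mult_ac)
  qed
  have "(mat_exp (s \<cdot>\<^sub>m A) * mat_exp (t \<cdot>\<^sub>m A)) $$ (k, l) =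
      (\<Sum>j<n. (\<Sum>m. a s k j m) * (\<Sum>m. a t j l m))"
    using A kl by (simp add: index_mult_mat_sum[of _ n n _ n] mat_exp_smult_index a_def del: index_mult_mat)
  also have "(\<lambda>m. \<Sum>j<n. \<Sum>i\<le>m. a s k j i * a t j l (m - i)) sums \<dots>"
    using kl by (intro sums_sum Cauchy_product_sums sm) auto
  then have "(\<Sum>j<n. (\<Sum>m. a s k j m) * (\<Sum>m. a t j l m)) = (\<Sum>m. a (s + t) k l m)"
    unfolding conv by (simp add: sums_iff)
  also have "\<dots> = mat_exp ((s + t) \<cdot>\<^sub>m A) $$ (k, l)"
    using A kl by (simp add: mat_exp_smult_index a_def)
  finally show "mat_exp ((s + t) \<cdot>\<^sub>m A) $$ (k, l) = (mat_exp (s \<cdot>\<^sub>m A) * mat_exp (t \<cdot>\<^sub>m A)) $$ (k, l)" ..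
qed (use A in \<open>auto simp: mat_exp_def\<close>)

lemma mat_exp_zero:
  assumes A: "A \<in> carrier_mat n n"
  shows "mat_exp (0 \<cdot>\<^sub>m A) = 1\<^sub>m n"
proof (rule eq_matI)
  fix k l assume "k < dim_row (1\<^sub>m n)" "l < dim_col (1\<^sub>m n)"
  then have kl: "k < n" "l < n" by auto
  show "mat_exp (0 \<cdot>\<^sub>m A) $$ (k, l) = 1\<^sub>m n $$ (k, l)"
    unfolding mat_exp_smult_index[OF A kl] powser_zero using A kl by simp
qed (use A in \<open>auto simp: mat_exp_def\<close>)

lemma mat_exp_inverse:
  assumes A: "A \<in> carrier_mat n n"
  shows "mat_exp ((- t) \<cdot>\<^sub>m A) * mat_exp (t \<cdot>\<^sub>m A) = 1\<^sub>m n"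
    and "mat_exp (t \<cdot>\<^sub>m A) * mat_exp ((- t) \<cdot>\<^sub>m A) = 1\<^sub>m n"
  using mat_exp_add[OF A, of "- t" t] mat_exp_add[OF A, of t "- t"] mat_exp_zero[OF A] by simp_all

lemma continuous_mat_exp_index [continuous_intros]:
  assumes A: "A \<in> carrier_mat n n" and kl: "k < n" "l < n" and f: "continuous_on S f"
  shows "continuous_on S (\<lambda>s. mat_exp (f s \<cdot>\<^sub>m A) $$ (k, l))"
proof -
  have "isCont (\<lambda>t. \<Sum>m. (A ^\<^sub>m m) $$ (k, l) / fact m * t ^ m) t" for t :: real
    by (rule isCont_powser_converges_everywhere)
      (rule summable_norm_cancel[OF summable_pow_mat_index[OF A kl]])
  then have "continuous_on UNIV (\<lambda>t. mat_exp (t \<cdot>\<^sub>m A) $$ (k, l))"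
    unfolding mat_exp_smult_index[OF A kl] by (simp add: continuous_at_imp_continuous_on)
  then show ?thesis by (rule continuous_on_compose2[OF _ f]) auto
qed

section \<open>Bounds from the Jordan normal form\<close>

lemma pow_over_fact_le_exp:
  fixes x :: real
  assumes "0 \<le> x"
  shows "x ^ j / fact j \<le> exp x"
proof -
  have "(\<Sum>n\<in>{j}. x ^ n /\<^sub>R fact n) \<le> (\<Sum>n. x ^ n /\<^sub>R fact n)"
    using assms by (intro sum_le_suminf summable_exp_generic) auto
  then show ?thesis by (simp add: exp_def divide_inverse mult.commute)
qed

lemma jordan_matrix_Cons:
  "jordan_matrix ((b, z) # bs) = four_block_mat (jordan_block b z)
     (0\<^sub>m b (sum_list (map fst bs))) (0\<^sub>m (sum_list (map fst bs)) b) (jordan_matrix bs)"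
  using jordan_matrix_dim[of bs] by (simp add: jordan_matrix_def Let_def)

lemma jordan_matrix_Cons_pow:
  fixes z :: "'a::comm_ring_1"
  shows "jordan_matrix ((b, z) # bs) ^\<^sub>m m = four_block_mat (jordan_block b z ^\<^sub>m m)
     (0\<^sub>m b (sum_list (map fst bs))) (0\<^sub>m (sum_list (map fst bs)) b) (jordan_matrix bs ^\<^sub>m m)"
  unfolding jordan_matrix_Cons
  by (rule pow_four_block_mat) auto

text \<open>The case and the witnesses are chosen before \<open>m\<close>, so that the exponential
  series of an entry can be summed in closed form. Here \<open>j\<close> is the distance from the
  diagonal inside a block; zeros come from below the diagonal and from outside the blocks.\<close>

lemma jordan_matrix_pow_index:
  fixes bs :: "(nat \<times> 'a::comm_ring_1) list"
  assumes "k < sum_list (map fst bs)" "l < sum_list (map fst bs)"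
  shows "(\<forall>m. (jordan_matrix bs ^\<^sub>m m) $$ (k, l) = 0) \<or>
    (\<exists>b z j. (b, z) \<in> set bs \<and> j < b \<and>
       (\<forall>m. (jordan_matrix bs ^\<^sub>m m) $$ (k, l) = of_nat (m choose j) * z ^ (m - j)))"
  using assms
proof (induction bs arbitrary: k l)
  case (Cons bz bs)
  obtain b z where bz: "bz = (b, z)" by fastforce
  let ?N = "sum_list (map fst bs)"
  have dims: "dim_row (jordan_matrix bs ^\<^sub>m m) = ?N" "dim_col (jordan_matrix bs ^\<^sub>m m) = ?N" for m
    using pow_mat_dim_square[OF jordan_matrix_carrier] by auto
  consider "k < b" "l < b" | "k \<ge> b" "l \<ge> b" | "k < b \<and> l \<ge> b \<or> k \<ge> b \<and> l < b" by linarith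
  then show ?case
  proof cases
    case 1
    \<comment> \<open>For \<open>m < l - k\<close> the exponent is truncated, but there the binomial
      coefficient is 0.\<close>
    then have eq: "(jordan_matrix (bz # bs) ^\<^sub>m m) $$ (k, l) =
        (if k \<le> l then of_nat (m choose (l - k)) * z ^ (m + k - l) else 0)" for m
      unfolding bz jordan_matrix_Cons_pow by (simp add: dims) (simp add: jordan_block_pow binomial_eq_0)
    show ?thesis
    proof (cases "k \<le> l")
      case True
      then have "(jordan_matrix (bz # bs) ^\<^sub>m m) $$ (k, l) =
          of_nat (m choose (l - k)) * z ^ (m - (l - k))" for m
        using eq[of m] by simp
      moreover have "l - k < b" using 1 by simp
      ultimately show ?thesis unfolding bz by (metis list.set_intros(1))
    qed (simp add: eq)
  next
    case 2
    then have eq: "(jordan_matrix (bz # bs) ^\<^sub>m m) $$ (k, l) =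
        (jordan_matrix bs ^\<^sub>m m) $$ (k - b, l - b)" for m
      using Cons.prems unfolding bz jordan_matrix_Cons_pow by (simp add: dims)
    have "k - b < ?N" "l - b < ?N" using 2 Cons.prems by (auto simp: bz)
    from Cons.IH[OF this] show ?thesis unfolding eq by (metis list.set_intros(2))
  next
    case 3
    then have "(jordan_matrix (bz # bs) ^\<^sub>m m) $$ (k, l) = 0" for m
      using Cons.prems unfolding bz jordan_matrix_Cons_pow by (auto simp: dims)
    then show ?thesis by blast
  qed
qed simp

text \<open>In a block of size at least 2 the unit vectors e_1 and e_0 form a Jordan chain, and
  padding with zeros carries it past the other blocks. The chain is the source of the vector
  required by \<open>defective_eigenvalue\<close>.\<close>

lemma jordan_matrix_chain:
  fixes bs :: "(nat \<times> 'a::field) list"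
  assumes "(b, z) \<in> set bs" "2 \<le> b"
  shows "\<exists>v w. v \<in> carrier_vec (sum_list (map fst bs)) \<and> w \<in> carrier_vec (sum_list (map fst bs)) \<and>
    w \<noteq> 0\<^sub>v (sum_list (map fst bs)) \<and>
    jordan_matrix bs *\<^sub>v v = z \<cdot>\<^sub>v v + w \<and> jordan_matrix bs *\<^sub>v w = z \<cdot>\<^sub>v w"
  using assms(1)
proof (induction bs)
  case (Cons cy bs)
  obtain c y where cy: "cy = (c, y)" by fastforce
  let ?N = "sum_list (map fst bs)"
  have mv: "jordan_matrix (cy # bs) *\<^sub>v (v @\<^sub>v w) = (jordan_block c y *\<^sub>v v) @\<^sub>v (jordan_matrix bs *\<^sub>v w)"
    if "v \<in> carrier_vec c" "w \<in> carrier_vec ?N" for v w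
    unfolding cy jordan_matrix_Cons using that by (intro mult_mat_vec_split) auto
  show ?case
  proof (cases "(b, z) \<in> set bs")
    case True
    then obtain v w where vw: "v \<in> carrier_vec ?N" "w \<in> carrier_vec ?N" "w \<noteq> 0\<^sub>v ?N"
      "jordan_matrix bs *\<^sub>v v = z \<cdot>\<^sub>v v + w" "jordan_matrix bs *\<^sub>v w = z \<cdot>\<^sub>v w"
      using Cons.IH by blast
    obtain k where k: "k < ?N" "vec_index w k \<noteq> 0"
      using vw(2,3) by (metis carrier_vecD eq_vecI index_zero_vec(1) index_zero_vec(2))
    have "0\<^sub>v c @\<^sub>v w \<noteq> 0\<^sub>v (c + ?N)"
    proof
      assume eq: "0\<^sub>v c @\<^sub>v w = 0\<^sub>v (c + ?N)"
      have "vec_index (0\<^sub>v c @\<^sub>v w) (c + k) = 0" unfolding eq using k by simp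
      then show False using k vw by simp
    qed
    moreover have z: "jordan_block c y *\<^sub>v 0\<^sub>v c = 0\<^sub>v c" by auto
    have "jordan_matrix (cy # bs) *\<^sub>v (0\<^sub>v c @\<^sub>v v) = z \<cdot>\<^sub>v (0\<^sub>v c @\<^sub>v v) + (0\<^sub>v c @\<^sub>v w)"
      using vw by (subst mv) (auto simp: z)
    moreover have "jordan_matrix (cy # bs) *\<^sub>v (0\<^sub>v c @\<^sub>v w) = z \<cdot>\<^sub>v (0\<^sub>v c @\<^sub>v w)"
      using vw by (subst mv) (auto simp: z)
    ultimately show ?thesis using vw
      by (intro exI[of _ "0\<^sub>v c @\<^sub>v v"] exI[of _ "0\<^sub>v c @\<^sub>v w"]) (auto simp: cy)
  next
    case False
    then have cy: "cy = (b, z)" and c: "c = b" and y: "y = z" using Cons.prems cy by auto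
    let ?v = "unit_vec b 1 :: 'a Matrix.vec" and ?w = "unit_vec b 0 :: 'a Matrix.vec"
    have z: "jordan_matrix bs *\<^sub>v 0\<^sub>v ?N = 0\<^sub>v ?N" by auto
    have v: "jordan_block b z *\<^sub>v ?v = z \<cdot>\<^sub>v ?v + ?w"
      using assms(2) by (intro eq_vecI) auto
    have w: "jordan_block b z *\<^sub>v ?w = z \<cdot>\<^sub>v ?w"
      using assms(2) by (intro eq_vecI) auto
    have "?w @\<^sub>v 0\<^sub>v ?N \<noteq> 0\<^sub>v (b + ?N)"
    proof
      assume eq: "?w @\<^sub>v 0\<^sub>v ?N = 0\<^sub>v (b + ?N)"
      have "vec_index (?w @\<^sub>v 0\<^sub>v ?N) 0 = 0" unfolding eq using assms by simp
      then show False using assms by simp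
    qed
    moreover have "jordan_matrix (cy # bs) *\<^sub>v (?v @\<^sub>v 0\<^sub>v ?N) = z \<cdot>\<^sub>v (?v @\<^sub>v 0\<^sub>v ?N) + (?w @\<^sub>v 0\<^sub>v ?N)"
      using mv[of ?v "0\<^sub>v ?N"] unfolding c y v z by (auto intro!: eq_vecI)
    moreover have "jordan_matrix (cy # bs) *\<^sub>v (?w @\<^sub>v 0\<^sub>v ?N) = z \<cdot>\<^sub>v (?w @\<^sub>v 0\<^sub>v ?N)"
      using mv[of ?w "0\<^sub>v ?N"] unfolding c y w z by (auto intro!: eq_vecI)
    ultimately show ?thesis
      by (intro exI[of _ "?v @\<^sub>v 0\<^sub>v ?N"] exI[of _ "?w @\<^sub>v 0\<^sub>v ?N"]) (auto simp: cy)
  qed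
qed simp

text \<open>The terms with \<open>m < j\<close> vanish; after a shift by \<open>j\<close> the
  factorials cancel and leave \<open>t ^ j / fact j\<close> times the series of
  \<open>exp (t * z)\<close>.\<close>

lemma sums_binomial_exp:
  fixes z t :: complex
  shows "(\<lambda>m. of_nat (m choose j) * z ^ (m - j) / fact m * t ^ m) sums (t ^ j / fact j * exp (t * z))"
proof -
  let ?f = "\<lambda>m. of_nat (m choose j) * z ^ (m - j) / fact m * t ^ m"
  have "?f (m + j) = t ^ j / fact j * ((t * z) ^ m /\<^sub>R fact m)" for m
  proof -
    have "of_nat ((m + j) choose j) = (fact (m + j) / (fact j * fact m) :: complex)"
      by (subst binomial_fact) auto
    then show ?thesis
      by (simp add: power_add power_mult_distrib scaleR_conv_of_real divide_inverse)
  qed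
  then have "(\<lambda>m. ?f (m + j)) sums (t ^ j / fact j * exp (t * z))"
    using sums_mult[OF exp_converges[of "t * z"], of "t ^ j / fact j"] by simp
  then show ?thesis
    by (subst (asm) sums_zero_iff_shift) auto
qed

lemma map_vec_mult_mat_vec_complex:
  assumes "M \<in> carrier_mat m n" "v \<in> carrier_vec n"
  shows "map_vec complex_of_real (M *\<^sub>v v) = complex_mat M *\<^sub>v map_vec complex_of_real v"
  using assms by (intro eq_vecI) (auto simp: scalar_prod_def)

lemma complex_mat_pow:
  assumes "A \<in> carrier_mat n n"
  shows "complex_mat (A ^\<^sub>m m) = complex_mat A ^\<^sub>m m"
  using of_real_hom.mat_hom_pow[OF assms] .

text \<open>\<open>mat_exp\<close> is defined over the reals, so the exponential of the complex
  matrix \<open>jordan_matrix bs\<close> appears as an entrywise series. The identity is that of the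
  powers, passed through finite sums and the limit.\<close>

lemma mat_exp_jordan:
  assumes A: "A \<in> carrier_mat n n"
    and sim: "similar_mat_wit (jordan_matrix bs) (complex_mat A) P Q"
  shows "complex_mat (mat_exp (t \<cdot>\<^sub>m A)) =
    Q * Matrix.mat n n (\<lambda>(k, l). \<Sum>m. (jordan_matrix bs ^\<^sub>m m) $$ (k, l) / fact m * of_real t ^ m) * P"
    (is "_ = Q * ?F * P")
proof -
  let ?J = "jordan_matrix bs"
  have n: "n = dim_row (complex_mat A)" using A by simp
  note sim' = similar_mat_witD[OF n similar_mat_wit_sym[OF sim]]
  have J: "?J \<in> carrier_mat n n" and P: "P \<in> carrier_mat n n" and Q: "Q \<in> carrier_mat n n"
    using sim' by auto
  show ?thesis
  proof (rule eq_matI)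
    fix k l assume "k < dim_row (Q * ?F * P)" "l < dim_col (Q * ?F * P)"
    then have kl: "k < n" "l < n" using P Q by auto
    define f where "f i j m = (?J ^\<^sub>m m) $$ (i, j) / fact m * of_real t ^ m" for i j m
    have f: "f i j sums (?F $$ (i, j))" if "i < n" "j < n" for i j
      using summable_norm_cancel[OF summable_pow_mat_index[OF J that]] that
      by (simp add: f_def[abs_def] summable_sums)
    have "(\<lambda>m. \<Sum>j<n. (\<Sum>i<n. Q $$ (k, i) * f i j m) * P $$ (j, l)) sums
        (\<Sum>j<n. (\<Sum>i<n. Q $$ (k, i) * ?F $$ (i, j)) * P $$ (j, l))"
      by (intro sums_sum sums_mult2 sums_mult f) auto
    also have "(\<Sum>j<n. (\<Sum>i<n. Q $$ (k, i) * ?F $$ (i, j)) * P $$ (j, l)) = (Q * ?F * P) $$ (k, l)"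
      using P Q kl by (simp add: index_mult_mat_sum[of _ n n _ n] del: index_mult_mat)
    finally have "(\<lambda>m. \<Sum>j<n. (\<Sum>i<n. Q $$ (k, i) * f i j m) * P $$ (j, l)) sums (Q * ?F * P) $$ (k, l)" .
    moreover have "(\<Sum>j<n. (\<Sum>i<n. Q $$ (k, i) * f i j m) * P $$ (j, l)) =
        complex_of_real ((A ^\<^sub>m m) $$ (k, l) / fact m * t ^ m)" for m
    proof -
      have "complex_of_real ((A ^\<^sub>m m) $$ (k, l)) = complex_mat (A ^\<^sub>m m) $$ (k, l)"
        using A kl by simp
      also have "\<dots> = (Q * ?J ^\<^sub>m m * P) $$ (k, l)"
        unfolding complex_mat_pow[OF A] similar_mat_wit_pow_id[OF similar_mat_wit_sym[OF sim]] ..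
      also have "\<dots> = (\<Sum>j<n. (\<Sum>i<n. Q $$ (k, i) * (?J ^\<^sub>m m) $$ (i, j)) * P $$ (j, l))"
        using P Q kl J by (simp add: index_mult_mat_sum[of _ n n _ n] del: index_mult_mat)
      finally have Am: "complex_of_real ((A ^\<^sub>m m) $$ (k, l)) =
          (\<Sum>j<n. (\<Sum>i<n. Q $$ (k, i) * (?J ^\<^sub>m m) $$ (i, j)) * P $$ (j, l))" .
      define c where "c = complex_of_real t ^ m / fact m"
      have "(\<Sum>j<n. (\<Sum>i<n. Q $$ (k, i) * f i j m) * P $$ (j, l)) =
          (\<Sum>j<n. (\<Sum>i<n. Q $$ (k, i) * (?J ^\<^sub>m m) $$ (i, j) * c) * P $$ (j, l))"
        by (simp add: f_def c_def mult.assoc)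
      also have "\<dots> = complex_of_real ((A ^\<^sub>m m) $$ (k, l)) * c"
        unfolding Am by (simp only: sum_distrib_right mult.assoc mult.commute[of c])
      finally show ?thesis
        by (simp add: c_def)
    qed
    ultimately have "(\<lambda>m. complex_of_real ((A ^\<^sub>m m) $$ (k, l) / fact m * t ^ m)) sums (Q * ?F * P) $$ (k, l)"
      by (simp only:)
    moreover have "(\<lambda>m. complex_of_real ((A ^\<^sub>m m) $$ (k, l) / fact m * t ^ m)) sums
        complex_of_real (mat_exp (t \<cdot>\<^sub>m A) $$ (k, l))"
      unfolding mat_exp_smult_index[OF A kl]
      by (intro sums_of_real summable_sums summable_norm_cancel[OF summable_pow_mat_index[OF A kl]])
    ultimately have "complex_of_real (mat_exp (t \<cdot>\<^sub>m A) $$ (k, l)) = (Q * ?F * P) $$ (k, l)"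
      by (rule sums_unique2[rotated])
    then show "complex_mat (mat_exp (t \<cdot>\<^sub>m A)) $$ (k, l) = (Q * ?F * P) $$ (k, l)"
      using carrier_matD[OF mat_exp_carrier[OF smult_carrier_mat[OF A, of t]]] kl by simp
  qed (use A P Q in \<open>auto simp: mat_exp_def\<close>)
qed

text \<open>Conjugation costs the product of the two operator norms, which uniform normalizability
  bounds; the crude entrywise bound costs \<open>n\<^sup>2\<close>. \<open>B\<close> is left open
  because growth, boundedness and decay differ only in the choice of it.\<close>

lemma euclidean_norm_mat_exp_le:
  assumes A: "A \<in> carrier_mat n n" and n: "0 < n"
    and sim: "similar_mat_wit (jordan_matrix bs) (complex_mat A) P Q"
    and B: "\<And>b z j. (b, z) \<in> set bs \<Longrightarrow> j < b \<Longrightarrow>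
      \<bar>t\<bar> ^ j / fact j * exp (t * Re z) \<le> B" and B0: "0 \<le> B"
    and v: "v \<in> carrier_vec n"
  shows "euclidean_norm (mat_exp (t \<cdot>\<^sub>m A) *\<^sub>v v) \<le>
    op_norm P * op_norm Q * (real n)\<^sup>2 * B * euclidean_norm v"
proof -
  let ?J = "jordan_matrix bs"
  define F where "F = Matrix.mat n n (\<lambda>(k, l). \<Sum>m. (?J ^\<^sub>m m) $$ (k, l) / fact m * complex_of_real t ^ m)"
  let ?v = "map_vec complex_of_real v"
  have dim: "n = dim_row (complex_mat A)" using A by simp
  note sim' = similar_mat_witD[OF dim similar_mat_wit_sym[OF sim]]
  have J: "?J \<in> carrier_mat n n" and P: "P \<in> carrier_mat n n" and Q: "Q \<in> carrier_mat n n"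
    using sim' by auto
  then have N: "sum_list (map fst bs) = n" by auto
  have F: "norm (F $$ (k, l)) \<le> B" if kl: "k < n" "l < n" for k l
  proof -
    consider "\<forall>m. (?J ^\<^sub>m m) $$ (k, l) = 0"
      | b z j where "(b, z) \<in> set bs" "j < b" "\<forall>m. (?J ^\<^sub>m m) $$ (k, l) = of_nat (m choose j) * z ^ (m - j)"
      using jordan_matrix_pow_index[of k bs l] kl unfolding N by blast
    then show ?thesis
    proof cases
      case 2
      have "F $$ (k, l) = of_real t ^ j / fact j * exp (of_real t * z)"
        using kl 2 sums_binomial_exp[of j z "of_real t"] by (simp add: sums_iff F_def)
      then show ?thesis
        using B[OF 2(1,2)] by (simp add: norm_mult norm_divide norm_power)
    qed (use kl B0 in \<open>simp add: F_def\<close>)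
  qed
  have F_carrier: "F \<in> carrier_mat n n"
    by (simp add: F_def)
  have Pv: "P *\<^sub>v ?v \<in> carrier_vec n"
    using P v by auto
  have FPv: "F *\<^sub>v (P *\<^sub>v ?v) \<in> carrier_vec n"
    by (rule mult_mat_vec_carrier[OF F_carrier Pv])
  have "euclidean_norm (mat_exp (t \<cdot>\<^sub>m A) *\<^sub>v v) = euclidean_norm (complex_mat (mat_exp (t \<cdot>\<^sub>m A)) *\<^sub>v ?v)"
    using A v by (subst map_vec_mult_mat_vec_complex[of _ n n, symmetric]) auto
  also have "complex_mat (mat_exp (t \<cdot>\<^sub>m A)) *\<^sub>v ?v = Q *\<^sub>v (F *\<^sub>v (P *\<^sub>v ?v))"
    unfolding mat_exp_jordan[OF A sim] F_def[symmetric] using P Q v F_carrier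
    by (simp add: assoc_mult_mat_vec[of _ n n _ n])
  also have "euclidean_norm \<dots> \<le> op_norm Q * euclidean_norm (F *\<^sub>v (P *\<^sub>v ?v))"
    by (rule op_norm_bound[OF Q FPv])
  also have "\<dots> \<le> op_norm Q * (real n * real n * B * euclidean_norm (P *\<^sub>v ?v))"
    using Q n F F_carrier B0 Pv by (intro mult_left_mono euclidean_norm_mult_mat_vec_le op_norm_nonneg) auto
  also have "\<dots> \<le> op_norm Q * (real n * real n * B * (op_norm P * euclidean_norm ?v))"
    using Q n B0 P v by (intro mult_left_mono op_norm_bound op_norm_nonneg) auto
  finally show ?thesis by (simp add: power2_eq_square mult_ac)
qed

text \<open>The block contributes the factor \<open>[:- z, 1:] ^ b\<close> to the characteristic
  polynomial, and this vanishes at \<open>z\<close> because \<open>b > 0\<close>.\<close>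

lemma eigenvalue_of_jordan_block:
  assumes A: "A \<in> carrier_mat n n" and sim: "similar_mat_wit (jordan_matrix bs) A P Q"
    and bz: "(b, z :: 'a::field) \<in> set bs" "0 < b"
  shows "eigenvalue A z"
proof -
  have "similar_mat (jordan_matrix bs) A"
    unfolding similar_mat_def using sim by blast
  then have "char_poly A = (\<Prod>(n, a)\<leftarrow>bs. [:- a, 1:] ^ n)"
    using char_poly_similar[of "jordan_matrix bs" A] jordan_matrix_char_poly[of bs] by simp
  moreover have "poly (\<Prod>(n, a)\<leftarrow>bs. [:- a, 1:] ^ n) z = 0"
    using bz by (induction bs) (auto simp: poly_mult split: prod.splits)
  ultimately show ?thesis using eigenvalue_root_char_poly[OF A] by simp
qed

text \<open>\<open>Q\<close> carries the chain of the Jordan matrix to one of \<open>A\<close>. This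
  connects the gap hypothesis, which is stated for the matrix itself, with the block sizes of a
  normal form.\<close>

lemma defective_eigenvalue_of_jordan_block:
  assumes A: "A \<in> carrier_mat n n" and sim: "similar_mat_wit (jordan_matrix bs) A P Q"
    and bz: "(b, z) \<in> set bs" "2 \<le> b"
  shows "defective_eigenvalue A z"
proof -
  let ?J = "jordan_matrix bs"
  have dim: "n = dim_row A" using A by simp
  note sim' = similar_mat_witD[OF dim similar_mat_wit_sym[OF sim]]
  have J: "?J \<in> carrier_mat n n" and P: "P \<in> carrier_mat n n" and Q: "Q \<in> carrier_mat n n"
    using sim' by auto
  then have N: "sum_list (map fst bs) = n" by auto
  obtain v w where vw: "v \<in> carrier_vec n" "w \<in> carrier_vec n" "w \<noteq> 0\<^sub>v n"
    "?J *\<^sub>v v = z \<cdot>\<^sub>v v + w" "?J *\<^sub>v w = z \<cdot>\<^sub>v w"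
    using jordan_matrix_chain[OF bz] unfolding N by blast
  have PQ: "P *\<^sub>v (Q *\<^sub>v x) = x" if x: "x \<in> carrier_vec n" for x
    using assoc_mult_mat_vec[OF P Q x] sim' x by simp
  have AQ: "A *\<^sub>v (Q *\<^sub>v x) = Q *\<^sub>v (?J *\<^sub>v x)" if x: "x \<in> carrier_vec n" for x
  proof -
    have "A *\<^sub>v (Q *\<^sub>v x) = (Q * ?J * P) *\<^sub>v (Q *\<^sub>v x)" using sim' by simp
    also have "\<dots> = Q *\<^sub>v (?J *\<^sub>v (P *\<^sub>v (Q *\<^sub>v x)))"
      using assoc_mult_mat_vec[of "Q * ?J" n n P n "Q *\<^sub>v x"]
        assoc_mult_mat_vec[of Q n n ?J n "P *\<^sub>v (Q *\<^sub>v x)"] P Q J x by simp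
    finally show ?thesis by (simp add: PQ[OF x])
  qed
  have char: "char_matrix A z *\<^sub>v x = A *\<^sub>v x - z \<cdot>\<^sub>v x" if x: "x \<in> carrier_vec n" for x
  proof -
    have "(- z \<cdot>\<^sub>m 1\<^sub>m n) *\<^sub>v x = - (z \<cdot>\<^sub>v x)"
      using x by (intro eq_vecI) (auto simp: row_smult)
    then show ?thesis
      using A x by (simp add: char_matrix_def add_mult_distrib_mat_vec[of _ n n] minus_add_uminus_vec[of _ n])
  qed
  have 1: "char_matrix A z *\<^sub>v (Q *\<^sub>v v) = Q *\<^sub>v w"
    using vw Q by (simp add: char AQ mult_add_distrib_mat_vec[of _ n n] mult_mat_vec[of _ n n])
      (intro eq_vecI, auto)
  have 2: "char_matrix A z *\<^sub>v (Q *\<^sub>v w) = 0\<^sub>v n"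
    using vw Q by (simp add: char AQ mult_mat_vec[of _ n n])
  have "Q *\<^sub>v w \<noteq> 0\<^sub>v n"
  proof
    assume "Q *\<^sub>v w = 0\<^sub>v n"
    then have "P *\<^sub>v (Q *\<^sub>v w) = 0\<^sub>v n" using P by auto
    then show False using PQ vw by simp
  qed
  then show ?thesis unfolding defective_eigenvalue_def
    using 1 2 A Q vw by (intro bexI[of _ "Q *\<^sub>v v"]) auto
qed

section \<open>Growth, boundedness and decay of the exponential\<close>

lemma similar_jordan_Re_neg:
  assumes "A \<in> carrier_mat n n" "similar_mat_wit (jordan_matrix bs) (complex_mat A) P Q"
    and "\<And>z. eigenvalue (complex_mat A) z \<Longrightarrow> Re z < 0"
    and "(b, z) \<in> set bs" "j < b"
  shows "Re z < 0"
  using assms eigenvalue_of_jordan_block[of "complex_mat A" n bs P Q b z] by auto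

text \<open>With eigenvalues possibly close to the imaginary axis, the polynomial factor has to be
  absorbed without help from \<open>exp (t * Re z)\<close>; \<open>exp t\<close> dominates every
  \<open>t ^ j / fact j\<close> at once.\<close>

lemma mat_exp_growth:
  assumes A: "A \<in> carrier_mat n n" and n: "0 < n"
    and sim: "similar_mat_wit (jordan_matrix bs) (complex_mat A) P Q"
    and neg: "\<And>z. eigenvalue (complex_mat A) z \<Longrightarrow> Re z < 0"
    and C: "op_norm P * op_norm Q \<le> C"
    and t: "0 \<le> t" and v: "v \<in> carrier_vec n"
  shows "euclidean_norm (mat_exp (t \<cdot>\<^sub>m A) *\<^sub>v v) \<le> C * (real n)\<^sup>2 * exp t * euclidean_norm v"
proof -
  have "euclidean_norm (mat_exp (t \<cdot>\<^sub>m A) *\<^sub>v v) \<le>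
      op_norm P * op_norm Q * (real n)\<^sup>2 * exp t * euclidean_norm v"
  proof (rule euclidean_norm_mat_exp_le[OF A n sim _ _ v])
    fix b z j assume bz: "(b, z) \<in> set bs" "j < b"
    have "t * Re z \<le> 0"
      using similar_jordan_Re_neg[OF A sim neg bz] t by (simp add: mult_nonneg_nonpos)
    then have "\<bar>t\<bar> ^ j / fact j * exp (t * Re z) \<le> exp \<bar>t\<bar> * 1"
      by (intro mult_mono pow_over_fact_le_exp) auto
    then show "\<bar>t\<bar> ^ j / fact j * exp (t * Re z) \<le> exp t" using t by simp
  qed auto
  also have "\<dots> \<le> C * (real n)\<^sup>2 * exp t * euclidean_norm v"
    using C by (intro mult_right_mono) auto
  finally show ?thesis .
qed

text \<open>An entry with \<open>j = 0\<close> has modulus at most 1. An entry with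
  \<open>j > 0\<close> lies in a block of size at least 2, so its eigenvalue is defective and the
  gap applies.\<close>

lemma mat_exp_bounded:
  assumes A: "A \<in> carrier_mat n n" and n: "0 < n"
    and sim: "similar_mat_wit (jordan_matrix bs) (complex_mat A) P Q"
    and neg: "\<And>z. eigenvalue (complex_mat A) z \<Longrightarrow> Re z < 0"
    and eps: "0 < \<epsilon>" and gap: "\<And>z. defective_eigenvalue (complex_mat A) z \<Longrightarrow> Re z \<le> - \<epsilon>"
    and C: "op_norm P * op_norm Q \<le> C"
    and t: "0 \<le> t" and v: "v \<in> carrier_vec n"
  shows "euclidean_norm (mat_exp (t \<cdot>\<^sub>m A) *\<^sub>v v) \<le>
    C * (real n)\<^sup>2 * max 1 (1 / \<epsilon>) ^ n * euclidean_norm v"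
proof -
  have A': "complex_mat A \<in> carrier_mat n n" using A by simp
  have N: "sum_list (map fst bs) = n"
    using similar_mat_witD2[OF A' similar_mat_wit_sym[OF sim]] by auto
  have "euclidean_norm (mat_exp (t \<cdot>\<^sub>m A) *\<^sub>v v) \<le>
      op_norm P * op_norm Q * (real n)\<^sup>2 * max 1 (1 / \<epsilon>) ^ n * euclidean_norm v"
  proof (rule euclidean_norm_mat_exp_le[OF A n sim _ _ v])
    fix b z j assume bz: "(b, z) \<in> set bs" "j < b"
    have "b \<le> n"
      using bz(1) N member_le_sum_list[of b "map fst bs"] by force
    show "\<bar>t\<bar> ^ j / fact j * exp (t * Re z) \<le> max 1 (1 / \<epsilon>) ^ n"
    proof (cases "j = 0")
      case True
      have "t * Re z \<le> 0"
        using similar_jordan_Re_neg[OF A sim neg bz] t by (simp add: mult_nonneg_nonpos)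
      then have "exp (t * Re z) \<le> 1" by simp
      also have "1 \<le> max 1 (1 / \<epsilon>) ^ n" by (intro one_le_power) simp
      finally show ?thesis using True by simp
    next
      case False
      then have "Re z \<le> - \<epsilon>"
        using bz by (intro gap defective_eigenvalue_of_jordan_block[OF A' sim bz(1)]) auto
      then have "t * Re z \<le> t * - \<epsilon>" using t by (intro mult_left_mono) auto
      then have "t ^ j / fact j * exp (t * Re z) \<le> t ^ j / fact j * exp (- (\<epsilon> * t))"
        using t by (intro mult_left_mono) (auto simp: mult.commute)
      \<comment> \<open>After rescaling by \<epsilon> the two exponentials cancel and leave
        \<open>(1 / \<epsilon>) ^ j\<close>; the maximum with 1 then allows the exponent to be
        raised from \<open>j\<close> to \<open>n\<close>.\<close>
      also have "\<dots> = (1 / \<epsilon>) ^ j * ((\<epsilon> * t) ^ j / fact j * exp (- (\<epsilon> * t)))"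
        using eps by (simp add: power_mult_distrib power_divide)
      also have "\<dots> \<le> (1 / \<epsilon>) ^ j * (exp (\<epsilon> * t) * exp (- (\<epsilon> * t)))"
        using eps t by (intro mult_left_mono mult_right_mono pow_over_fact_le_exp) auto
      also have "\<dots> = (1 / \<epsilon>) ^ j" by (simp flip: exp_add)
      also have "\<dots> \<le> max 1 (1 / \<epsilon>) ^ j" using eps by (intro power_mono) auto
      also have "\<dots> \<le> max 1 (1 / \<epsilon>) ^ n"
        using bz \<open>b \<le> n\<close> by (intro power_increasing) auto
      finally show ?thesis using t by simp
    qed
  qed auto
  also have "\<dots> \<le> C * (real n)\<^sup>2 * max 1 (1 / \<epsilon>) ^ n * euclidean_norm v"
    using C by (intro mult_right_mono) auto
  finally show ?thesis .
qed

text \<open>The sum over all blocks and all \<open>j\<close> consists of finitely many functions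
  tending to 0 and serves as the common bound \<open>B\<close>. The resulting \<beta> depends on the
  matrix, so a family gets no common rate from it.\<close>

lemma mat_exp_decay:
  assumes A: "A \<in> carrier_mat n n" and n: "0 < n"
    and sim: "similar_mat_wit (jordan_matrix bs) (complex_mat A) P Q"
    and neg: "\<And>z. eigenvalue (complex_mat A) z \<Longrightarrow> Re z < 0"
  shows "\<exists>\<beta>. (\<beta> \<longlongrightarrow> 0) at_top \<and> (\<forall>t\<ge>0. \<forall>v\<in>carrier_vec n.
    euclidean_norm (mat_exp (t \<cdot>\<^sub>m A) *\<^sub>v v) \<le> \<beta> t * euclidean_norm v)"
proof -
  let ?S = "Sigma (set bs) (\<lambda>(b, z). {..<b})"
  define g where "g t = (\<Sum>((b, z), j)\<in>?S. t ^ j / fact j * exp (t * Re z))" for t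
  have "((\<lambda>t. t ^ j / fact j * exp (t * Re z)) \<longlongrightarrow> 0) at_top"
    if "(b, z) \<in> set bs" "j < b" for b z j
  proof -
    have "Re z < 0" by (rule similar_jordan_Re_neg[OF A sim neg that])
    then show ?thesis by real_asymp
  qed
  then have "(g \<longlongrightarrow> 0) at_top"
    unfolding g_def by (intro tendsto_null_sum) (auto simp del: times_divide_eq_left)
  then have "((\<lambda>t. op_norm P * op_norm Q * (real n)\<^sup>2 * g t) \<longlongrightarrow> 0) at_top"
    by (rule tendsto_mult_right_zero)
  moreover have "euclidean_norm (mat_exp (t \<cdot>\<^sub>m A) *\<^sub>v v) \<le>
      op_norm P * op_norm Q * (real n)\<^sup>2 * g t * euclidean_norm v"
    if t: "0 \<le> t" and v: "v \<in> carrier_vec n" for t v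
  proof (rule euclidean_norm_mat_exp_le[OF A n sim _ _ v])
    have fin: "finite ?S" by auto
    fix b z j assume "(b, z) \<in> set bs" "j < b"
    then have "(\<lambda>((b, z), j). t ^ j / fact j * exp (t * Re z)) ((b, z), j) \<le> g t"
      unfolding g_def using t fin by (intro member_le_sum) (auto split: prod.split)
    then show "\<bar>t\<bar> ^ j / fact j * exp (t * Re z) \<le> g t" using t by simp
  next
    show "0 \<le> g t" unfolding g_def using t by (intro sum_nonneg) auto
  qed
  ultimately show ?thesis by blast
qed

section \<open>The Gramian\<close>

lemma scalar_prod_mult_transpose:
  fixes M :: "'a::comm_semiring_0 Matrix.mat"
  assumes "M \<in> carrier_mat n n" "v \<in> carrier_vec n" "w \<in> carrier_vec n"
  shows "scalar_prod v (M *\<^sub>v w) = scalar_prod (transpose_mat M *\<^sub>v v) w"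
  using transpose_vec_mult_scalar[OF assms(1,3,2)] by simp

lemma scalar_prod_lessThan:
  assumes "w \<in> carrier_vec n"
  shows "scalar_prod v w = (\<Sum>k<n. vec_index v k * vec_index w k)"
  using assms by (simp add: scalar_prod_def lessThan_atLeast0)

lemma continuous_on_transpose_mat_exp_mult:
  assumes A: "A \<in> carrier_mat n n" and y: "y \<in> carrier_vec n" and k: "k < n"
  shows "continuous_on S (\<lambda>s. vec_index (transpose_mat (mat_exp ((- s) \<cdot>\<^sub>m A)) *\<^sub>v y) k)"
proof -
  have "continuous_on S (\<lambda>s. \<Sum>j<n. mat_exp ((- s) \<cdot>\<^sub>m A) $$ (j, k) * vec_index y j)"
    using A k by (intro continuous_intros) auto
  also have "(\<lambda>s. \<Sum>j<n. mat_exp ((- s) \<cdot>\<^sub>m A) $$ (j, k) * vec_index y j) =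
      (\<lambda>s. vec_index (transpose_mat (mat_exp ((- s) \<cdot>\<^sub>m A)) *\<^sub>v y) k)"
  proof
    fix s
    have M: "mat_exp ((- s) \<cdot>\<^sub>m A) \<in> carrier_mat n n" using A by simp
    then have "transpose_mat (mat_exp ((- s) \<cdot>\<^sub>m A)) \<in> carrier_mat n n" by simp
    from index_mult_mat_vec_sum[OF this y k] carrier_matD[OF M] k
    show "(\<Sum>j<n. mat_exp ((- s) \<cdot>\<^sub>m A) $$ (j, k) * vec_index y j) =
        vec_index (transpose_mat (mat_exp ((- s) \<cdot>\<^sub>m A)) *\<^sub>v y) k"
      by simp
  qed
  finally show ?thesis .
qed

lemma integral_double_sum:
  fixes F :: "nat \<Rightarrow> nat \<Rightarrow> 'b \<Rightarrow> real"
  assumes int: "\<And>k l. k < n \<Longrightarrow> l < n \<Longrightarrow> integrable M (F k l)"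
  shows "(\<Sum>k<n. z k * (\<Sum>l<n. (LINT s|M. F k l s) * y l)) =
    (LINT s|M. (\<Sum>k<n. z k * (\<Sum>l<n. F k l s * y l)))"
proof -
  have 1: "integrable M (\<lambda>s. \<Sum>l<n. F k l s * y l)" if "k < n" for k
    using int that by (intro Bochner_Integration.integrable_sum integrable_mult_left) auto
  have 2: "(LINT s|M. (\<Sum>l<n. F k l s * y l)) = (\<Sum>l<n. (LINT s|M. F k l s) * y l)" if "k < n" for k
    using int that by (subst Bochner_Integration.integral_sum) auto
  show ?thesis
    using 1 2 by (subst Bochner_Integration.integral_sum) auto
qed

text \<open>Moving the vectors inside the entrywise integrals turns the Gramian into a form whose
  integrand is a scalar product. The change to \<open>integral\<close> gives access to additivity
  over intervals.\<close>

lemma gramian_bilinear: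
  assumes A: "A \<in> carrier_mat n n" and y: "y \<in> carrier_vec n" and z: "z \<in> carrier_vec n"
  shows "scalar_prod z (gramian A T *\<^sub>v y) =
    integral {0..T} (\<lambda>s. scalar_prod (transpose_mat (mat_exp ((- s) \<cdot>\<^sub>m A)) *\<^sub>v z)
      (transpose_mat (mat_exp ((- s) \<cdot>\<^sub>m A)) *\<^sub>v y))"
proof -
  define E where "E s = mat_exp ((- s) \<cdot>\<^sub>m A)" for s
  have E: "E s \<in> carrier_mat n n" for s using A by (simp add: E_def)
  have W: "gramian A T \<in> carrier_mat n n" using A by (simp add: gramian_def)
  have EE_cont: "continuous_on S (\<lambda>s. (E s * transpose_mat (E s)) $$ (k, l))" if "k < n" "l < n" for S k l
  proof -
    have "continuous_on S (\<lambda>s. \<Sum>j<n. E s $$ (k, j) * E s $$ (l, j))"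
      unfolding E_def using A that by (intro continuous_intros) auto
    moreover have "(E s * transpose_mat (E s)) $$ (k, l) = (\<Sum>j<n. E s $$ (k, j) * E s $$ (l, j))" for s
      using index_mult_mat_sum[OF E[of s] _ that, of "transpose_mat (E s)"] E[of s] that by simp
    ultimately show ?thesis by simp
  qed
  have int: "integrable (lebesgue_on {0..T}) (\<lambda>s. (E s * transpose_mat (E s)) $$ (k, l))"
    if "k < n" "l < n" for k l
    by (rule continuous_imp_integrable_real[OF EE_cont[OF that]])
  have int': "integrable (lebesgue_on {0..T})
      (\<lambda>s. \<Sum>k<n. vec_index z k * (\<Sum>l<n. (E s * transpose_mat (E s)) $$ (k, l) * vec_index y l))"
    using int by (intro Bochner_Integration.integrable_sum integrable_mult_right integrable_mult_left) auto
  have eq: "(\<Sum>k<n. vec_index z k * (\<Sum>l<n. (E s * transpose_mat (E s)) $$ (k, l) * vec_index y l)) =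
      scalar_prod (transpose_mat (E s) *\<^sub>v z) (transpose_mat (E s) *\<^sub>v y)" for s
  proof -
    have EE: "E s * transpose_mat (E s) \<in> carrier_mat n n" using E[of s] by simp
    have "(\<Sum>k<n. vec_index z k * (\<Sum>l<n. (E s * transpose_mat (E s)) $$ (k, l) * vec_index y l)) =
        scalar_prod z ((E s * transpose_mat (E s)) *\<^sub>v y)"
      using EE y by (simp add: scalar_prod_lessThan[of _ n] index_mult_mat_vec_sum[of _ n n]
          del: index_mult_mat_vec index_mult_mat)
    also have "\<dots> = scalar_prod z (E s *\<^sub>v (transpose_mat (E s) *\<^sub>v y))"
      using E[of s] y by (simp add: assoc_mult_mat_vec[of _ n n _ n])
    also have "\<dots> = scalar_prod (transpose_mat (E s) *\<^sub>v z) (transpose_mat (E s) *\<^sub>v y)"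
      using E[of s] y z by (intro scalar_prod_mult_transpose) auto
    finally show ?thesis .
  qed
  have "scalar_prod z (gramian A T *\<^sub>v y) =
      (\<Sum>k<n. vec_index z k * (\<Sum>l<n. gramian A T $$ (k, l) * vec_index y l))"
    using W y by (simp add: scalar_prod_lessThan[of _ n] index_mult_mat_vec_sum[of _ n n]
          del: index_mult_mat_vec)
  also have "\<dots> = (\<Sum>k<n. vec_index z k * (\<Sum>l<n.
      (LINT s|lebesgue_on {0..T}. (E s * transpose_mat (E s)) $$ (k, l)) * vec_index y l))"
    using A by (simp add: gramian_def E_def)
  also have "\<dots> = (LINT s|lebesgue_on {0..T}. (\<Sum>k<n. vec_index z k *
      (\<Sum>l<n. (E s * transpose_mat (E s)) $$ (k, l) * vec_index y l)))"
    by (rule integral_double_sum[OF int])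
  also have "\<dots> = integral {0..T} (\<lambda>s. \<Sum>k<n. vec_index z k *
      (\<Sum>l<n. (E s * transpose_mat (E s)) $$ (k, l) * vec_index y l))"
    by (rule lebesgue_integral_eq_integral[OF int']) simp
  finally show ?thesis unfolding eq unfolding E_def .
qed

lemma gramian_carrier [simp]: "A \<in> carrier_mat n n \<Longrightarrow> gramian A T \<in> carrier_mat n n"
  by (simp add: gramian_def)

lemma gramian_sym:
  assumes "A \<in> carrier_mat n n" "y \<in> carrier_vec n" "z \<in> carrier_vec n"
  shows "scalar_prod z (gramian A T *\<^sub>v y) = scalar_prod y (gramian A T *\<^sub>v z)"
  unfolding gramian_bilinear[OF assms] gramian_bilinear[OF assms(1,3,2)]
  using assms by (intro arg_cong[where f = "integral _"] ext comm_scalar_prod[of _ n]) auto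

lemma gramian_quadratic:
  assumes "A \<in> carrier_mat n n" "y \<in> carrier_vec n"
  shows "scalar_prod y (gramian A T *\<^sub>v y) =
    integral {0..T} (\<lambda>s. (euclidean_norm (transpose_mat (mat_exp ((- s) \<cdot>\<^sub>m A)) *\<^sub>v y))\<^sup>2)"
  unfolding gramian_bilinear[OF assms assms(2)] euclidean_norm_sq_real ..

lemma continuous_on_norm_transpose_mat_exp:
  assumes A: "A \<in> carrier_mat n n" and y: "y \<in> carrier_vec n"
  shows "continuous_on S (\<lambda>s. (euclidean_norm (transpose_mat (mat_exp ((- s) \<cdot>\<^sub>m A)) *\<^sub>v y))\<^sup>2)"
proof -
  have "(euclidean_norm (transpose_mat (mat_exp ((- s) \<cdot>\<^sub>m A)) *\<^sub>v y))\<^sup>2 =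
      (\<Sum>k<n. (norm (vec_index (transpose_mat (mat_exp ((- s) \<cdot>\<^sub>m A)) *\<^sub>v y) k))\<^sup>2)" for s
    using A y by (intro euclidean_norm_sq) auto
  moreover have "continuous_on S (\<lambda>s. \<Sum>k<n. (norm (vec_index (transpose_mat (mat_exp ((- s) \<cdot>\<^sub>m A)) *\<^sub>v y) k))\<^sup>2)"
    by (intro continuous_intros continuous_on_transpose_mat_exp_mult[OF A y]) auto
  ultimately show ?thesis by simp
qed

lemma gramian_increment:
  assumes A: "A \<in> carrier_mat n n" and y: "y \<in> carrier_vec n" and T: "0 \<le> S" "S \<le> T"
  shows "scalar_prod y (gramian A T *\<^sub>v y) = scalar_prod y (gramian A S *\<^sub>v y) +
    integral {S..T} (\<lambda>s. (euclidean_norm (transpose_mat (mat_exp ((- s) \<cdot>\<^sub>m A)) *\<^sub>v y))\<^sup>2)"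
  unfolding gramian_quadratic[OF A y] using T
  by (intro Henstock_Kurzweil_Integration.integral_combine[symmetric] integrable_continuous_real
      continuous_on_norm_transpose_mat_exp[OF A y])

lemma gramian_nonneg:
  assumes "A \<in> carrier_mat n n" "y \<in> carrier_vec n"
  shows "0 \<le> scalar_prod y (gramian A T *\<^sub>v y)"
  unfolding gramian_quadratic[OF assms]
  by (intro Henstock_Kurzweil_Integration.integral_nonneg integrable_continuous_real continuous_on_norm_transpose_mat_exp[OF assms]) auto

text \<open>The bound concerns \<open>[S, T]\<close> alone, which permits three uses: with
  \<open>S = 0\<close> for coercivity, with \<open>0 < S\<close> for strict monotonicity of the
  energy, and with \<open>K = 1\<close> beyond a late \<open>S\<close> for linear growth in
  \<open>T\<close>.\<close>

lemma gramian_increment_ge: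
  assumes A: "A \<in> carrier_mat n n" and y: "y \<in> carrier_vec n" and T: "0 \<le> S" "S \<le> T" and K: "0 < K"
    and bound: "\<And>s v. S \<le> s \<Longrightarrow> s \<le> T \<Longrightarrow> v \<in> carrier_vec n \<Longrightarrow>
      euclidean_norm (mat_exp (s \<cdot>\<^sub>m A) *\<^sub>v v) \<le> K * euclidean_norm v"
  shows "scalar_prod y (gramian A S *\<^sub>v y) + (T - S) / K\<^sup>2 * (euclidean_norm y)\<^sup>2 \<le> scalar_prod y (gramian A T *\<^sub>v y)"
proof -
  define e where "e s = transpose_mat (mat_exp ((- s) \<cdot>\<^sub>m A)) *\<^sub>v y" for s
  have e: "e s \<in> carrier_vec n" for s using A y by (simp add: e_def)
  have ptw: "(euclidean_norm y)\<^sup>2 / K\<^sup>2 \<le> (euclidean_norm (e s))\<^sup>2" if s: "S \<le> s" "s \<le> T" for s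
  proof -
    have "mat_exp ((- s) \<cdot>\<^sub>m A) *\<^sub>v (mat_exp (s \<cdot>\<^sub>m A) *\<^sub>v y) = y"
      using assoc_mult_mat_vec[of "mat_exp ((- s) \<cdot>\<^sub>m A)" n n "mat_exp (s \<cdot>\<^sub>m A)" n y]
        mat_exp_inverse(1)[OF A, of s] mat_exp_carrier[OF smult_carrier_mat[OF A]] y by simp
    then have "(euclidean_norm y)\<^sup>2 =
        scalar_prod y (mat_exp ((- s) \<cdot>\<^sub>m A) *\<^sub>v (mat_exp (s \<cdot>\<^sub>m A) *\<^sub>v y))"
      by (simp add: euclidean_norm_sq_real)
    also have "\<dots> = scalar_prod (e s) (mat_exp (s \<cdot>\<^sub>m A) *\<^sub>v y)"
      unfolding e_def using A y
      by (intro scalar_prod_mult_transpose[of _ n]) simp_all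
    also have "\<dots> \<le> euclidean_norm (e s) * euclidean_norm (mat_exp (s \<cdot>\<^sub>m A) *\<^sub>v y)"
      using norm_scalar_prod_le[OF e, of "mat_exp (s \<cdot>\<^sub>m A) *\<^sub>v y" s] 
        A by simp
    also have "\<dots> \<le> euclidean_norm (e s) * (K * euclidean_norm y)"
      using bound[OF s y] by (intro mult_left_mono) auto
    finally have "euclidean_norm y * euclidean_norm y \<le> (K * euclidean_norm (e s)) * euclidean_norm y"
      by (simp add: power2_eq_square mult_ac)
    then have "euclidean_norm y \<le> K * euclidean_norm (e s)"
      using K by (cases "euclidean_norm y = 0") (auto simp: less_le)
    then have "(euclidean_norm y)\<^sup>2 \<le> (K * euclidean_norm (e s))\<^sup>2"
      by (intro power_mono) auto
    then show ?thesis using K by (simp add: field_simps power_mult_distrib)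
  qed
  have "(T - S) / K\<^sup>2 * (euclidean_norm y)\<^sup>2 = integral {S..T} (\<lambda>s. (euclidean_norm y)\<^sup>2 / K\<^sup>2)"
    using T by simp
  also have "\<dots> \<le> integral {S..T} (\<lambda>s. (euclidean_norm (e s))\<^sup>2)"
    unfolding e_def
    by (rule integral_le) (use ptw in \<open>auto simp: e_def intro!: integrable_continuous_real
      continuous_on_norm_transpose_mat_exp[OF A y]\<close>)
  finally show ?thesis
    using gramian_increment[OF A y T] by (simp add: e_def)
qed

text \<open>Compactness of \<open>[0, T]\<close> bounds the continuous entries. The constant depends
  on \<open>A\<close>, since inverse exponentials in a family need not be uniformly bounded.\<close>

lemma transpose_mat_exp_bounded:
  assumes A: "A \<in> carrier_mat n n"
  shows "\<exists>M>0. \<forall>s\<in>{0..T}. \<forall>y\<in>carrier_vec n.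
    (euclidean_norm (transpose_mat (mat_exp ((- s) \<cdot>\<^sub>m A)) *\<^sub>v y))\<^sup>2 \<le> M * (euclidean_norm y)\<^sup>2"
proof -
  have "\<exists>B. \<forall>s\<in>{0..T}. norm (mat_exp ((- s) \<cdot>\<^sub>m A) $$ (k, l)) \<le> B" if "k < n" "l < n" for k l
  proof -
    have "compact ((\<lambda>s. mat_exp ((- s) \<cdot>\<^sub>m A) $$ (k, l)) ` {0..T})"
      using A that by (intro compact_continuous_image continuous_intros) auto
    then show ?thesis by (meson bounded_iff compact_imp_bounded imageI)
  qed
  then obtain b where b: "\<And>k l s. k < n \<Longrightarrow> l < n \<Longrightarrow> s \<in> {0..T} \<Longrightarrow> norm (mat_exp ((- s) \<cdot>\<^sub>m A) $$ (k, l)) \<le> b k l"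
    by metis
  define B where "B = (\<Sum>p\<in>{..<n} \<times> {..<n}. \<bar>b (fst p) (snd p)\<bar>)"
  have B: "norm (transpose_mat (mat_exp ((- s) \<cdot>\<^sub>m A)) $$ (k, l)) \<le> B"
    if "k < n" "l < n" "s \<in> {0..T}" for k l s
  proof -
    have "norm (transpose_mat (mat_exp ((- s) \<cdot>\<^sub>m A)) $$ (k, l)) \<le> \<bar>b l k\<bar>"
      using b[of l k s] that carrier_matD[OF mat_exp_carrier[OF smult_carrier_mat[OF A, of "- s"]]] by simp
    also have "\<dots> \<le> B"
      unfolding B_def using that member_le_sum[of "(l, k)" "{..<n} \<times> {..<n}" "\<lambda>p. \<bar>b (fst p) (snd p)\<bar>"] by simp
    finally show ?thesis .
  qed
  have B0: "0 \<le> B" by (simp add: B_def sum_nonneg)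
  \<comment> \<open>The summand 1 makes the constant positive even if \<open>B\<close> is 0.\<close>
  have "(euclidean_norm (transpose_mat (mat_exp ((- s) \<cdot>\<^sub>m A)) *\<^sub>v y))\<^sup>2 \<le>
      ((real n * real n * B)\<^sup>2 + 1) * (euclidean_norm y)\<^sup>2"
    if s: "s \<in> {0..T}" and y: "y \<in> carrier_vec n" for s y
  proof -
    have "euclidean_norm (transpose_mat (mat_exp ((- s) \<cdot>\<^sub>m A)) *\<^sub>v y) \<le> real n * real n * B * euclidean_norm y"
      using A s y B B0 by (intro euclidean_norm_mult_mat_vec_le) auto
    then have "(euclidean_norm (transpose_mat (mat_exp ((- s) \<cdot>\<^sub>m A)) *\<^sub>v y))\<^sup>2 \<le> (real n * real n * B * euclidean_norm y)\<^sup>2"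
      by (intro power_mono) auto
    also have "\<dots> \<le> ((real n * real n * B)\<^sup>2 + 1) * (euclidean_norm y)\<^sup>2"
      by (simp add: power_mult_distrib distrib_right)
    finally show ?thesis .
  qed
  then show ?thesis by (intro exI[of _ "(real n * real n * B)\<^sup>2 + 1"]) (auto simp: add_nonneg_pos)
qed

lemma gramian_increment_le:
  assumes A: "A \<in> carrier_mat n n" and y: "y \<in> carrier_vec n" and T: "0 \<le> S" "S \<le> T"
    and M: "\<And>s. s \<in> {S..T} \<Longrightarrow>
      (euclidean_norm (transpose_mat (mat_exp ((- s) \<cdot>\<^sub>m A)) *\<^sub>v y))\<^sup>2 \<le> M"
  shows "scalar_prod y (gramian A T *\<^sub>v y) \<le> scalar_prod y (gramian A S *\<^sub>v y) + (T - S) * M"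
proof -
  have "integral {S..T} (\<lambda>s. (euclidean_norm (transpose_mat (mat_exp ((- s) \<cdot>\<^sub>m A)) *\<^sub>v y))\<^sup>2)
      \<le> integral {S..T} (\<lambda>s. M)"
    using M by (intro integral_le integrable_continuous_real continuous_on_norm_transpose_mat_exp[OF A y]) auto
  then show ?thesis using gramian_increment[OF A y T] T by simp
qed

text \<open>A nonzero kernel vector would contradict \<open>pos\<close>, so the determinant is
  nonzero, \<open>mat_inverse\<close> is not \<open>None\<close>, and \<open>the\<close> in
  \<open>gramian_inv\<close> returns a genuine inverse.\<close>

lemma gramian_inv_props:
  assumes A: "A \<in> carrier_mat n n"
    and pos: "\<And>y. y \<in> carrier_vec n \<Longrightarrow> y \<noteq> 0\<^sub>v n \<Longrightarrow> 0 < scalar_prod y (gramian A T *\<^sub>v y)"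
  shows "gramian_inv A T \<in> carrier_mat n n" "gramian A T * gramian_inv A T = 1\<^sub>m n"
proof -
  have W: "gramian A T \<in> carrier_mat n n" using A by simp
  have "Determinant.det (gramian A T) \<noteq> 0"
  proof
    assume "Determinant.det (gramian A T) = 0"
    then obtain v where v: "v \<in> carrier_vec n" "v \<noteq> 0\<^sub>v n" "gramian A T *\<^sub>v v = 0\<^sub>v n"
      using det_0_iff_vec_prod_zero_field[OF W] by auto
    then show False using pos[OF v(1,2)] by simp
  qed
  then have "gramian A T \<in> Units (ring_mat TYPE(real) n ())"
    by (rule det_non_zero_imp_unit[OF W])
  then have "mat_inverse (gramian A T) \<noteq> None"
    using mat_inverse(1)[OF W, of "()"] by blast
  then obtain B where "mat_inverse (gramian A T) = Some B" by blast
  then show "gramian_inv A T \<in> carrier_mat n n" "gramian A T * gramian_inv A T = 1\<^sub>m n"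
    using mat_inverse(2)[OF W, of B] by (simp_all add: gramian_inv_def)
qed

section \<open>The energy of one coordinate under a growth bound\<close>

context
  fixes A :: "real Matrix.mat" and n :: nat and \<kappa> :: real
  assumes A: "A \<in> carrier_mat n n" and \<kappa>: "0 < \<kappa>"
    and growth: "\<And>t v. 0 \<le> t \<Longrightarrow> v \<in> carrier_vec n \<Longrightarrow>
      euclidean_norm (mat_exp (t \<cdot>\<^sub>m A) *\<^sub>v v) \<le> \<kappa> * exp t * euclidean_norm v"
begin

lemma gramian_increment_growth:
  assumes "0 \<le> S" "S \<le> T" "y \<in> carrier_vec n"
  shows "scalar_prod y (gramian A S *\<^sub>v y) + (T - S) / (\<kappa> * exp T)\<^sup>2 * (euclidean_norm y)\<^sup>2
    \<le> scalar_prod y (gramian A T *\<^sub>v y)"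
proof (rule gramian_increment_ge[OF A assms(3,1,2)])
  fix s and v :: "real Matrix.vec" assume s: "S \<le> s" "s \<le> T" and v: "v \<in> carrier_vec n"
  have "euclidean_norm (mat_exp (s \<cdot>\<^sub>m A) *\<^sub>v v) \<le> \<kappa> * exp s * euclidean_norm v"
    using s v assms by (intro growth) auto
  also have "\<dots> \<le> \<kappa> * exp T * euclidean_norm v"
    using s \<kappa> by (intro mult_right_mono mult_left_mono) auto
  finally show "euclidean_norm (mat_exp (s \<cdot>\<^sub>m A) *\<^sub>v v) \<le> \<kappa> * exp T * euclidean_norm v" .
qed (use \<kappa> in simp)

lemma gramian_ge:
  assumes "0 \<le> T" "y \<in> carrier_vec n"
  shows "T / (\<kappa> * exp T)\<^sup>2 * (euclidean_norm y)\<^sup>2 \<le> scalar_prod y (gramian A T *\<^sub>v y)"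
  using gramian_increment_growth[of 0 T y] gramian_nonneg[OF A, of y 0] assms by simp

lemma gramian_pos:
  assumes "0 < T" "y \<in> carrier_vec n" "y \<noteq> 0\<^sub>v n"
  shows "0 < scalar_prod y (gramian A T *\<^sub>v y)"
proof -
  have "0 < T / (\<kappa> * exp T)\<^sup>2 * (euclidean_norm y)\<^sup>2"
    using assms \<kappa> euclidean_norm_pos[OF assms(2,3)] by simp
  also have "\<dots> \<le> scalar_prod y (gramian A T *\<^sub>v y)" using gramian_ge assms by simp
  finally show ?thesis .
qed

lemma gramian_inv_carrier:
  assumes "0 < T"
  shows "gramian_inv A T \<in> carrier_mat n n"
  using gramian_inv_props(1)[OF A gramian_pos] assms by blast

lemma gramian_inv_mult_carrier:
  assumes "0 < T" "x \<in> carrier_vec n"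
  shows "gramian_inv A T *\<^sub>v x \<in> carrier_vec n"
  by (rule mult_mat_vec_carrier[OF gramian_inv_carrier[OF assms(1)] assms(2)])

lemma gramian_gramian_inv:
  assumes T: "0 < T" and x: "x \<in> carrier_vec n"
  shows "gramian A T *\<^sub>v (gramian_inv A T *\<^sub>v x) = x"
proof -
  have "gramian A T *\<^sub>v (gramian_inv A T *\<^sub>v x) = (gramian A T * gramian_inv A T) *\<^sub>v x"
    using A gramian_inv_carrier[OF T] x by (intro assoc_mult_mat_vec[symmetric, of _ n n]) auto
  also have "gramian A T * gramian_inv A T = 1\<^sub>m n"
    using T by (intro gramian_inv_props(2)[OF A] gramian_pos)
  finally show ?thesis using x by simp
qed

lemma gramian_inv_quadratic:
  assumes "0 < T" "x \<in> carrier_vec n"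
  shows "scalar_prod (gramian_inv A T *\<^sub>v x) (gramian A T *\<^sub>v (gramian_inv A T *\<^sub>v x)) =
    scalar_prod x (gramian_inv A T *\<^sub>v x)"
  using gramian_gramian_inv[OF assms] comm_scalar_prod[OF gramian_inv_mult_carrier[OF assms] assms(2)]
  by simp

lemma gramian_inv_nonneg:
  assumes "0 < T" "x \<in> carrier_vec n"
  shows "0 \<le> scalar_prod x (gramian_inv A T *\<^sub>v x)"
  using gramian_inv_quadratic[OF assms] gramian_nonneg[OF A gramian_inv_mult_carrier[OF assms], of T]
  by simp

text \<open>The difference of the two sides is the quadratic form of \<open>gramian A T\<close> at
  \<open>y - gramian_inv A T *\<^sub>v x\<close>, so \<open>gramian_inv A T *\<^sub>v x\<close> is
  the optimal \<open>y\<close>.\<close>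

lemma gramian_inv_variational:
  assumes T: "0 < T" and x: "x \<in> carrier_vec n" and y: "y \<in> carrier_vec n"
  shows "2 * scalar_prod x y - scalar_prod y (gramian A T *\<^sub>v y) \<le> scalar_prod x (gramian_inv A T *\<^sub>v x)"
proof -
  let ?p = "gramian_inv A T *\<^sub>v x" and ?W = "gramian A T"
  have W: "?W \<in> carrier_mat n n" using A by simp
  have p: "?p \<in> carrier_vec n" by (rule gramian_inv_mult_carrier[OF T x])
  have Wp: "?W *\<^sub>v ?p = x" by (rule gramian_gramian_inv[OF T x])
  have Wy: "?W *\<^sub>v y \<in> carrier_vec n" using W y by simp
  have "0 \<le> scalar_prod (y - ?p) (?W *\<^sub>v (y - ?p))"
    using y p by (intro gramian_nonneg[OF A]) simp
  also have "?W *\<^sub>v (y - ?p) = ?W *\<^sub>v y - x"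
    using mult_minus_distrib_mat_vec[OF W y p] Wp by simp
  also have "scalar_prod (y - ?p) (?W *\<^sub>v y - x) =
      scalar_prod y (?W *\<^sub>v y) - scalar_prod y x - (scalar_prod ?p (?W *\<^sub>v y) - scalar_prod ?p x)"
    using x y p Wy by (simp add: minus_scalar_prod_distrib[of _ n] scalar_prod_minus_distrib[of _ n])
  also have "scalar_prod ?p (?W *\<^sub>v y) = scalar_prod y x"
    using gramian_sym[OF A y p, of T] Wp by simp
  also have "scalar_prod ?p x = scalar_prod x ?p" by (rule comm_scalar_prod[OF p x])
  also have "scalar_prod y x = scalar_prod x y" by (rule comm_scalar_prod[OF y x])
  finally show ?thesis by simp
qed

text \<open>With \<open>p\<close> the solution of \<open>gramian A T *\<^sub>v p = x\<close>,
  coercivity and Cauchy-Schwarz give \<open>c * |p|^2 <= <x, p> <= |x| * |p|\<close>; one factor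
  \<open>|p|\<close> cancels.\<close>

lemma gramian_inv_norm_le:
  assumes T: "0 < T" and x: "x \<in> carrier_vec n" and c: "0 < c"
    and coercive: "\<And>y. y \<in> carrier_vec n \<Longrightarrow> c * (euclidean_norm y)\<^sup>2 \<le> scalar_prod y (gramian A T *\<^sub>v y)"
  shows "euclidean_norm (gramian_inv A T *\<^sub>v x) \<le> euclidean_norm x / c"
    and "scalar_prod x (gramian_inv A T *\<^sub>v x) \<le> (euclidean_norm x)\<^sup>2 / c"
proof -
  let ?p = "gramian_inv A T *\<^sub>v x"
  have p: "?p \<in> carrier_vec n" by (rule gramian_inv_mult_carrier[OF T x])
  have xp: "scalar_prod x ?p \<le> euclidean_norm x * euclidean_norm ?p"
    using norm_scalar_prod_le[OF x p] by simp
  have "c * (euclidean_norm ?p)\<^sup>2 \<le> euclidean_norm x * euclidean_norm ?p"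
    using coercive[OF p] gramian_inv_quadratic[OF T x] xp by simp
  then have "(c * euclidean_norm ?p) * euclidean_norm ?p \<le> euclidean_norm x * euclidean_norm ?p"
    by (simp add: power2_eq_square mult.assoc)
  then have "c * euclidean_norm ?p \<le> euclidean_norm x"
    by (cases "euclidean_norm ?p = 0") (auto simp: less_le)
  then show le: "euclidean_norm ?p \<le> euclidean_norm x / c"
    using c by (simp add: field_simps)
  have "euclidean_norm x * euclidean_norm ?p \<le> euclidean_norm x * (euclidean_norm x / c)"
    by (intro mult_left_mono le) simp
  then show "scalar_prod x ?p \<le> (euclidean_norm x)\<^sup>2 / c"
    using xp by (simp add: power2_eq_square)
qed

lemma gramian_inv_upper:
  assumes T: "0 < T" and x: "x \<in> carrier_vec n"
  shows "scalar_prod x (gramian_inv A T *\<^sub>v x) \<le> (\<kappa> * exp T)\<^sup>2 / T * (euclidean_norm x)\<^sup>2"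
proof -
  have "scalar_prod x (gramian_inv A T *\<^sub>v x) \<le> (euclidean_norm x)\<^sup>2 / (T / (\<kappa> * exp T)\<^sup>2)"
    using T \<kappa> by (intro gramian_inv_norm_le(2)[OF T x] gramian_ge) auto
  then show ?thesis by (simp add: mult.commute)
qed

lemma gramian_inv_nonzero:
  assumes T: "0 < T" and x: "x \<in> carrier_vec n" "x \<noteq> 0\<^sub>v n"
  shows "gramian_inv A T *\<^sub>v x \<noteq> 0\<^sub>v n"
proof
  assume "gramian_inv A T *\<^sub>v x = 0\<^sub>v n"
  then have "gramian A T *\<^sub>v 0\<^sub>v n = x" using gramian_gramian_inv[OF T x(1)] by simp
  moreover have "gramian A T *\<^sub>v 0\<^sub>v n = 0\<^sub>v n"
    using carrier_matD[OF gramian_carrier[OF A, of T]]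
    by (intro eq_vecI) (auto intro!: scalar_prod_right_zero carrier_vecI)
  ultimately show False using x(2) by simp
qed

text \<open>The optimal vector for \<open>T\<close> is a competitor for \<open>S\<close>. It is
  nonzero, so its quadratic form is strictly smaller at \<open>S\<close>, and the variational value
  there is strictly larger.\<close>

lemma gramian_inv_strict_antimono:
  assumes T: "0 < S" "S < T" and x: "x \<in> carrier_vec n" "x \<noteq> 0\<^sub>v n"
  shows "scalar_prod x (gramian_inv A T *\<^sub>v x) < scalar_prod x (gramian_inv A S *\<^sub>v x)"
proof -
  let ?p = "gramian_inv A T *\<^sub>v x"
  have T0: "0 < T" using T by simp
  have p: "?p \<in> carrier_vec n" by (rule gramian_inv_mult_carrier[OF T0 x(1)])
  have "0 < (T - S) / (\<kappa> * exp T)\<^sup>2 * (euclidean_norm ?p)\<^sup>2"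
    using T \<kappa> euclidean_norm_pos[OF p gramian_inv_nonzero[OF T0 x]] by simp
  then have "scalar_prod ?p (gramian A S *\<^sub>v ?p) < scalar_prod ?p (gramian A T *\<^sub>v ?p)"
    using gramian_increment_growth[of S T ?p] T p by simp
  then show ?thesis
    using gramian_inv_variational[OF T(1) x(1) p] gramian_inv_quadratic[OF T0 x(1)] by simp
qed

lemma gramian_inv_antimono:
  assumes T: "0 < S" "S \<le> T" and x: "x \<in> carrier_vec n"
  shows "scalar_prod x (gramian_inv A T *\<^sub>v x) \<le> scalar_prod x (gramian_inv A S *\<^sub>v x)"
proof (cases "S = T \<or> x = 0\<^sub>v n")
  case True
  then show ?thesis
    using gramian_inv_mult_carrier[of S "0\<^sub>v n"] gramian_inv_mult_carrier[of T "0\<^sub>v n"] T by auto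
next
  case False
  then show ?thesis using gramian_inv_strict_antimono[of S T x] T x by simp
qed

text \<open>The optimal vector for the earlier time is inserted at the later one, so the energy
  drops by at most the growth of one quadratic form; monotonicity gives the other direction.\<close>

lemma gramian_inv_lipschitz:
  assumes S: "0 < S" and x: "x \<in> carrier_vec n"
  shows "\<exists>L. L-lipschitz_on {S..R} (\<lambda>T. scalar_prod x (gramian_inv A T *\<^sub>v x))"
proof -
  obtain M where M: "0 < M" "\<And>s y. s \<in> {0..R} \<Longrightarrow> y \<in> carrier_vec n \<Longrightarrow>
    (euclidean_norm (transpose_mat (mat_exp ((- s) \<cdot>\<^sub>m A)) *\<^sub>v y))\<^sup>2 \<le> M * (euclidean_norm y)\<^sup>2"
    using transpose_mat_exp_bounded[OF A, of R] by blast
  \<comment> \<open>A coercivity constant for all times of \<open>[S, R]\<close>: the numerator is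
    least at \<open>S\<close>, the denominator greatest at \<open>R\<close>. It bounds all the
    optimal vectors there.\<close>
  define c where "c = S / (\<kappa> * exp R)\<^sup>2"
  have c: "0 < c" using S \<kappa> by (simp add: c_def)
  define L where "L = M * (euclidean_norm x / c)\<^sup>2"
  let ?g = "\<lambda>T. scalar_prod x (gramian_inv A T *\<^sub>v x)"
  have step: "?g T \<le> ?g T' + L * (T' - T)" if T: "S \<le> T" "T \<le> T'" "T' \<le> R" for T T'
  proof -
    let ?p = "gramian_inv A T *\<^sub>v x"
    have T0: "0 < T" "0 < T'" using T S by auto
    have p: "?p \<in> carrier_vec n" by (rule gramian_inv_mult_carrier[OF T0(1) x])
    have "euclidean_norm ?p \<le> euclidean_norm x / c"
    proof (rule gramian_inv_norm_le(1)[OF T0(1) x c])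
      fix y :: "real Matrix.vec" assume y: "y \<in> carrier_vec n"
      have "c \<le> T / (\<kappa> * exp T)\<^sup>2"
        unfolding c_def using T S \<kappa> by (intro frac_le power_mono mult_left_mono) auto
      then have "c * (euclidean_norm y)\<^sup>2 \<le> T / (\<kappa> * exp T)\<^sup>2 * (euclidean_norm y)\<^sup>2"
        by (intro mult_right_mono) auto
      also have "\<dots> \<le> scalar_prod y (gramian A T *\<^sub>v y)" using gramian_ge T0 y by simp
      finally show "c * (euclidean_norm y)\<^sup>2 \<le> scalar_prod y (gramian A T *\<^sub>v y)" .
    qed
    then have "M * (euclidean_norm ?p)\<^sup>2 \<le> L"
      unfolding L_def using M(1) by (intro mult_left_mono power_mono) auto
    then have "scalar_prod ?p (gramian A T' *\<^sub>v ?p) \<le> scalar_prod ?p (gramian A T *\<^sub>v ?p) + (T' - T) * L"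
      using T T0 p by (intro gramian_increment_le[OF A p] order_trans[OF M(2)]) auto
    then show ?thesis
      using gramian_inv_variational[OF T0(2) x p] gramian_inv_quadratic[OF T0(1) x] by (simp add: mult.commute)
  qed
  have "\<bar>?g T - ?g T'\<bar> \<le> L * \<bar>T - T'\<bar>" if "T \<in> {S..R}" "T' \<in> {S..R}" for T T'
    using that
  proof (induction T T' rule: linorder_wlog)
    case (le T T')
    then show ?case
      using step[of T T'] gramian_inv_antimono[of T T' x] S x by auto
  next
    case (sym T T')
    then show ?case by (simp add: abs_minus_commute)
  qed
  moreover have "0 \<le> L" using M(1) by (simp add: L_def)
  ultimately show ?thesis by (auto simp: lipschitz_on_def dist_real_def)
qed

lemma continuous_on_gramian_inv:
  assumes x: "x \<in> carrier_vec n"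
  shows "continuous_on {0<..} (\<lambda>T. scalar_prod x (gramian_inv A T *\<^sub>v x))"
proof (rule continuous_at_imp_continuous_on, rule ballI)
  fix T :: real assume T: "T \<in> {0<..}"
  obtain L where "L-lipschitz_on {T/2..T+1} (\<lambda>T. scalar_prod x (gramian_inv A T *\<^sub>v x))"
    using gramian_inv_lipschitz[OF _ x, of "T/2" "T+1"] T by auto
  then have "continuous_on {T/2..T+1} (\<lambda>T. scalar_prod x (gramian_inv A T *\<^sub>v x))"
    by (rule lipschitz_on_continuous_on)
  then show "isCont (\<lambda>T. scalar_prod x (gramian_inv A T *\<^sub>v x)) T"
    using T by (intro continuous_on_interior[of "{T/2..T+1}"]) auto
qed

text \<open>Competitors are taken along \<open>x\<close>. For small \<open>T\<close> the Gramian
  form is at most \<open>T * M\<close> times the squared norm, so the lower bound is quadratic in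
  the factor \<open>r\<close>, and its maximum \<open>N / (M * T)\<close> grows without limit as
  \<open>T\<close> tends to 0.\<close>

lemma gramian_inv_blowup:
  assumes x: "x \<in> carrier_vec n" "x \<noteq> 0\<^sub>v n"
  shows "\<exists>T>0. e \<le> scalar_prod x (gramian_inv A T *\<^sub>v x)"
proof -
  obtain M where M: "0 < M" "\<And>s y. s \<in> {0..1} \<Longrightarrow> y \<in> carrier_vec n \<Longrightarrow>
    (euclidean_norm (transpose_mat (mat_exp ((- s) \<cdot>\<^sub>m A)) *\<^sub>v y))\<^sup>2 \<le> M * (euclidean_norm y)\<^sup>2"
    using transpose_mat_exp_bounded[OF A, of 1] by blast
  define N where "N = (euclidean_norm x)\<^sup>2"
  have N: "0 < N" using euclidean_norm_pos[OF x] by (simp add: N_def)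
  \<comment> \<open>The bound 1 stays in the range of validity of \<open>M\<close>; the other one
    makes \<open>N / (M * T)\<close> at least \<open>\<bar>e\<bar> + 1\<close>, where the summand 1
    avoids a zero denominator.\<close>
  define T where "T = min 1 (N / (M * (\<bar>e\<bar> + 1)))"
  have T: "0 < T" "T \<le> 1" using M(1) N by (auto simp: T_def)
  \<comment> \<open>The maximizer of \<open>2 * (r * N) - T * (M * (r\<^sup>2 * N))\<close>.\<close>
  define r where "r = 1 / (M * T)"
  have y: "r \<cdot>\<^sub>v x \<in> carrier_vec n" using x by simp
  have nrm: "(euclidean_norm (r \<cdot>\<^sub>v x))\<^sup>2 = r\<^sup>2 * N"
    by (simp add: euclidean_norm_smult power_mult_distrib N_def)
  have "scalar_prod (r \<cdot>\<^sub>v x) (gramian A 0 *\<^sub>v (r \<cdot>\<^sub>v x)) = 0"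
    using gramian_quadratic[OF A y, of 0] by simp
  then have "scalar_prod (r \<cdot>\<^sub>v x) (gramian A T *\<^sub>v (r \<cdot>\<^sub>v x)) \<le> T * (M * (r\<^sup>2 * N))"
    using gramian_increment_le[OF A y, of 0 T "M * (r\<^sup>2 * N)"] M(2)[of _ "r \<cdot>\<^sub>v x"] T y nrm by auto
  moreover have "scalar_prod x (r \<cdot>\<^sub>v x) = r * N"
    unfolding N_def euclidean_norm_sq_real using scalar_prod_smult_right[of x x r] by simp
  ultimately have "2 * (r * N) - T * (M * (r\<^sup>2 * N)) \<le> scalar_prod x (gramian_inv A T *\<^sub>v x)"
    using gramian_inv_variational[OF T(1) x(1) y] by linarith
  moreover have "2 * (r * N) - T * (M * (r\<^sup>2 * N)) = N / (M * T)"
    using M(1) T by (simp add: r_def field_simps power2_eq_square)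
  moreover have "e \<le> N / (M * T)"
  proof -
    have "T \<le> N / (M * (\<bar>e\<bar> + 1))" by (simp add: T_def)
    then have "T * (M * (\<bar>e\<bar> + 1)) \<le> N" using M(1) by (subst (asm) pos_le_divide_eq) auto
    then have "(\<bar>e\<bar> + 1) * (M * T) \<le> N" by (simp only: mult_ac)
    then have "\<bar>e\<bar> + 1 \<le> N / (M * T)" using M(1) T by (simp add: pos_le_divide_eq)
    then show ?thesis by linarith
  qed
  ultimately show ?thesis using T by (intro exI[of _ T]) auto
qed

text \<open>Once \<beta> stays below 1, the quadratic form of the Gramian gains at least
  \<open>|y|^2\<close> per unit of time, so the energy is at most
  \<open>|x|^2 / (T - S)\<close>.\<close>

lemma gramian_inv_tendsto_0:
  assumes x: "x \<in> carrier_vec n" and \<beta>: "(\<beta> \<longlongrightarrow> 0) at_top"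
    and decay: "\<And>t v. 0 \<le> t \<Longrightarrow> v \<in> carrier_vec n \<Longrightarrow>
      euclidean_norm (mat_exp (t \<cdot>\<^sub>m A) *\<^sub>v v) \<le> \<beta> t * euclidean_norm v"
  shows "((\<lambda>T. scalar_prod x (gramian_inv A T *\<^sub>v x)) \<longlongrightarrow> 0) at_top"
proof -
  have "eventually (\<lambda>t. \<beta> t < 1) at_top" using \<beta> by (rule order_tendstoD) simp
  then obtain S0 where S0: "\<And>t. S0 \<le> t \<Longrightarrow> \<beta> t < 1" by (auto simp: eventually_at_top_linorder)
  define S where "S = max 0 S0"
  have S: "0 \<le> S" "\<And>t. S \<le> t \<Longrightarrow> \<beta> t \<le> 1" using S0 by (auto simp: S_def less_imp_le)
  have upper: "scalar_prod x (gramian_inv A T *\<^sub>v x) \<le> (euclidean_norm x)\<^sup>2 / (T - S)" if T: "S < T" for T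
  proof (rule gramian_inv_norm_le(2)[OF _ x])
    fix y :: "real Matrix.vec" assume y: "y \<in> carrier_vec n"
    have "scalar_prod y (gramian A S *\<^sub>v y) + (T - S) / 1\<^sup>2 * (euclidean_norm y)\<^sup>2 \<le> scalar_prod y (gramian A T *\<^sub>v y)"
    proof (rule gramian_increment_ge[OF A y])
      fix s and v :: "real Matrix.vec" assume s: "S \<le> s" and v: "v \<in> carrier_vec n"
      have "euclidean_norm (mat_exp (s \<cdot>\<^sub>m A) *\<^sub>v v) \<le> \<beta> s * euclidean_norm v"
        using s S v by (intro decay) auto
      also have "\<dots> \<le> 1 * euclidean_norm v" using S s by (intro mult_right_mono) auto
      finally show "euclidean_norm (mat_exp (s \<cdot>\<^sub>m A) *\<^sub>v v) \<le> 1 * euclidean_norm v" .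
    qed (use S T in auto)
    then show "(T - S) * (euclidean_norm y)\<^sup>2 \<le> scalar_prod y (gramian A T *\<^sub>v y)"
      using gramian_nonneg[OF A y, of S] by simp
  qed (use S T in auto)
  show ?thesis
  proof (rule tendsto_sandwich[OF _ _ tendsto_const])
    show "eventually (\<lambda>T. 0 \<le> scalar_prod x (gramian_inv A T *\<^sub>v x)) at_top"
      using eventually_gt_at_top[of 0] by eventually_elim (rule gramian_inv_nonneg[OF _ x])
    show "eventually (\<lambda>T. scalar_prod x (gramian_inv A T *\<^sub>v x) \<le> (euclidean_norm x)\<^sup>2 / (T - S)) at_top"
      using eventually_gt_at_top[of S] by eventually_elim (rule upper)
    show "((\<lambda>T. (euclidean_norm x)\<^sup>2 / (T - S)) \<longlongrightarrow> 0) at_top" by real_asymp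
  qed
qed

end

section \<open>Controls of finite energy\<close>

text \<open>On a bounded interval constants are integrable, and
  \<open>|y| <= 1 + y\<^sup>2\<close>.\<close>

lemma integrable_of_square_integrable:
  fixes f :: "real \<Rightarrow> real"
  assumes "f \<in> borel_measurable (lebesgue_on {a..b})" "integrable (lebesgue_on {a..b}) (\<lambda>s. (f s)\<^sup>2)"
  shows "integrable (lebesgue_on {a..b}) f"
proof (rule Bochner_Integration.integrable_bound)
  have "integrable (lebesgue_on {a..b}) (\<lambda>s. 1 :: real)"
    by (rule continuous_imp_integrable_real) simp
  then show "integrable (lebesgue_on {a..b}) (\<lambda>s. 1 + (f s)\<^sup>2)"
    using assms(2) by (rule Bochner_Integration.integrable_add)
  have "norm y \<le> norm (1 + y\<^sup>2)" for y :: real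
  proof -
    have "0 \<le> (\<bar>y\<bar> - 1)\<^sup>2" by simp
    then have "2 * \<bar>y\<bar> \<le> 1 + y\<^sup>2" by (simp add: power2_diff)
    then show ?thesis by simp
  qed
  then show "AE s in lebesgue_on {a..b}. norm (f s) \<le> norm (1 + (f s)\<^sup>2)" by (intro AE_I2)
qed (rule assms)

lemma integrable_continuous_mult:
  fixes f g :: "real \<Rightarrow> real"
  assumes g: "continuous_on {a..b} g" and f: "integrable (lebesgue_on {a..b}) f"
  shows "integrable (lebesgue_on {a..b}) (\<lambda>s. g s * f s)"
proof -
  have "bounded (g ` {a..b})"
    using g by (intro compact_imp_bounded compact_continuous_image) auto
  then obtain B where "\<forall>y\<in>g ` {a..b}. norm y \<le> B"
    unfolding bounded_iff ..
  then have B: "\<bar>g s\<bar> \<le> B" if "s \<in> {a..b}" for s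
    using that by simp
  show ?thesis
  proof (rule Bochner_Integration.integrable_bound)
    show "integrable (lebesgue_on {a..b}) (\<lambda>s. B * f s)" using f by simp
    show "(\<lambda>s. g s * f s) \<in> borel_measurable (lebesgue_on {a..b})"
      using f continuous_imp_integrable_real[OF g] by (intro borel_measurable_times) auto
    show "AE s in lebesgue_on {a..b}. norm (g s * f s) \<le> norm (B * f s)"
    proof (rule AE_I2)
      fix s assume "s \<in> space (lebesgue_on {a..b})"
      then have "\<bar>g s\<bar> \<le> \<bar>B\<bar>" using B[of s] by simp
      then show "norm (g s * f s) \<le> norm (B * f s)"
        by (simp add: abs_mult mult_right_mono)
    qed
  qed
qed

text \<open>The form that one coordinate of an admissible control takes, with the extended energy
  replaced by Bochner integrability so that energies are real numbers.\<close>

definition L2_control :: "nat \<Rightarrow> real \<Rightarrow> (real \<Rightarrow> real Matrix.vec) \<Rightarrow> bool" where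
  "L2_control n T u \<longleftrightarrow>
     (\<forall>s\<in>{0..T}. u s \<in> carrier_vec n) \<and>
     (\<forall>k<n. (\<lambda>s. vec_index (u s) k) \<in> borel_measurable (lebesgue_on {0..T})) \<and>
     integrable (lebesgue_on {0..T}) (\<lambda>s. (euclidean_norm (u s))\<^sup>2)"

lemma L2_control_index_sq:
  assumes u: "L2_control n T u" and k: "k < n"
  shows "integrable (lebesgue_on {0..T}) (\<lambda>s. (vec_index (u s) k)\<^sup>2)"
proof (rule Bochner_Integration.integrable_bound)
  show "integrable (lebesgue_on {0..T}) (\<lambda>s. (euclidean_norm (u s))\<^sup>2)"
    using u by (simp add: L2_control_def)
  have "(\<lambda>s. vec_index (u s) k) \<in> borel_measurable (lebesgue_on {0..T})"
    using u k by (simp add: L2_control_def)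
  then show "(\<lambda>s. (vec_index (u s) k)\<^sup>2) \<in> borel_measurable (lebesgue_on {0..T})"
    by (rule borel_measurable_power)
  show "AE s in lebesgue_on {0..T}. norm ((vec_index (u s) k)\<^sup>2) \<le> norm ((euclidean_norm (u s))\<^sup>2)"
  proof (rule AE_I2)
    fix s assume "s \<in> space (lebesgue_on {0..T})"
    then have "u s \<in> carrier_vec n"
      using u by (simp add: L2_control_def)
    then have "norm (vec_index (u s) k) \<le> euclidean_norm (u s)"
      using k by (rule norm_vec_index_le)
    then show "norm ((vec_index (u s) k)\<^sup>2) \<le> norm ((euclidean_norm (u s))\<^sup>2)"
      unfolding norm_power by (intro power_mono) simp_all
  qed
qed

lemma L2_control_index:
  assumes "L2_control n T u" "k < n"
  shows "integrable (lebesgue_on {0..T}) (\<lambda>s. vec_index (u s) k)"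
  by (rule integrable_of_square_integrable[OF _ L2_control_index_sq[OF assms]])
    (use assms in \<open>simp add: L2_control_def\<close>)

lemma L2_control_subinterval:
  assumes u: "L2_control n T u" and t: "t \<le> T"
  shows "L2_control n t u"
proof -
  have sub: "{0..t} \<subseteq> {0..T}" using t by auto
  have "set_integrable lebesgue {0..T} (\<lambda>s. (euclidean_norm (u s))\<^sup>2)"
    using u by (simp add: L2_control_def set_integrable_def integrable_restrict_space)
  then have "set_integrable lebesgue {0..t} (\<lambda>s. (euclidean_norm (u s))\<^sup>2)"
    by (rule set_integrable_subset[OF _ _ sub]) simp
  then have "integrable (lebesgue_on {0..t}) (\<lambda>s. (euclidean_norm (u s))\<^sup>2)"
    by (simp add: set_integrable_def integrable_restrict_space)
  moreover have "(\<lambda>s. vec_index (u s) k) \<in> borel_measurable (lebesgue_on {0..t})" if "k < n" for k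
    using u that by (intro measurable_restrict_mono[OF _ sub]) (simp add: L2_control_def)
  moreover have "u s \<in> carrier_vec n" if "s \<in> {0..t}" for s
    using u that sub by (auto simp: L2_control_def)
  ultimately show ?thesis by (simp add: L2_control_def)
qed

lemma L2_control_subinterval_integral:
  assumes u: "L2_control n T u" and t: "t \<le> T"
  shows "(LINT s|lebesgue_on {0..t}. (euclidean_norm (u s))\<^sup>2) \<le> (LINT s|lebesgue_on {0..T}. (euclidean_norm (u s))\<^sup>2)"
proof -
  let ?f = "\<lambda>s. (euclidean_norm (u s))\<^sup>2"
  have "integrable (lebesgue_on {0..t}) ?f" "integrable (lebesgue_on {0..T}) ?f"
    using u L2_control_subinterval[OF u t] by (simp_all only: L2_control_def)
  then have "integrable lebesgue (\<lambda>s. indicator {0..t} s *\<^sub>R ?f s)"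
    "integrable lebesgue (\<lambda>s. indicator {0..T} s *\<^sub>R ?f s)"
    by (simp_all add: integrable_restrict_space)
  then have "(LINT s|lebesgue. indicator {0..t} s *\<^sub>R ?f s) \<le> (LINT s|lebesgue. indicator {0..T} s *\<^sub>R ?f s)"
    by (rule integral_mono) (use t in \<open>auto split: split_indicator\<close>)
  then show ?thesis by (simp add: integral_restrict_space)
qed

section \<open>The effect of a control on the state\<close>

lemma integrable_mat_exp_control:
  assumes A: "A \<in> carrier_mat n n" and u: "L2_control n t u" and k: "k < n" and f: "continuous_on {0..t} f"
  shows "integrable (lebesgue_on {0..t}) (\<lambda>s. vec_index (mat_exp (f s \<cdot>\<^sub>m A) *\<^sub>v u s) k)"
proof -
  have "integrable (lebesgue_on {0..t}) (\<lambda>s. \<Sum>j<n. mat_exp (f s \<cdot>\<^sub>m A) $$ (k, j) * vec_index (u s) j)"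
    using A k f u
    by (intro Bochner_Integration.integrable_sum integrable_continuous_mult continuous_intros L2_control_index) auto
  then show ?thesis
  proof (rule Bochner_Integration.integrable_cong[THEN iffD1, rotated -1])
    fix s assume "s \<in> space (lebesgue_on {0..t})"
    then have us: "u s \<in> carrier_vec n" using u by (simp add: L2_control_def)
    show "(\<Sum>j<n. mat_exp (f s \<cdot>\<^sub>m A) $$ (k, j) * vec_index (u s) j) = vec_index (mat_exp (f s \<cdot>\<^sub>m A) *\<^sub>v u s) k"
      by (rule index_mult_mat_vec_sum[OF mat_exp_carrier[OF smult_carrier_mat[OF A]] us k, symmetric])
  qed simp
qed

text \<open>The contribution of the control, transported back to time 0. Steering \<open>x\<close>
  to zero becomes \<open>control_effect A u t = - x\<close>, and the kernel \<open>e^(-sA)\<close>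
  is the one in the Gramian.\<close>

definition control_effect :: "real Matrix.mat \<Rightarrow> (real \<Rightarrow> real Matrix.vec) \<Rightarrow> real \<Rightarrow> real Matrix.vec" where
  "control_effect A u t = Matrix.vec (dim_row A)
     (\<lambda>k. LINT s|lebesgue_on {0..t}. vec_index (mat_exp ((- s) \<cdot>\<^sub>m A) *\<^sub>v u s) k)"

lemma control_effect_carrier [simp]: "A \<in> carrier_mat n n \<Longrightarrow> control_effect A u t \<in> carrier_vec n"
  by (simp add: control_effect_def)

text \<open>The factor \<open>e^(tA)\<close> of \<open>e^((t-s)A)\<close> does not depend on
  \<open>s\<close> and leaves the integral.\<close>

lemma variation_of_constants:
  assumes A: "A \<in> carrier_mat n n" and u: "L2_control n t u" and x: "x \<in> carrier_vec n"
  shows "mat_exp (t \<cdot>\<^sub>m A) *\<^sub>v x +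
    Matrix.vec (dim_row A) (\<lambda>k. LINT s|lebesgue_on {0..t}. vec_index (mat_exp ((t - s) \<cdot>\<^sub>m A) *\<^sub>v u s) k) =
    mat_exp (t \<cdot>\<^sub>m A) *\<^sub>v (x + control_effect A u t)"
proof -
  let ?M = "mat_exp (t \<cdot>\<^sub>m A)"
  have M: "?M \<in> carrier_mat n n" using A by simp
  have "Matrix.vec (dim_row A) (\<lambda>k. LINT s|lebesgue_on {0..t}. vec_index (mat_exp ((t - s) \<cdot>\<^sub>m A) *\<^sub>v u s) k) =
      ?M *\<^sub>v control_effect A u t"
  proof (rule eq_vecI)
    fix k assume "k < dim_vec (?M *\<^sub>v control_effect A u t)"
    then have k: "k < n" using A by simp
    have ptw: "vec_index (mat_exp ((t - s) \<cdot>\<^sub>m A) *\<^sub>v u s) k =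
        (\<Sum>j<n. ?M $$ (k, j) * vec_index (mat_exp ((- s) \<cdot>\<^sub>m A) *\<^sub>v u s) j)" if "s \<in> {0..t}" for s
    proof -
      have us: "u s \<in> carrier_vec n" using u that by (simp add: L2_control_def)
      have "mat_exp ((t - s) \<cdot>\<^sub>m A) *\<^sub>v u s = ?M *\<^sub>v (mat_exp ((- s) \<cdot>\<^sub>m A) *\<^sub>v u s)"
        using mat_exp_add[OF A, of t "- s"] assoc_mult_mat_vec[OF M mat_exp_carrier[OF smult_carrier_mat[OF A]] us]
        by simp
      then show ?thesis using index_mult_mat_vec_sum[OF M _ k] A by simp
    qed
    have "(LINT s|lebesgue_on {0..t}. vec_index (mat_exp ((t - s) \<cdot>\<^sub>m A) *\<^sub>v u s) k) =
        (LINT s|lebesgue_on {0..t}. (\<Sum>j<n. ?M $$ (k, j) * vec_index (mat_exp ((- s) \<cdot>\<^sub>m A) *\<^sub>v u s) j))"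
      using ptw by (intro Bochner_Integration.integral_cong) auto
    also have "\<dots> = (\<Sum>j<n. ?M $$ (k, j) * (LINT s|lebesgue_on {0..t}. vec_index (mat_exp ((- s) \<cdot>\<^sub>m A) *\<^sub>v u s) j))"
      using integrable_mat_exp_control[OF A u _ continuous_on_minus[OF continuous_on_id]]
      by (subst Bochner_Integration.integral_sum) (auto simp del: index_mult_mat_vec)
    also have "\<dots> = vec_index (?M *\<^sub>v control_effect A u t) k"
      using index_mult_mat_vec_sum[OF M control_effect_carrier[OF A] k] A
      by (simp add: control_effect_def del: index_mult_mat_vec)
    finally show "vec_index (Matrix.vec (dim_row A) (\<lambda>k. LINT s|lebesgue_on {0..t}. vec_index (mat_exp ((t - s) \<cdot>\<^sub>m A) *\<^sub>v u s) k)) k =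
        vec_index (?M *\<^sub>v control_effect A u t) k"
      using A k by simp
  qed (use A in simp)
  then show ?thesis
    using mult_add_distrib_mat_vec[OF M x control_effect_carrier[OF A]] by simp
qed

lemma mat_exp_mult_eq_0_iff:
  assumes A: "A \<in> carrier_mat n n" and v: "v \<in> carrier_vec n"
  shows "mat_exp (t \<cdot>\<^sub>m A) *\<^sub>v v = 0\<^sub>v n \<longleftrightarrow> v = 0\<^sub>v n"
proof
  have M: "mat_exp (s \<cdot>\<^sub>m A) \<in> carrier_mat n n" for s using A by simp
  have zero: "mat_exp (s \<cdot>\<^sub>m A) *\<^sub>v 0\<^sub>v n = 0\<^sub>v n" for s
    using carrier_matD[OF M[of s]] by (intro eq_vecI) (auto intro!: scalar_prod_right_zero carrier_vecI)
  show "mat_exp (t \<cdot>\<^sub>m A) *\<^sub>v v = 0\<^sub>v n" if "v = 0\<^sub>v n" using zero that by simp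
  assume "mat_exp (t \<cdot>\<^sub>m A) *\<^sub>v v = 0\<^sub>v n"
  then have "mat_exp ((- t) \<cdot>\<^sub>m A) *\<^sub>v (mat_exp (t \<cdot>\<^sub>m A) *\<^sub>v v) = 0\<^sub>v n" using zero by simp
  then show "v = 0\<^sub>v n"
    using assoc_mult_mat_vec[OF M M v, of "- t" t] mat_exp_inverse(1)[OF A, of t] v by simp
qed

text \<open>Cauchy-Schwarz against the constant 1: the integral of the squared deviation from the
  mean \<open>c = I / t\<close> is nonnegative. The case \<open>t = 0\<close> is split off because
  of this division.\<close>

lemma integral_sq_le:
  fixes f :: "real \<Rightarrow> real"
  assumes f: "integrable (lebesgue_on {0..t}) f" and f2: "integrable (lebesgue_on {0..t}) (\<lambda>s. (f s)\<^sup>2)"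
    and t: "0 \<le> t"
  shows "(LINT s|lebesgue_on {0..t}. f s)\<^sup>2 \<le> t * (LINT s|lebesgue_on {0..t}. (f s)\<^sup>2)"
proof (cases "t = 0")
  case True
  have "(LINT s|lebesgue_on {0..t}. f s) = integral {0..t} f"
    using f by (rule lebesgue_integral_eq_integral) simp
  then show ?thesis using True by simp
next
  case False
  define I where "I = (LINT s|lebesgue_on {0..t}. f s)"
  define c where "c = I / t"
  have 1: "integrable (lebesgue_on {0..t}) (\<lambda>s. c\<^sup>2)"
    by (rule continuous_imp_integrable_real) simp
  have c2: "(LINT s|lebesgue_on {0..t}. c\<^sup>2) = c\<^sup>2 * t"
    using t by (subst lebesgue_integral_eq_integral[OF 1]) auto
  have "0 \<le> (LINT s|lebesgue_on {0..t}. (f s - c)\<^sup>2)"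
    by (rule Bochner_Integration.integral_nonneg) simp
  also have "\<dots> = (LINT s|lebesgue_on {0..t}. (f s)\<^sup>2 - 2 * c * f s + c\<^sup>2)"
    by (simp add: power2_diff algebra_simps)
  also have "\<dots> = (LINT s|lebesgue_on {0..t}. (f s)\<^sup>2) - 2 * c * I + c\<^sup>2 * t"
    using f f2 1 c2 by (simp add: I_def)
  also have "\<dots> = (LINT s|lebesgue_on {0..t}. (f s)\<^sup>2) - I\<^sup>2 / t"
    using False by (simp add: c_def power2_eq_square)
  finally show ?thesis using False t by (simp add: field_simps I_def)
qed

text \<open>Linear in \<open>(euclidean_norm x)\<^sup>2\<close> and in the energy, so that it can be
  summed over the coordinates of the system. The factors 2 come from
  \<open>(a + b)\<^sup>2 <= 2 * a\<^sup>2 + 2 * b\<^sup>2\<close>, the factor \<open>n\<close> from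
  treating the entries of the integral separately.\<close>

lemma trajectory_bound:
  assumes A: "A \<in> carrier_mat n n" and u: "L2_control n t u" and x: "x \<in> carrier_vec n" and t: "0 \<le> t"
    and K: "\<And>s v. 0 \<le> s \<Longrightarrow> s \<le> t \<Longrightarrow> v \<in> carrier_vec n \<Longrightarrow>
      euclidean_norm (mat_exp (s \<cdot>\<^sub>m A) *\<^sub>v v) \<le> K * euclidean_norm v"
  shows "(euclidean_norm (mat_exp (t \<cdot>\<^sub>m A) *\<^sub>v x +
    Matrix.vec (dim_row A) (\<lambda>k. LINT s|lebesgue_on {0..t}. vec_index (mat_exp ((t - s) \<cdot>\<^sub>m A) *\<^sub>v u s) k)))\<^sup>2 \<le>
    2 * K\<^sup>2 * (euclidean_norm x)\<^sup>2 +
    2 * real n * t * K\<^sup>2 * (LINT s|lebesgue_on {0..t}. (euclidean_norm (u s))\<^sup>2)"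
proof -
  let ?f = "\<lambda>k s. vec_index (mat_exp ((t - s) \<cdot>\<^sub>m A) *\<^sub>v u s) k"
  let ?e = "LINT s|lebesgue_on {0..t}. (euclidean_norm (u s))\<^sup>2"
  define z where "z = Matrix.vec (dim_row A) (\<lambda>k. LINT s|lebesgue_on {0..t}. ?f k s)"
  have z: "z \<in> carrier_vec n" using A by (simp add: z_def)
  have int_u: "integrable (lebesgue_on {0..t}) (\<lambda>s. (euclidean_norm (u s))\<^sup>2)"
    using u by (simp add: L2_control_def)
  have f: "integrable (lebesgue_on {0..t}) (?f k)" if "k < n" for k
    by (rule integrable_mat_exp_control[OF A u that]) (intro continuous_intros)
  have le: "(?f k s)\<^sup>2 \<le> K\<^sup>2 * (euclidean_norm (u s))\<^sup>2" if k: "k < n" and s: "s \<in> {0..t}" for k s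
  proof -
    have us: "u s \<in> carrier_vec n" using u s by (simp add: L2_control_def)
    have "mat_exp ((t - s) \<cdot>\<^sub>m A) *\<^sub>v u s \<in> carrier_vec n"
      using A by simp
    then have "norm (?f k s) \<le> euclidean_norm (mat_exp ((t - s) \<cdot>\<^sub>m A) *\<^sub>v u s)"
      using k by (rule norm_vec_index_le)
    also have "\<dots> \<le> K * euclidean_norm (u s)"
      using K[of "t - s" "u s"] us s by simp
    finally have "(norm (?f k s))\<^sup>2 \<le> (K * euclidean_norm (u s))\<^sup>2"
      by (rule power_mono) (rule norm_ge_zero)
    then show ?thesis by (simp add: power_mult_distrib)
  qed
  have f2: "integrable (lebesgue_on {0..t}) (\<lambda>s. (?f k s)\<^sup>2)" if k: "k < n" for k
  proof (rule Bochner_Integration.integrable_bound)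
    show "integrable (lebesgue_on {0..t}) (\<lambda>s. K\<^sup>2 * (euclidean_norm (u s))\<^sup>2)"
      using int_u by (rule integrable_mult_right)
    show "(\<lambda>s. (?f k s)\<^sup>2) \<in> borel_measurable (lebesgue_on {0..t})"
      using f[OF k] by (intro borel_measurable_power borel_measurable_integrable)
    show "AE s in lebesgue_on {0..t}. norm ((?f k s)\<^sup>2) \<le> norm (K\<^sup>2 * (euclidean_norm (u s))\<^sup>2)"
      by (rule AE_I2) (use le[OF k] in simp)
  qed
  have "(euclidean_norm z)\<^sup>2 \<le> (\<Sum>k<n. t * (K\<^sup>2 * ?e))"
    unfolding euclidean_norm_sq[OF z]
  proof (rule sum_mono)
    fix k assume "k \<in> {..<n}"
    then have k: "k < n" by simp
    have "(norm (vec_index z k))\<^sup>2 = (LINT s|lebesgue_on {0..t}. ?f k s)\<^sup>2"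
      using A k by (simp add: z_def)
    also have "\<dots> \<le> t * (LINT s|lebesgue_on {0..t}. (?f k s)\<^sup>2)"
      by (rule integral_sq_le[OF f[OF k] f2[OF k] t])
    also have "(LINT s|lebesgue_on {0..t}. (?f k s)\<^sup>2) \<le> (LINT s|lebesgue_on {0..t}. K\<^sup>2 * (euclidean_norm (u s))\<^sup>2)"
      by (rule integral_mono[OF f2[OF k] integrable_mult_right[OF int_u]]) (use le[OF k] in simp)
    also have "\<dots> = K\<^sup>2 * ?e" by simp
    finally show "(norm (vec_index z k))\<^sup>2 \<le> t * (K\<^sup>2 * ?e)"
      using t by (simp add: mult_left_mono)
  qed
  then have z_le: "(euclidean_norm z)\<^sup>2 \<le> real n * (t * (K\<^sup>2 * ?e))" by simp
  define a where "a = euclidean_norm (mat_exp (t \<cdot>\<^sub>m A) *\<^sub>v x)"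
  have "a \<le> K * euclidean_norm x" using K t x by (simp add: a_def)
  then have a_le: "a\<^sup>2 \<le> K\<^sup>2 * (euclidean_norm x)\<^sup>2"
    using power_mono[of a "K * euclidean_norm x" 2] by (simp add: power_mult_distrib a_def)
  have "euclidean_norm (mat_exp (t \<cdot>\<^sub>m A) *\<^sub>v x + z) \<le> a + euclidean_norm z"
    unfolding a_def by (rule euclidean_norm_add_le[OF _ z]) (use A in simp)
  then have "(euclidean_norm (mat_exp (t \<cdot>\<^sub>m A) *\<^sub>v x + z))\<^sup>2 \<le> (a + euclidean_norm z)\<^sup>2"
    by (intro power_mono) simp_all
  also have "\<dots> \<le> 2 * a\<^sup>2 + 2 * (euclidean_norm z)\<^sup>2"
    using zero_le_power2[of "a - euclidean_norm z"] by (simp add: power2_sum power2_diff)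
  also have "\<dots> \<le> 2 * (K\<^sup>2 * (euclidean_norm x)\<^sup>2) + 2 * (real n * (t * (K\<^sup>2 * ?e)))"
    using a_le z_le by linarith
  finally show ?thesis by (simp add: z_def mult.assoc)
qed

lemma L2_control_gramian:
  assumes A: "A \<in> carrier_mat n n" and p: "p \<in> carrier_vec n"
  shows "L2_control n T (\<lambda>s. - (transpose_mat (mat_exp ((- s) \<cdot>\<^sub>m A)) *\<^sub>v p))"
proof -
  have dim: "dim_vec (transpose_mat (mat_exp ((- s) \<cdot>\<^sub>m A)) *\<^sub>v p) = n" for s using A by simp
  have "(\<lambda>s. vec_index (- (transpose_mat (mat_exp ((- s) \<cdot>\<^sub>m A)) *\<^sub>v p)) k) \<in> borel_measurable (lebesgue_on {0..T})"
    if k: "k < n" for k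
  proof -
    have "continuous_on {0..T} (\<lambda>s. - vec_index (transpose_mat (mat_exp ((- s) \<cdot>\<^sub>m A)) *\<^sub>v p) k)"
      by (intro continuous_on_minus continuous_on_transpose_mat_exp_mult[OF A p k])
    from borel_measurable_integrable[OF continuous_imp_integrable_real[OF this]]
    show ?thesis using dim k by (simp only: index_uminus_vec)
  qed
  moreover have "integrable (lebesgue_on {0..T}) (\<lambda>s. (euclidean_norm (- (transpose_mat (mat_exp ((- s) \<cdot>\<^sub>m A)) *\<^sub>v p)))\<^sup>2)"
    unfolding euclidean_norm_uminus
    by (rule continuous_imp_integrable_real[OF continuous_on_norm_transpose_mat_exp[OF A p]])
  ultimately show ?thesis using A by (simp add: L2_control_def carrier_vecI)
qed

text \<open>Duality: the transpose moves the exponential from the control to the test vector. A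
  prescribed effect thereby fixes the integrals of \<open>u\<close> against the functions that
  generate the Gramian.\<close>

lemma control_effect_scalar_prod:
  assumes A: "A \<in> carrier_mat n n" and u: "L2_control n T u" and y: "y \<in> carrier_vec n"
  shows "integrable (lebesgue_on {0..T}) (\<lambda>s. scalar_prod (transpose_mat (mat_exp ((- s) \<cdot>\<^sub>m A)) *\<^sub>v y) (u s))"
    and "scalar_prod y (control_effect A u T) =
      (LINT s|lebesgue_on {0..T}. scalar_prod (transpose_mat (mat_exp ((- s) \<cdot>\<^sub>m A)) *\<^sub>v y) (u s))"
proof -
  let ?h = "\<lambda>k s. vec_index (mat_exp ((- s) \<cdot>\<^sub>m A) *\<^sub>v u s) k"
  have h: "integrable (lebesgue_on {0..T}) (\<lambda>s. vec_index y k * ?h k s)" if "k < n" for k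
    by (intro integrable_mult_right integrable_mat_exp_control[OF A u that] continuous_intros)
  have ptw: "scalar_prod (transpose_mat (mat_exp ((- s) \<cdot>\<^sub>m A)) *\<^sub>v y) (u s) = (\<Sum>k<n. vec_index y k * ?h k s)"
    if "s \<in> space (lebesgue_on {0..T})" for s
  proof -
    have us: "u s \<in> carrier_vec n" using u that by (simp add: L2_control_def)
    have M: "mat_exp ((- s) \<cdot>\<^sub>m A) \<in> carrier_mat n n" using A by simp
    show ?thesis
      unfolding scalar_prod_mult_transpose[OF M y us, symmetric]
      by (rule scalar_prod_lessThan) (use A in simp)
  qed
  show "integrable (lebesgue_on {0..T}) (\<lambda>s. scalar_prod (transpose_mat (mat_exp ((- s) \<cdot>\<^sub>m A)) *\<^sub>v y) (u s))"
    by (rule Bochner_Integration.integrable_cong[THEN iffD2, OF refl ptw Bochner_Integration.integrable_sum])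
      (use h in simp_all)
  have "(LINT s|lebesgue_on {0..T}. scalar_prod (transpose_mat (mat_exp ((- s) \<cdot>\<^sub>m A)) *\<^sub>v y) (u s)) =
      (LINT s|lebesgue_on {0..T}. (\<Sum>k<n. vec_index y k * ?h k s))"
    by (rule Bochner_Integration.integral_cong[OF refl ptw])
  also have "\<dots> = (\<Sum>k<n. LINT s|lebesgue_on {0..T}. vec_index y k * ?h k s)"
    by (rule Bochner_Integration.integral_sum) (use h in simp)
  also have "\<dots> = (\<Sum>k<n. vec_index y k * vec_index (control_effect A u T) k)"
    using A by (intro sum.cong refl) (simp add: control_effect_def)
  also have "\<dots> = scalar_prod y (control_effect A u T)"
    by (rule scalar_prod_lessThan[symmetric]) (use A in simp)
  finally show "scalar_prod y (control_effect A u T) =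
      (LINT s|lebesgue_on {0..T}. scalar_prod (transpose_mat (mat_exp ((- s) \<cdot>\<^sub>m A)) *\<^sub>v y) (u s))" ..
qed

lemma gramian_quadratic_LINT:
  assumes A: "A \<in> carrier_mat n n" and y: "y \<in> carrier_vec n"
  shows "scalar_prod y (gramian A T *\<^sub>v y) =
    (LINT s|lebesgue_on {0..T}. (euclidean_norm (transpose_mat (mat_exp ((- s) \<cdot>\<^sub>m A)) *\<^sub>v y))\<^sup>2)"
  unfolding gramian_quadratic[OF A y]
  by (rule lebesgue_integral_eq_integral[symmetric, OF continuous_imp_integrable_real])
    (simp_all add: continuous_on_norm_transpose_mat_exp[OF A y])

text \<open>With e(s) the transposed exponential applied to \<open>p\<close>, the integral of
  \<open>|u + e|^2\<close> is nonnegative. The terminal condition fixes the integral of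
  \<open><e, u>\<close> at \<open>- scalar_prod x p\<close>, and \<open>|e|^2\<close> integrates to
  \<open>scalar_prod x p\<close>.\<close>

lemma minimal_energy:
  assumes A: "A \<in> carrier_mat n n" and u: "L2_control n T u" and p: "p \<in> carrier_vec n"
    and x: "x \<in> carrier_vec n" and Wp: "gramian A T *\<^sub>v p = x" and eff: "control_effect A u T = - x"
  shows "scalar_prod x p \<le> (LINT s|lebesgue_on {0..T}. (euclidean_norm (u s))\<^sup>2)"
proof -
  let ?e = "\<lambda>s. transpose_mat (mat_exp ((- s) \<cdot>\<^sub>m A)) *\<^sub>v p"
  have e: "?e s \<in> carrier_vec n" for s using A by simp
  have int_e: "integrable (lebesgue_on {0..T}) (\<lambda>s. (euclidean_norm (?e s))\<^sup>2)"
    by (rule continuous_imp_integrable_real[OF continuous_on_norm_transpose_mat_exp[OF A p]])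
  have int_u: "integrable (lebesgue_on {0..T}) (\<lambda>s. (euclidean_norm (u s))\<^sup>2)"
    using u by (simp add: L2_control_def)
  note eu = control_effect_scalar_prod[OF A u p]
  have "0 \<le> (euclidean_norm (u s))\<^sup>2 + 2 * scalar_prod (?e s) (u s) + (euclidean_norm (?e s))\<^sup>2"
    if "s \<in> space (lebesgue_on {0..T})" for s
  proof -
    have us: "u s \<in> carrier_vec n" using u that by (simp add: L2_control_def)
    have "\<bar>scalar_prod (?e s) (u s)\<bar> \<le> euclidean_norm (?e s) * euclidean_norm (u s)"
      using norm_scalar_prod_le[OF e us] by simp
    moreover have "0 \<le> (euclidean_norm (u s) - euclidean_norm (?e s))\<^sup>2" by simp
    ultimately show ?thesis unfolding power2_diff by (simp add: abs_le_iff mult.commute)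
  qed
  then have "0 \<le> (LINT s|lebesgue_on {0..T}.
      (euclidean_norm (u s))\<^sup>2 + 2 * scalar_prod (?e s) (u s) + (euclidean_norm (?e s))\<^sup>2)"
    by (rule Bochner_Integration.integral_nonneg)
  also have "\<dots> = (LINT s|lebesgue_on {0..T}. (euclidean_norm (u s))\<^sup>2) +
      2 * (LINT s|lebesgue_on {0..T}. scalar_prod (?e s) (u s)) + (LINT s|lebesgue_on {0..T}. (euclidean_norm (?e s))\<^sup>2)"
    using int_e int_u eu(1)
    by (simp add: Bochner_Integration.integral_add Bochner_Integration.integrable_add)
  also have "(LINT s|lebesgue_on {0..T}. (euclidean_norm (?e s))\<^sup>2) = scalar_prod p x"
    using gramian_quadratic_LINT[OF A p, of T] Wp by simp
  also have "(LINT s|lebesgue_on {0..T}. scalar_prod (?e s) (u s)) = - scalar_prod p x"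
    unfolding eu(2)[symmetric] eff using p x by (intro scalar_prod_uminus_right) simp
  also have "scalar_prod p x = scalar_prod x p" by (rule comm_scalar_prod[OF p x])
  finally show ?thesis by simp
qed

text \<open>Read off entry by entry, by testing with unit vectors in the duality formula.\<close>

lemma control_effect_gramian:
  assumes A: "A \<in> carrier_mat n n" and p: "p \<in> carrier_vec n"
  shows "control_effect A (\<lambda>s. - (transpose_mat (mat_exp ((- s) \<cdot>\<^sub>m A)) *\<^sub>v p)) T = - (gramian A T *\<^sub>v p)"
proof (rule eq_vecI)
  let ?u = "\<lambda>s. - (transpose_mat (mat_exp ((- s) \<cdot>\<^sub>m A)) *\<^sub>v p)"
  note u = L2_control_gramian[OF A p, of T]
  fix k assume "k < dim_vec (- (gramian A T *\<^sub>v p))"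
  then have k: "k < n" using carrier_matD[OF gramian_carrier[OF A, of T]] by simp
  let ?y = "unit_vec n k :: real Matrix.vec"
  have "vec_index (control_effect A ?u T) k = scalar_prod ?y (control_effect A ?u T)"
    using k A by (simp add: scalar_prod_left_unit[of _ n])
  also have "\<dots> = (LINT s|lebesgue_on {0..T}. - scalar_prod (transpose_mat (mat_exp ((- s) \<cdot>\<^sub>m A)) *\<^sub>v ?y)
      (transpose_mat (mat_exp ((- s) \<cdot>\<^sub>m A)) *\<^sub>v p))"
    unfolding control_effect_scalar_prod(2)[OF A u unit_vec_carrier]
    using A by (simp add: scalar_prod_uminus_right)
  also have "\<dots> = integral {0..T} (\<lambda>s. - scalar_prod (transpose_mat (mat_exp ((- s) \<cdot>\<^sub>m A)) *\<^sub>v ?y)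
      (transpose_mat (mat_exp ((- s) \<cdot>\<^sub>m A)) *\<^sub>v p))"
    using control_effect_scalar_prod(1)[OF A u unit_vec_carrier[of n k]] A
    by (intro lebesgue_integral_eq_integral) (simp_all add: scalar_prod_uminus_right)
  also have "\<dots> = - scalar_prod ?y (gramian A T *\<^sub>v p)"
    unfolding gramian_bilinear[OF A p unit_vec_carrier] by simp
  also have "\<dots> = - vec_index (gramian A T *\<^sub>v p) k"
    using k carrier_matD[OF gramian_carrier[OF A, of T]]
    by (subst scalar_prod_left_unit[of _ n]) (auto simp: carrier_vecI)
  finally show "vec_index (control_effect A ?u T) k = vec_index (- (gramian A T *\<^sub>v p)) k"
    using k carrier_matD[OF gramian_carrier[OF A, of T]] by simp
qed (use A carrier_matD[OF gramian_carrier[OF A, of T]] in \<open>simp add: control_effect_def\<close>)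

section \<open>The system on the sequence space\<close>

lemma ell2D:
  assumes "x \<in> ell2 d"
  shows "x i \<in> carrier_vec (d i)" "summable (\<lambda>i. (euclidean_norm (x i))\<^sup>2)"
  using assms by (simp_all add: ell2_def)

lemma zero_state_ell2 [simp]: "zero_state d \<in> ell2 d"
  by (simp add: ell2_def zero_state_def)

lemma ell2_neq_zero_state:
  assumes "x \<in> ell2 d" "x \<noteq> zero_state d"
  obtains j where "x j \<noteq> 0\<^sub>v (d j)"
  using assms by (auto simp: zero_state_def)

text \<open>The bound on the extended sum makes each coordinate energy finite, hence its integrand
  integrable, and then the series of real energies converges. Measurability of the norm comes from
  that of finitely many entries.\<close>

lemma admissible_controlD:
  assumes w: "w \<in> admissible_controls d \<theta> T"
  shows "L2_control (d i) T (\<lambda>s. w s i)"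
    and "summable (\<lambda>i. LINT s|lebesgue_on {0..T}. (euclidean_norm (w s i))\<^sup>2)"
    and "(\<Sum>i. LINT s|lebesgue_on {0..T}. (euclidean_norm (w s i))\<^sup>2) \<le> \<theta>\<^sup>2"
proof -
  let ?M = "lebesgue_on {0..T}"
  let ?e = "\<lambda>i. LINT s|?M. (euclidean_norm (w s i))\<^sup>2"
  let ?N = "\<lambda>i. \<integral>\<^sup>+ s. ennreal ((euclidean_norm (w s i))\<^sup>2) \<partial>?M"
  have car: "w s i \<in> carrier_vec (d i)" if "s \<in> {0..T}" for s i
    using w that ell2D(1) by (auto simp: admissible_controls_def)
  have meas: "(\<lambda>s. vec_index (w s i) k) \<in> borel_measurable ?M" if "k < d i" for i k
    using w that by (simp add: admissible_controls_def)
  have sum_le: "(\<Sum>i. ?N i) \<le> ennreal (\<theta>\<^sup>2)"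
    using w by (simp add: admissible_controls_def)
  have int: "integrable ?M (\<lambda>s. (euclidean_norm (w s i))\<^sup>2)" for i
  proof (rule integrableI_nonneg)
    have meas2: "(\<lambda>s. \<Sum>k<d i. (vec_index (w s i) k)\<^sup>2) \<in> borel_measurable ?M"
      by (intro borel_measurable_sum borel_measurable_power meas) simp
    have "(\<Sum>k<d i. (vec_index (w s i) k)\<^sup>2) = (euclidean_norm (w s i))\<^sup>2" if "s \<in> space ?M" for s
      using euclidean_norm_sq[OF car[of s i]] that by simp
    from measurable_cong[of ?M, THEN iffD1, OF this meas2]
    show "(\<lambda>s. (euclidean_norm (w s i))\<^sup>2) \<in> borel_measurable ?M" .
    have "?N i \<le> (\<Sum>i. ?N i)"
      using sum_le_suminf[of ?N "{i}"] by simp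
    also have "\<dots> < \<infinity>"
      using sum_le by (simp add: le_less_trans[OF _ ennreal_less_top])
    finally show "?N i < \<infinity>" .
  qed simp
  show "L2_control (d i) T (\<lambda>s. w s i)"
    using car meas int by (simp add: L2_control_def)
  have N: "?N i = ennreal (?e i)" for i
    by (rule nn_integral_eq_integral[OF int]) simp
  have e: "0 \<le> ?e i" for i by (rule Bochner_Integration.integral_nonneg) simp
  have "(\<Sum>i. ennreal (?e i)) \<noteq> top_class.top"
    using neq_top_trans[OF ennreal_neq_top sum_le] unfolding N .
  then show sm: "summable ?e"
    by (rule summable_suminf_not_top[OF e])
  have "ennreal (\<Sum>i. ?e i) \<le> ennreal (\<theta>\<^sup>2)"
    using sum_le unfolding N suminf_ennreal2[OF e sm] .
  then show "(\<Sum>i. ?e i) \<le> \<theta>\<^sup>2" by simp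
qed

section \<open>Comparison and limits of series\<close>

lemma summable_nonneg_le:
  fixes f g :: "nat \<Rightarrow> real"
  assumes "\<And>i. 0 \<le> f i" "\<And>i. f i \<le> g i" "summable g"
  shows "summable f"
  using assms by (intro summable_comparison_test'[where N = 0 and f = f and g = g]) simp_all

lemma sums_strict_mono_neq:
  fixes f g :: "nat \<Rightarrow> real"
  assumes "f sums a" "g sums b" "\<And>i. f i \<le> g i" "f j < g j"
  shows "a < b"
proof -
  have "(\<lambda>i. g i - f i) sums (b - a)"
    using assms(2,1) by (rule sums_diff)
  moreover from this have "0 < (\<Sum>i. g i - f i)"
    using assms(3,4) by (intro suminf_pos2[where i = j]) (simp_all add: sums_iff)
  ultimately show ?thesis by (simp add: sums_iff)
qed

text \<open>Domination for all \<open>k\<close> at once lifts to the product filter in Tannery's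
  theorem. The filters of interest are \<open>at T\<close> and \<open>at_top\<close>.\<close>

lemma tannery_tendsto:
  fixes a :: "nat \<Rightarrow> 'b \<Rightarrow> real"
  assumes "\<And>k. ((\<lambda>n. a k n) \<longlongrightarrow> b k) F"
    and "eventually (\<lambda>n. \<forall>k. norm (a k n) \<le> M k) F" and "summable M" and "F \<noteq> bot"
  shows "((\<lambda>n. \<Sum>k. a k n) \<longlongrightarrow> (\<Sum>k. b k)) F"
proof -
  have "eventually (\<lambda>(k, n). norm (a k n) \<le> M k) (at_top \<times>\<^sub>F F)"
    by (rule eventually_mono[OF eventually_prodI[OF eventually_True assms(2)]]) auto
  from tannerys_theorem[OF assms(1) this assms(3,4)] show ?thesis by simp
qed

text \<open>All that is kept of the Jordan form: \<open>growth\<close> has one constant for all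
  \<open>i\<close>, whereas in \<open>decay\<close> the function \<beta> may depend on
  \<open>i\<close>. Both survive when eigenvalues approach the imaginary axis.\<close>

locale stable_family =
  fixes D :: nat and d :: "nat \<Rightarrow> nat" and A :: "nat \<Rightarrow> real Matrix.mat" and \<kappa> :: real
  assumes d: "\<And>i. d i \<le> D" and A: "\<And>i. A i \<in> carrier_mat (d i) (d i)" and \<kappa>: "0 < \<kappa>"
    and growth: "\<And>i t v. 0 \<le> t \<Longrightarrow> v \<in> carrier_vec (d i) \<Longrightarrow>
      euclidean_norm (mat_exp (t \<cdot>\<^sub>m A i) *\<^sub>v v) \<le> \<kappa> * exp t * euclidean_norm v"
    and decay: "\<And>i. \<exists>\<beta>. (\<beta> \<longlongrightarrow> 0) at_top \<and> (\<forall>t\<ge>0. \<forall>v\<in>carrier_vec (d i).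
      euclidean_norm (mat_exp (t \<cdot>\<^sub>m A i) *\<^sub>v v) \<le> \<beta> t * euclidean_norm v)"
begin

section \<open>Trajectories in the sequence space and stability\<close>

lemma trajectory_carrier: "trajectory A x0 w t i \<in> carrier_vec (d i)"
  using A[of i] by (simp add: trajectory_def carrier_vecI)

lemma trajectory_zero_control:
  shows "trajectory A x0 (\<lambda>s. zero_state d) t i = mat_exp (t \<cdot>\<^sub>m A i) *\<^sub>v x0 i"
proof (rule eq_vecI)
  fix k assume "k < dim_vec (mat_exp (t \<cdot>\<^sub>m A i) *\<^sub>v x0 i)"
  then have k: "k < d i" using A[of i] by simp
  have "vec_index (mat_exp ((t - s) \<cdot>\<^sub>m A i) *\<^sub>v 0\<^sub>v (d i)) k = 0" for s
    using k A[of i] by (auto intro!: scalar_prod_right_zero carrier_vecI)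
  then show "vec_index (trajectory A x0 (\<lambda>s. zero_state d) t i) k = vec_index (mat_exp (t \<cdot>\<^sub>m A i) *\<^sub>v x0 i) k"
    using k A[of i] by (simp add: trajectory_def zero_state_def del: index_mult_mat_vec)
qed (use A[of i] in \<open>simp add: trajectory_def\<close>)

text \<open>The squared bounds of the coordinates are summed; \<open>D\<close> in place of
  \<open>d i\<close> keeps the coefficients independent of \<open>i\<close>.\<close>

lemma trajectory_ell2:
  assumes x0: "x0 \<in> ell2 d" and t: "0 \<le> t" "t \<le> T"
    and w: "\<And>i. L2_control (d i) T (\<lambda>s. w s i)"
    and sm: "summable (\<lambda>i. LINT s|lebesgue_on {0..T}. (euclidean_norm (w s i))\<^sup>2)"
  shows "trajectory A x0 w t \<in> ell2 d"
proof -
  let ?K = "\<kappa> * exp t" and ?e = "\<lambda>i. LINT s|lebesgue_on {0..T}. (euclidean_norm (w s i))\<^sup>2"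
  have "(euclidean_norm (trajectory A x0 w t i))\<^sup>2 \<le>
      2 * ?K\<^sup>2 * (euclidean_norm (x0 i))\<^sup>2 + 2 * real D * t * ?K\<^sup>2 * ?e i" for i
  proof -
    have "(euclidean_norm (trajectory A x0 w t i))\<^sup>2 \<le> 2 * ?K\<^sup>2 * (euclidean_norm (x0 i))\<^sup>2 +
        2 * real (d i) * t * ?K\<^sup>2 * (LINT s|lebesgue_on {0..t}. (euclidean_norm (w s i))\<^sup>2)"
      unfolding trajectory_def
    proof (rule trajectory_bound[OF A L2_control_subinterval[OF w t(2)] ell2D(1)[OF x0] t(1)])
      fix s and v :: "real Matrix.vec" assume s: "0 \<le> s" "s \<le> t" and v: "v \<in> carrier_vec (d i)"
      have "euclidean_norm (mat_exp (s \<cdot>\<^sub>m A i) *\<^sub>v v) \<le> \<kappa> * exp s * euclidean_norm v"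
        by (rule growth[OF s(1) v])
      also have "\<dots> \<le> ?K * euclidean_norm v"
        using s \<kappa> by (intro mult_right_mono mult_left_mono) auto
      finally show "euclidean_norm (mat_exp (s \<cdot>\<^sub>m A i) *\<^sub>v v) \<le> ?K * euclidean_norm v" .
    qed
    also have "2 * real (d i) * t * ?K\<^sup>2 * (LINT s|lebesgue_on {0..t}. (euclidean_norm (w s i))\<^sup>2) \<le>
        2 * real D * t * ?K\<^sup>2 * ?e i"
    proof (rule mult_mono)
      show "2 * real (d i) * t * ?K\<^sup>2 \<le> 2 * real D * t * ?K\<^sup>2"
        using d[of i] t(1) by (intro mult_right_mono) simp_all
      show "0 \<le> 2 * real D * t * ?K\<^sup>2" using t(1) by simp
      show "0 \<le> (LINT s|lebesgue_on {0..t}. (euclidean_norm (w s i))\<^sup>2)"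
        by (rule Bochner_Integration.integral_nonneg) simp
    qed (rule L2_control_subinterval_integral[OF w t(2)])
    finally show ?thesis by simp
  qed
  moreover have "summable (\<lambda>i. 2 * ?K\<^sup>2 * (euclidean_norm (x0 i))\<^sup>2 + 2 * real D * t * ?K\<^sup>2 * ?e i)"
    by (intro summable_add summable_mult ell2D(2)[OF x0] sm)
  ultimately have "summable (\<lambda>i. (euclidean_norm (trajectory A x0 w t i))\<^sup>2)"
    by (rule summable_nonneg_le[OF zero_le_power2])
  then show ?thesis using trajectory_carrier by (simp add: ell2_def)
qed

lemma trajectory_eq:
  assumes x0: "x0 \<in> ell2 d" and w: "L2_control (d i) t (\<lambda>s. w s i)"
  shows "trajectory A x0 w t i = mat_exp (t \<cdot>\<^sub>m A i) *\<^sub>v (x0 i + control_effect (A i) (\<lambda>s. w s i) t)"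
  unfolding trajectory_def by (rule variation_of_constants[OF A w ell2D(1)[OF x0]])

lemma trajectory_eq_zero_iff:
  assumes x0: "x0 \<in> ell2 d" and w: "L2_control (d i) t (\<lambda>s. w s i)"
  shows "trajectory A x0 w t i = 0\<^sub>v (d i) \<longleftrightarrow> control_effect (A i) (\<lambda>s. w s i) t = - x0 i"
proof -
  let ?z = "control_effect (A i) (\<lambda>s. w s i) t"
  have z: "?z \<in> carrier_vec (d i)" and x: "x0 i \<in> carrier_vec (d i)"
    using A ell2D(1)[OF x0] by simp_all
  have "trajectory A x0 w t i = 0\<^sub>v (d i) \<longleftrightarrow> x0 i + ?z = 0\<^sub>v (d i)"
    unfolding trajectory_eq[where i = i and w = w and t = t, OF x0 w] using x z by (intro mat_exp_mult_eq_0_iff[OF A]) simp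
  also have "\<dots> \<longleftrightarrow> (\<forall>k<d i. vec_index (x0 i) k + vec_index ?z k = 0)"
    using x z by (auto simp: vec_eq_iff)
  also have "\<dots> \<longleftrightarrow> ?z = - x0 i"
    using x z by (auto simp: vec_eq_iff eq_neg_iff_add_eq_0 add.commute)
  finally show ?thesis .
qed

text \<open>A bound independent of both \<open>t\<close> and \<open>i\<close> supplies the
  dominating series, while \<open>decay\<close> supplies the limit of each coordinate. The gap
  hypothesis of the theorem serves to provide \<open>K\<close>.\<close>

lemma globally_asymptotically_stable_of_bound:
  assumes K: "\<And>i t v. 0 \<le> t \<Longrightarrow> v \<in> carrier_vec (d i) \<Longrightarrow>
      euclidean_norm (mat_exp (t \<cdot>\<^sub>m A i) *\<^sub>v v) \<le> K * euclidean_norm v"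
  shows "globally_asymptotically_stable d A"
  unfolding globally_asymptotically_stable_def
proof (intro ballI exI conjI)
  fix x0 assume x0: "x0 \<in> ell2 d"
  note x = ell2D[OF x0]
  let ?x = "trajectory A x0 (\<lambda>s. zero_state d)"
  have bound: "(euclidean_norm (?x t i))\<^sup>2 \<le> K\<^sup>2 * (euclidean_norm (x0 i))\<^sup>2" if "0 \<le> t" for t i
    using power_mono[OF K[OF that x(1)[of i]] euclidean_norm_nonneg, of 2] by (simp add: trajectory_zero_control power_mult_distrib)
  have sm: "summable (\<lambda>i. K\<^sup>2 * (euclidean_norm (x0 i))\<^sup>2)" by (rule summable_mult[OF x(2)])
  have "?x t \<in> ell2 d" if "0 \<le> t" for t
  proof -
    have "summable (\<lambda>i. (euclidean_norm (?x t i))\<^sup>2)"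
      by (rule summable_nonneg_le[OF zero_le_power2 bound[OF that] sm])
    then show ?thesis using trajectory_carrier by (simp add: ell2_def)
  qed
  then show "solution_on {0..} d A x0 (\<lambda>s. zero_state d) ?x" by (simp add: solution_on_def)
  have "((\<lambda>t. \<Sum>i. (euclidean_norm (?x t i))\<^sup>2) \<longlongrightarrow> (\<Sum>i. 0)) at_top"
  proof (rule tannery_tendsto[OF _ _ sm])
    show "eventually (\<lambda>t. \<forall>i. norm ((euclidean_norm (?x t i))\<^sup>2) \<le> K\<^sup>2 * (euclidean_norm (x0 i))\<^sup>2) at_top"
      using eventually_ge_at_top[of 0] by eventually_elim (simp add: bound)
    fix i
    obtain \<beta> where \<beta>: "(\<beta> \<longlongrightarrow> 0) at_top" "\<And>t v. 0 \<le> t \<Longrightarrow> v \<in> carrier_vec (d i) \<Longrightarrow>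
      euclidean_norm (mat_exp (t \<cdot>\<^sub>m A i) *\<^sub>v v) \<le> \<beta> t * euclidean_norm v"
      using decay[of i] by blast
    show "((\<lambda>t. (euclidean_norm (?x t i))\<^sup>2) \<longlongrightarrow> 0) at_top"
    proof (rule tendsto_sandwich[OF _ _ tendsto_const])
      show "eventually (\<lambda>t. (euclidean_norm (?x t i))\<^sup>2 \<le> (\<beta> t * euclidean_norm (x0 i))\<^sup>2) at_top"
        using eventually_ge_at_top[of 0]
        by eventually_elim (use \<beta>(2)[OF _ x(1)] in \<open>simp add: trajectory_zero_control power_mono\<close>)
      have "((\<lambda>t. (\<beta> t * euclidean_norm (x0 i))\<^sup>2) \<longlongrightarrow> (0 * euclidean_norm (x0 i))\<^sup>2) at_top"
        by (intro tendsto_intros \<beta>(1))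
      then show "((\<lambda>t. (\<beta> t * euclidean_norm (x0 i))\<^sup>2) \<longlongrightarrow> 0) at_top" by simp
    qed simp
  qed simp
  then show "((\<lambda>t. ell2_norm (?x t)) \<longlongrightarrow> 0) at_top"
    using tendsto_real_sqrt by (force simp: ell2_norm_def)
qed

section \<open>The total energy as a function of time\<close>

lemma gramian_energy_summable:
  assumes x0: "x0 \<in> ell2 d" and T: "0 < T"
  shows "summable (gramian_energy A x0 T)"
proof (rule summable_nonneg_le)
  show "0 \<le> gramian_energy A x0 T i" for i
    unfolding gramian_energy_def by (rule gramian_inv_nonneg[OF A \<kappa> growth T ell2D(1)[OF x0]])
  show "gramian_energy A x0 T i \<le> (\<kappa> * exp T)\<^sup>2 / T * (euclidean_norm (x0 i))\<^sup>2" for i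
    unfolding gramian_energy_def by (rule gramian_inv_upper[OF A \<kappa> growth T ell2D(1)[OF x0]])
  show "summable (\<lambda>i. (\<kappa> * exp T)\<^sup>2 / T * (euclidean_norm (x0 i))\<^sup>2)"
    by (rule summable_mult[OF ell2D(2)[OF x0]])
qed

lemma gramian_energy_nonneg:
  assumes x0: "x0 \<in> ell2 d" and T: "0 < T"
  shows "0 \<le> gramian_energy A x0 T i"
  unfolding gramian_energy_def by (rule gramian_inv_nonneg[OF A \<kappa> growth T ell2D(1)[OF x0]])

lemma gramian_energy_antimono:
  assumes x0: "x0 \<in> ell2 d" and T: "0 < S" "S \<le> T"
  shows "gramian_energy A x0 T i \<le> gramian_energy A x0 S i"
  unfolding gramian_energy_def by (rule gramian_inv_antimono[OF A \<kappa> growth T ell2D(1)[OF x0]])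

lemma total_energy_strict_antimono:
  assumes x0: "x0 \<in> ell2 d" "x0 \<noteq> zero_state d" and T: "0 < S" "S < T"
  shows "(\<Sum>i. gramian_energy A x0 T i) < (\<Sum>i. gramian_energy A x0 S i)"
proof -
  obtain j where j: "x0 j \<noteq> 0\<^sub>v (d j)" using ell2_neq_zero_state[OF x0] .
  have T0: "0 < T" using T by simp
  show ?thesis
  proof (rule sums_strict_mono_neq)
    show "gramian_energy A x0 T sums (\<Sum>i. gramian_energy A x0 T i)"
      "gramian_energy A x0 S sums (\<Sum>i. gramian_energy A x0 S i)"
      by (rule summable_sums[OF gramian_energy_summable[OF x0(1) T0]])
        (rule summable_sums[OF gramian_energy_summable[OF x0(1) T(1)]])
    show "gramian_energy A x0 T i \<le> gramian_energy A x0 S i" for i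
      using T by (intro gramian_energy_antimono[OF x0(1)]) simp_all
    show "gramian_energy A x0 T j < gramian_energy A x0 S j"
      unfolding gramian_energy_def by (rule gramian_inv_strict_antimono[OF A \<kappa> growth T ell2D(1)[OF x0(1)] j])
  qed
qed

text \<open>Coordinate energies decrease in time, so those at \<open>T / 2\<close> dominate all
  nearby ones. This stands in for Lipschitz constants, which would have to be uniform in
  \<open>i\<close>.\<close>

lemma continuous_total_energy:
  assumes x0: "x0 \<in> ell2 d" and T: "0 < T"
  shows "isCont (\<lambda>T. \<Sum>i. gramian_energy A x0 T i) T"
  unfolding isCont_def
proof (rule tannery_tendsto)
  have T2: "0 < T / 2" using T by simp
  show "summable (gramian_energy A x0 (T / 2))" by (rule gramian_energy_summable[OF x0 T2])
  have "eventually (\<lambda>S. S \<in> {T / 2<..}) (at T)"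
    using T by (intro eventually_at_in_open') simp_all
  then show "eventually (\<lambda>S. \<forall>i. norm (gramian_energy A x0 S i) \<le> gramian_energy A x0 (T / 2) i) (at T)"
  proof eventually_elim
    case (elim S)
    then have S: "0 < S" "T / 2 \<le> S" using T2 by auto
    show ?case
      using gramian_energy_nonneg[OF x0 S(1)] gramian_energy_antimono[OF x0 T2 S(2)] by simp
  qed
  fix i
  have "continuous_on {0<..} (\<lambda>T. scalar_prod (x0 i) (gramian_inv (A i) T *\<^sub>v x0 i))"
    by (rule continuous_on_gramian_inv[OF A \<kappa> growth ell2D(1)[OF x0]])
  then have "isCont (\<lambda>T. scalar_prod (x0 i) (gramian_inv (A i) T *\<^sub>v x0 i)) T"
    using T by (simp add: continuous_on_eq_continuous_at)
  then show "((\<lambda>T. gramian_energy A x0 T i) \<longlongrightarrow> gramian_energy A x0 T i) (at T)"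
    by (simp add: gramian_energy_def isCont_def)
qed simp

text \<open>The energies at time 1 dominate the later ones, and each coordinate energy tends to 0 at
  its own rate.\<close>

lemma total_energy_tendsto_0:
  assumes x0: "x0 \<in> ell2 d"
  shows "((\<lambda>T. \<Sum>i. gramian_energy A x0 T i) \<longlongrightarrow> 0) at_top"
proof -
  have "((\<lambda>T. \<Sum>i. gramian_energy A x0 T i) \<longlongrightarrow> (\<Sum>i. 0)) at_top"
  proof (rule tannery_tendsto)
    show "summable (gramian_energy A x0 1)" by (rule gramian_energy_summable[OF x0]) simp
    show "eventually (\<lambda>S. \<forall>i. norm (gramian_energy A x0 S i) \<le> gramian_energy A x0 1 i) at_top"
      using eventually_ge_at_top[of 1]
    proof eventually_elim
      case (elim S)
      then show ?case
        using gramian_energy_nonneg[OF x0, of S] gramian_energy_antimono[OF x0, of 1 S] elim by simp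
    qed
    fix i
    obtain \<beta> where \<beta>: "(\<beta> \<longlongrightarrow> 0) at_top" "\<And>t v. 0 \<le> t \<Longrightarrow> v \<in> carrier_vec (d i) \<Longrightarrow>
      euclidean_norm (mat_exp (t \<cdot>\<^sub>m A i) *\<^sub>v v) \<le> \<beta> t * euclidean_norm v"
      using decay[of i] by blast
    show "((\<lambda>T. gramian_energy A x0 T i) \<longlongrightarrow> 0) at_top"
      unfolding gramian_energy_def
      by (rule gramian_inv_tendsto_0[OF A \<kappa> growth ell2D(1)[OF x0] \<beta>])
  qed simp
  then show ?thesis by simp
qed

text \<open>A single nonzero coordinate already reaches \<open>e\<close> at a small time, and the
  total falls below \<open>e\<close> at a late one; the intermediate value theorem applies in
  between.\<close>

lemma critical_time_exists:
  assumes x0: "x0 \<in> ell2 d" "x0 \<noteq> zero_state d" and e: "0 < e"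
  shows "\<exists>T>0. gramian_energy A x0 T sums e"
proof -
  let ?F = "\<lambda>T. \<Sum>i. gramian_energy A x0 T i"
  obtain j where j: "x0 j \<noteq> 0\<^sub>v (d j)" using ell2_neq_zero_state[OF x0] .
  obtain T1 where T1: "0 < T1" "e \<le> gramian_energy A x0 T1 j"
    using gramian_inv_blowup[OF A \<kappa> growth ell2D(1)[OF x0(1)] j, of e] unfolding gramian_energy_def by blast
  have "e \<le> ?F T1"
    using T1(2) sum_le_suminf[OF gramian_energy_summable[OF x0(1) T1(1)], of "{j}"]
      gramian_energy_nonneg[OF x0(1) T1(1)] by simp
  moreover have "eventually (\<lambda>T. T1 \<le> T \<and> ?F T < e) at_top"
    using eventually_ge_at_top order_tendstoD(2)[OF total_energy_tendsto_0[OF x0(1)] e]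
    by (rule eventually_conj)
  then obtain T2 where T2: "T1 \<le> T2" "?F T2 < e" by (auto dest: eventually_happens)
  ultimately obtain T where T: "T1 \<le> T" "?F T = e"
    using IVT2[of ?F T2 e T1] continuous_total_energy[OF x0(1)] T1 by force
  then show ?thesis
    using summable_sums[OF gramian_energy_summable[OF x0(1), of T]] T1 by (intro exI[of _ T]) simp
qed

text \<open>Arrival at zero fixes the effect of every coordinate of the control, so each coordinate
  pays at least its Gramian energy; these lower bounds add up.\<close>

lemma steers_to_zero_energy:
  assumes x0: "x0 \<in> ell2 d" and u: "steers_to_zero d A \<theta> x0 u T" and T: "0 < T"
  shows "(\<Sum>i. gramian_energy A x0 T i) \<le> \<theta>\<^sup>2"
proof -
  have adm: "u \<in> admissible_controls d \<theta> T" using u by (simp add: steers_to_zero_def)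
  note w = admissible_controlD[OF adm]
  obtain x where "solution_on {0..T} d A x0 u x" "x T = zero_state d"
    using u by (auto simp: steers_to_zero_def)
  then have "trajectory A x0 u T = zero_state d" using T by (simp add: solution_on_def)
  then have "trajectory A x0 u T i = 0\<^sub>v (d i)" for i by (simp add: zero_state_def)
  then have eff: "control_effect (A i) (\<lambda>s. u s i) T = - x0 i" for i
    using trajectory_eq_zero_iff[where i = i and w = u and t = T, OF x0 w(1)] by simp
  have "gramian_energy A x0 T i \<le> (LINT s|lebesgue_on {0..T}. (euclidean_norm (u s i))\<^sup>2)" for i
    unfolding gramian_energy_def
    by (rule minimal_energy[OF A w(1) gramian_inv_mult_carrier[OF A \<kappa> growth T ell2D(1)[OF x0]] ell2D(1)[OF x0]
          gramian_gramian_inv[OF A \<kappa> growth T ell2D(1)[OF x0]] eff])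
  then have "(\<Sum>i. gramian_energy A x0 T i) \<le> (\<Sum>i. LINT s|lebesgue_on {0..T}. (euclidean_norm (u s i))\<^sup>2)"
    by (rule suminf_le[OF _ gramian_energy_summable[OF x0 T] w(2)])
  also have "\<dots> \<le> \<theta>\<^sup>2" by (rule w(3))
  finally show ?thesis .
qed

text \<open>At time 0 the Gramian is zero and the energy estimates say nothing, so this case is
  settled directly: an integral over a point has no effect.\<close>

lemma steers_to_zero_time_pos:
  assumes x0: "x0 \<in> ell2 d" "x0 \<noteq> zero_state d" and u: "steers_to_zero d A \<theta> x0 u T"
  shows "0 < T"
proof (rule ccontr)
  assume "\<not> 0 < T"
  then have T: "T = 0" using u by (simp add: steers_to_zero_def)
  obtain j where j: "x0 j \<noteq> 0\<^sub>v (d j)" using ell2_neq_zero_state[OF x0] .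
  have adm: "u \<in> admissible_controls d \<theta> 0" using u T by (simp add: steers_to_zero_def)
  note w = admissible_controlD(1)[OF adm, of j]
  obtain x where "solution_on {0..0} d A x0 u x" "x 0 = zero_state d"
    using u T by (auto simp: steers_to_zero_def)
  then have "trajectory A x0 u 0 = zero_state d" by (simp add: solution_on_def)
  then have "trajectory A x0 u 0 j = 0\<^sub>v (d j)" by (simp add: zero_state_def)
  then have eff: "control_effect (A j) (\<lambda>s. u s j) 0 = - x0 j"
    using trajectory_eq_zero_iff[where i = j and w = u and t = 0, OF x0(1) w] by simp
  have "vec_index (control_effect (A j) (\<lambda>s. u s j) 0) k = 0" if k: "k < d j" for k
  proof -
    have "integrable (lebesgue_on {0..0}) (\<lambda>s. vec_index (mat_exp ((- s) \<cdot>\<^sub>m A j) *\<^sub>v u s j) k)"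
      by (rule integrable_mat_exp_control[OF A w k]) (intro continuous_intros)
    then have "(LINT s|lebesgue_on {0..0}. vec_index (mat_exp ((- s) \<cdot>\<^sub>m A j) *\<^sub>v u s j) k) =
        integral {0..0} (\<lambda>s. vec_index (mat_exp ((- s) \<cdot>\<^sub>m A j) *\<^sub>v u s j) k)"
      by (rule lebesgue_integral_eq_integral) simp
    then show ?thesis using A[of j] k by (simp add: control_effect_def)
  qed
  then have "vec_index (x0 j) k = 0" if "k < d j" for k
    using that eff ell2D(1)[OF x0(1), of j] by (metis carrier_vecD index_uminus_vec(1) neg_equal_0_iff_equal)
  then have "x0 j = 0\<^sub>v (d j)"
    using ell2D(1)[OF x0(1), of j] by (intro eq_vecI) simp_all
  then show False using j by simp
qed

section \<open>The Gramian control of the whole system\<close>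

lemma gramian_control_props:
  assumes x0: "x0 \<in> ell2 d" and T: "0 < T"
  shows "L2_control (d i) T (\<lambda>s. gramian_control A x0 T s i)"
    and "control_effect (A i) (\<lambda>s. gramian_control A x0 T s i) T = - x0 i"
    and "(LINT s|lebesgue_on {0..T}. (euclidean_norm (gramian_control A x0 T s i))\<^sup>2) = gramian_energy A x0 T i"
proof -
  note x = ell2D(1)[OF x0, of i]
  note p = gramian_inv_mult_carrier[OF A[of i] \<kappa> growth T x]
  show "L2_control (d i) T (\<lambda>s. gramian_control A x0 T s i)"
    unfolding gramian_control_def by (rule L2_control_gramian[OF A p])
  show "control_effect (A i) (\<lambda>s. gramian_control A x0 T s i) T = - x0 i"
    using control_effect_gramian[OF A p, of T] gramian_gramian_inv[OF A \<kappa> growth T x]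
    by (simp only: gramian_control_def)
  show "(LINT s|lebesgue_on {0..T}. (euclidean_norm (gramian_control A x0 T s i))\<^sup>2) = gramian_energy A x0 T i"
    unfolding gramian_control_def euclidean_norm_uminus gramian_energy_def
    using gramian_quadratic_LINT[OF A p, of T] gramian_inv_quadratic[OF A \<kappa> growth T x]
    by (simp only:)
qed

text \<open>An admissible control must lie in the state space at every time, whereas finite energy puts the
  sequence of Gramian controls there only for almost every time.\<close>
definition optimal_control :: "(nat \<Rightarrow> real Matrix.vec) \<Rightarrow> real \<Rightarrow> real \<Rightarrow> nat \<Rightarrow> real Matrix.vec" where
  "optimal_control x0 T s =
     (if summable (\<lambda>i. (euclidean_norm (gramian_control A x0 T s i))\<^sup>2)
      then gramian_control A x0 T s else zero_state d)"

text \<open>Sum and integral of nonnegative functions commute, so the pointwise sum of the squared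
  norms has a finite integral and is finite almost everywhere. Putting zero elsewhere cannot raise
  the energy.\<close>

lemma optimal_control_admissible:
  assumes x0: "x0 \<in> ell2 d" and T: "0 < T" and energy: "(\<Sum>i. gramian_energy A x0 T i) \<le> \<theta>\<^sup>2"
  shows "optimal_control x0 T \<in> admissible_controls d \<theta> T"
    and "AE s in lebesgue_on {0..T}. optimal_control x0 T s = gramian_control A x0 T s"
proof -
  let ?M = "lebesgue_on {0..T}" and ?g = "gramian_control A x0 T"
  let ?n = "\<lambda>i s. (euclidean_norm (?g s i))\<^sup>2"
  note g = gramian_control_props[OF x0 T]
  have car: "?g s i \<in> carrier_vec (d i)" for s i
    using A[of i] by (simp add: gramian_control_def carrier_vecI)
  have int: "integrable ?M (?n i)" for i
    using g(1)[of i] by (simp add: L2_control_def)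
  have meas: "(\<lambda>s. ennreal (?n i s)) \<in> borel_measurable ?M" for i
    using borel_measurable_integrable[OF int] by (rule measurable_compose) simp
  have N: "(\<integral>\<^sup>+ s. ennreal (?n i s) \<partial>?M) = ennreal (gramian_energy A x0 T i)" for i
    unfolding g(3)[symmetric] by (rule nn_integral_eq_integral[OF int]) simp
  have sumN: "(\<Sum>i. \<integral>\<^sup>+ s. ennreal (?n i s) \<partial>?M) \<le> ennreal (\<theta>\<^sup>2)"
    unfolding N suminf_ennreal2[OF gramian_energy_nonneg[OF x0 T] gramian_energy_summable[OF x0 T]]
    by (rule ennreal_leI[OF energy])
  \<comment> \<open>With extended values \<open>q\<close> is measurable regardless of convergence,
    and \<open>q s\<close> is finite exactly under the condition in \<open>optimal_control\<close>;
    the set on which the control is altered is therefore measurable.\<close>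
  define q where "q s = (\<Sum>i. ennreal (?n i s))" for s
  have q_meas: "q \<in> borel_measurable ?M"
    unfolding q_def by (rule borel_measurable_suminf_order) (rule meas)
  have q_top: "q s \<noteq> \<infinity> \<longleftrightarrow> summable (\<lambda>i. ?n i s)" for s
  proof
    show "summable (\<lambda>i. ?n i s)" if "q s \<noteq> \<infinity>"
      using that unfolding q_def infinity_ennreal_def
      by (rule summable_suminf_not_top[rotated]) (rule zero_le_power2)
    show "q s \<noteq> \<infinity>" if "summable (\<lambda>i. ?n i s)"
      unfolding q_def suminf_ennreal2[OF zero_le_power2 that] by (rule ennreal_neq_top[folded infinity_ennreal_def])
  qed
  have qN: "integral\<^sup>N ?M q = (\<Sum>i. \<integral>\<^sup>+ s. ennreal (?n i s) \<partial>?M)"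
    unfolding q_def by (rule nn_integral_suminf) (rule meas)
  have "integral\<^sup>N ?M q \<noteq> \<infinity>"
    unfolding qN infinity_ennreal_def by (rule neq_top_trans[OF ennreal_neq_top sumN])
  then have "AE s in ?M. q s \<noteq> \<infinity>"
    by (rule nn_integral_PInf_AE[OF q_meas])
  then show "AE s in ?M. optimal_control x0 T s = ?g s"
    unfolding q_top by eventually_elim (simp add: optimal_control_def)
  have set: "{s \<in> space ?M. q s \<noteq> \<infinity>} \<in> sets ?M"
    using q_meas by measurable
  have idx: "vec_index (optimal_control x0 T s i) k = (if q s \<noteq> \<infinity> then vec_index (?g s i) k else 0)"
    if "k < d i" for s i k
    unfolding q_top using that by (simp add: optimal_control_def zero_state_def)
  have "(\<lambda>s. vec_index (optimal_control x0 T s i) k) \<in> borel_measurable ?M" if k: "k < d i" for i k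
    unfolding idx[OF k] using g(1)[of i] k
    by (intro measurable_If set) (simp_all add: L2_control_def)
  moreover have "optimal_control x0 T s \<in> ell2 d" for s
    using car by (simp add: optimal_control_def) (simp add: ell2_def)
  moreover have "(\<Sum>i. \<integral>\<^sup>+ s. ennreal ((euclidean_norm (optimal_control x0 T s i))\<^sup>2) \<partial>?M) \<le> ennreal (\<theta>\<^sup>2)"
  proof (rule order_trans[OF suminf_le sumN])
    show "(\<integral>\<^sup>+ s. ennreal ((euclidean_norm (optimal_control x0 T s i))\<^sup>2) \<partial>?M) \<le> (\<integral>\<^sup>+ s. ennreal (?n i s) \<partial>?M)" for i
      by (rule nn_integral_mono) (simp add: optimal_control_def zero_state_def)
  qed simp_all
  ultimately show "optimal_control x0 T \<in> admissible_controls d \<theta> T"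
    by (simp add: admissible_controls_def)
qed

text \<open>Integrals ignore the null set on which the two controls differ, so the effect is that of
  the Gramian control.\<close>

lemma optimal_control_steers:
  assumes x0: "x0 \<in> ell2 d" and T: "0 < T" and energy: "(\<Sum>i. gramian_energy A x0 T i) \<le> \<theta>\<^sup>2"
  shows "steers_to_zero d A \<theta> x0 (optimal_control x0 T) T"
proof -
  let ?u = "optimal_control x0 T" and ?g = "gramian_control A x0 T"
  note u = optimal_control_admissible[OF x0 T energy]
  note w = admissible_controlD[OF u(1)]
  note g = gramian_control_props[OF x0 T]
  have "control_effect (A i) (\<lambda>s. ?u s i) T = control_effect (A i) (\<lambda>s. ?g s i) T" for i
  proof (rule eq_vecI)
    fix k assume "k < dim_vec (control_effect (A i) (\<lambda>s. ?g s i) T)"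
    then have k: "k < d i" using A[of i] by (simp add: control_effect_def)
    have "(LINT s|lebesgue_on {0..T}. vec_index (mat_exp ((- s) \<cdot>\<^sub>m A i) *\<^sub>v ?u s i) k) =
        (LINT s|lebesgue_on {0..T}. vec_index (mat_exp ((- s) \<cdot>\<^sub>m A i) *\<^sub>v ?g s i) k)"
    proof (rule integral_cong_AE)
      show "(\<lambda>s. vec_index (mat_exp ((- s) \<cdot>\<^sub>m A i) *\<^sub>v ?u s i) k) \<in> borel_measurable (lebesgue_on {0..T})"
        by (intro borel_measurable_integrable integrable_mat_exp_control[OF A w(1) k] continuous_intros)
      show "(\<lambda>s. vec_index (mat_exp ((- s) \<cdot>\<^sub>m A i) *\<^sub>v ?g s i) k) \<in> borel_measurable (lebesgue_on {0..T})"
        by (intro borel_measurable_integrable integrable_mat_exp_control[OF A g(1) k] continuous_intros)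
      show "AE s in lebesgue_on {0..T}. vec_index (mat_exp ((- s) \<cdot>\<^sub>m A i) *\<^sub>v ?u s i) k =
          vec_index (mat_exp ((- s) \<cdot>\<^sub>m A i) *\<^sub>v ?g s i) k"
        using u(2) by eventually_elim (simp only:)
    qed
    then show "vec_index (control_effect (A i) (\<lambda>s. ?u s i) T) k = vec_index (control_effect (A i) (\<lambda>s. ?g s i) T) k"
      using k A[of i] by (simp add: control_effect_def)
  qed (simp add: control_effect_def)
  then have "control_effect (A i) (\<lambda>s. ?u s i) T = - x0 i" for i
    using g(2) by simp
  then have "trajectory A x0 ?u T i = 0\<^sub>v (d i)" for i
    using trajectory_eq_zero_iff[where i = i and w = ?u and t = T, OF x0 w(1)] by simp
  then have zero: "trajectory A x0 ?u T = zero_state d"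
    by (simp add: fun_eq_iff zero_state_def)
  have "trajectory A x0 ?u t \<in> ell2 d" if "t \<in> {0..T}" for t
    using that by (intro trajectory_ell2[OF x0 _ _ w(1,2)]) simp_all
  then have "solution_on {0..T} d A x0 ?u (trajectory A x0 ?u)"
    by (simp only: solution_on_def simp_thms) blast
  then show ?thesis
    unfolding steers_to_zero_def using T u(1) zero
    by (intro conjI exI[of _ "trajectory A x0 ?u"]) simp_all
qed

lemma steers_to_zero_zero_state:
  "steers_to_zero d A \<theta> (zero_state d) (\<lambda>s. zero_state d) 0"
proof -
  have "(\<Sum>i. \<integral>\<^sup>+ s. ennreal ((euclidean_norm (zero_state d i))\<^sup>2) \<partial>lebesgue_on {0..0::real}) \<le> ennreal (\<theta>\<^sup>2)"
    by (simp add: zero_state_def)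
  then have adm: "(\<lambda>s. zero_state d) \<in> admissible_controls d \<theta> 0"
    by (simp add: admissible_controls_def)
  have "trajectory A (zero_state d) (\<lambda>s. zero_state d) 0 i = zero_state d i" for i
    unfolding trajectory_zero_control
    using mat_exp_mult_eq_0_iff[OF A, of "0\<^sub>v (d i)" i 0] by (simp add: zero_state_def)
  then have eq: "trajectory A (zero_state d) (\<lambda>s. zero_state d) 0 = zero_state d"
    by (rule ext)
  then have "solution_on {0..0} d A (zero_state d) (\<lambda>s. zero_state d) (\<lambda>t. zero_state d)"
    by (simp add: solution_on_def)
  then show ?thesis
    unfolding steers_to_zero_def using adm by (intro conjI exI[of _ "\<lambda>t. zero_state d"]) simp_all
qed

text \<open>Before the critical time the total energy exceeds \<open>\<theta>\<^sup>2\<close>, which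
  any steering control forbids; at the critical time the budget is met exactly. Strict monotonicity
  also makes this time unique.\<close>

lemma time_optimal_control_exists:
  assumes \<theta>: "0 < \<theta>" and x0: "x0 \<in> ell2 d"
  shows "\<exists>u. time_optimal_control d A \<theta> x0 u \<and>
    (x0 \<noteq> zero_state d \<longrightarrow>
       optimal_time d A \<theta> x0 > 0 \<and>
       (\<forall>T>0. gramian_energy A x0 T sums \<theta>\<^sup>2 \<longleftrightarrow> T = optimal_time d A \<theta> x0) \<and>
       (\<forall>i. AE s in lebesgue_on {0..optimal_time d A \<theta> x0}.
          u s i = gramian_control A x0 (optimal_time d A \<theta> x0) s i))"
proof (cases "x0 = zero_state d")
  case True
  \<comment> \<open>The zero state has no critical time, its energy being 0 at every positive time;
    here the infimum is 0 and is attained by the zero control.\<close>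
  have steers: "steers_to_zero d A \<theta> x0 (\<lambda>s. zero_state d) 0"
    unfolding True by (rule steers_to_zero_zero_state)
  have "optimal_time d A \<theta> x0 = 0"
    unfolding optimal_time_def
  proof (rule cInf_eq_minimum)
    show "0 \<in> {T. \<exists>u. steers_to_zero d A \<theta> x0 u T}" using steers by blast
    show "0 \<le> T" if "T \<in> {T. \<exists>u. steers_to_zero d A \<theta> x0 u T}" for T
      using that unfolding steers_to_zero_def by blast
  qed
  then have "time_optimal_control d A \<theta> x0 (\<lambda>s. zero_state d)"
    using steers by (simp only: time_optimal_control_def)
  then show ?thesis using True by blast
next
  case False
  note x0' = x0 False
  obtain T where T: "0 < T" and sums: "gramian_energy A x0 T sums \<theta>\<^sup>2"
    using critical_time_exists[OF x0', of "\<theta>\<^sup>2"] \<theta> by auto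
  have energy: "(\<Sum>i. gramian_energy A x0 T i) = \<theta>\<^sup>2" using sums by (simp add: sums_iff)
  have steers: "steers_to_zero d A \<theta> x0 (optimal_control x0 T) T"
    by (rule optimal_control_steers[OF x0 T]) (simp add: energy)
  have minimal: "T \<le> S" if "steers_to_zero d A \<theta> x0 u S" for u S
  proof (rule ccontr)
    assume "\<not> T \<le> S"
    moreover have S: "0 < S" by (rule steers_to_zero_time_pos[OF x0' that])
    ultimately have "\<theta>\<^sup>2 < (\<Sum>i. gramian_energy A x0 S i)"
      using total_energy_strict_antimono[OF x0' S, of T] energy by simp
    then show False using steers_to_zero_energy[OF x0 that S] by simp
  qed
  have opt: "optimal_time d A \<theta> x0 = T"
    unfolding optimal_time_def
  proof (rule cInf_eq_minimum)
    show "T \<in> {T. \<exists>u. steers_to_zero d A \<theta> x0 u T}" using steers by blast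
    show "T \<le> S" if "S \<in> {T. \<exists>u. steers_to_zero d A \<theta> x0 u T}" for S
      using that minimal by blast
  qed
  have unique: "S = T" if "0 < S" "gramian_energy A x0 S sums \<theta>\<^sup>2" for S
  proof -
    have "(\<Sum>i. gramian_energy A x0 S i) = \<theta>\<^sup>2" using that(2) by (simp add: sums_iff)
    then show ?thesis
      using total_energy_strict_antimono[OF x0' T, of S] total_energy_strict_antimono[OF x0' that(1), of T] energy
      by (cases S T rule: linorder_cases) simp_all
  qed
  have "AE s in lebesgue_on {0..T}. optimal_control x0 T s = gramian_control A x0 T s"
    by (rule optimal_control_admissible(2)[OF x0 T, of \<theta>]) (simp add: energy)
  then have ae: "AE s in lebesgue_on {0..T}. optimal_control x0 T s i = gramian_control A x0 T s i" for i
    by eventually_elim (simp only:)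
  have "\<forall>S>0. gramian_energy A x0 S sums \<theta>\<^sup>2 \<longleftrightarrow> S = T"
    using sums unique by blast
  moreover have "time_optimal_control d A \<theta> x0 (optimal_control x0 T)"
    using steers by (simp only: time_optimal_control_def opt)
  ultimately show ?thesis
    unfolding opt using T ae by (intro exI[of _ "optimal_control x0 T"] conjI impI allI) simp_all
qed

end

theorem theorem2:
  fixes D :: nat and d :: "nat \<Rightarrow> nat" and A :: "nat \<Rightarrow> real Matrix.mat" and \<theta> :: real
  assumes "D \<ge> 2"
    and "\<And>i. 2 \<le> d i \<and> d i \<le> D"
    and "\<And>i. A i \<in> carrier_mat (d i) (d i)"
    and "uniformly_normalizable A"
    and "\<And>i z. eigenvalue (complex_mat (A i)) z \<Longrightarrow> Re z < 0"
    and "\<theta> > 0"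
  shows "((\<exists>\<epsilon>>0. \<forall>i z. defective_eigenvalue (complex_mat (A i)) z \<longrightarrow> Re z \<le> - \<epsilon>) \<longrightarrow>
            globally_asymptotically_stable d A) \<and>
         null_controllable_in_large d A \<theta> \<and>
         (\<forall>x0\<in>ell2 d. \<exists>u. time_optimal_control d A \<theta> x0 u \<and>
            (x0 \<noteq> zero_state d \<longrightarrow>
               optimal_time d A \<theta> x0 > 0 \<and>
               (\<forall>T>0. gramian_energy A x0 T sums \<theta>\<^sup>2 \<longleftrightarrow> T = optimal_time d A \<theta> x0) \<and>
               (\<forall>i. AE s in lebesgue_on {0..optimal_time d A \<theta> x0}.
                  u s i = gramian_control A x0 (optimal_time d A \<theta> x0) s i)))"
proof -
  obtain P Q :: "nat \<Rightarrow> complex Matrix.mat" and C where C: "1 \<le> C"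
    and jordan: "\<And>i. \<exists>bs. 0 \<notin> fst ` set bs \<and> similar_mat_wit (jordan_matrix bs) (complex_mat (A i)) (P i) (Q i)"
    and cond: "\<And>i. op_norm (P i) * op_norm (Q i) \<le> C"
    using assms(4) unfolding uniformly_normalizable_def by blast
  obtain bs where sim: "\<And>i. similar_mat_wit (jordan_matrix (bs i)) (complex_mat (A i)) (P i) (Q i)"
    using jordan by metis
  have n: "0 < d i" for i using assms(2)[of i] by simp
  \<comment> \<open>Replacing \<open>d i\<close> by \<open>D\<close> makes the constant common to
    all \<open>i\<close>; it becomes the growth constant of the interpretation below.\<close>
  have dD: "C * (real (d i))\<^sup>2 \<le> C * (real D)\<^sup>2" for i
    using assms(2)[of i] C by (intro mult_left_mono power_mono) simp_all
  interpret stable_family D d A "C * (real D)\<^sup>2"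
  proof
    show "d i \<le> D" for i using assms(2) by blast
    show "A i \<in> carrier_mat (d i) (d i)" for i by (rule assms(3))
    show "0 < C * (real D)\<^sup>2" using C assms(1) by simp
    fix i and t :: real and v :: "real Matrix.vec" assume t: "0 \<le> t" and v: "v \<in> carrier_vec (d i)"
    have "euclidean_norm (mat_exp (t \<cdot>\<^sub>m A i) *\<^sub>v v) \<le> C * (real (d i))\<^sup>2 * exp t * euclidean_norm v"
      by (rule mat_exp_growth[OF assms(3) n sim assms(5) cond t v])
    also have "\<dots> \<le> C * (real D)\<^sup>2 * exp t * euclidean_norm v"
      by (intro mult_right_mono dD) simp_all
    finally show "euclidean_norm (mat_exp (t \<cdot>\<^sub>m A i) *\<^sub>v v) \<le> C * (real D)\<^sup>2 * exp t * euclidean_norm v" .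
  next
    show "\<exists>\<beta>. (\<beta> \<longlongrightarrow> 0) at_top \<and> (\<forall>t\<ge>0. \<forall>v\<in>carrier_vec (d i).
        euclidean_norm (mat_exp (t \<cdot>\<^sub>m A i) *\<^sub>v v) \<le> \<beta> t * euclidean_norm v)" for i
      by (rule mat_exp_decay[OF assms(3) n sim assms(5)])
  qed
  have stable: "globally_asymptotically_stable d A"
    if eps: "0 < \<epsilon>" and gap: "\<And>i z. defective_eigenvalue (complex_mat (A i)) z \<Longrightarrow> Re z \<le> - \<epsilon>" for \<epsilon>
  proof (rule globally_asymptotically_stable_of_bound)
    fix i and t :: real and v :: "real Matrix.vec" assume t: "0 \<le> t" and v: "v \<in> carrier_vec (d i)"
    have "euclidean_norm (mat_exp (t \<cdot>\<^sub>m A i) *\<^sub>v v) \<le>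
        C * (real (d i))\<^sup>2 * max 1 (1 / \<epsilon>) ^ d i * euclidean_norm v"
      by (rule mat_exp_bounded[OF assms(3) n sim assms(5) eps gap cond t v])
    \<comment> \<open>The base of the power is at least 1, so the exponent may grow from
      \<open>d i\<close> to \<open>D\<close>.\<close>
    also have "\<dots> \<le> C * (real D)\<^sup>2 * max 1 (1 / \<epsilon>) ^ D * euclidean_norm v"
      using C assms(2)[of i] by (intro mult_right_mono[OF mult_mono[OF dD power_increasing]]) simp_all
    finally show "euclidean_norm (mat_exp (t \<cdot>\<^sub>m A i) *\<^sub>v v) \<le> C * (real D)\<^sup>2 * max 1 (1 / \<epsilon>) ^ D * euclidean_norm v" .
  qed
  note optimal = time_optimal_control_exists[OF assms(6)]
  have null: "null_controllable_in_large d A \<theta>"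
    unfolding null_controllable_in_large_def null_controllable_from_def
  proof
    fix x0 assume "x0 \<in> ell2 d"
    from optimal[OF this] have "\<exists>u. time_optimal_control d A \<theta> x0 u"
      by (rule ex_forward) (erule conjunct1)
    then show "\<exists>u T. steers_to_zero d A \<theta> x0 u T"
      unfolding time_optimal_control_def by blast
  qed
  have gas: "globally_asymptotically_stable d A"
    if gap: "\<exists>\<epsilon>>0. \<forall>i z. defective_eigenvalue (complex_mat (A i)) z \<longrightarrow> Re z \<le> - \<epsilon>"
  proof -
    from gap obtain \<epsilon> where eps: "0 < \<epsilon>"
      and le: "\<forall>i z. defective_eigenvalue (complex_mat (A i)) z \<longrightarrow> Re z \<le> - \<epsilon>"
      by (elim exE conjE)
    show ?thesis by (rule stable[OF eps]) (rule le[rule_format])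
  qed
  have "\<forall>x0\<in>ell2 d. \<exists>u. time_optimal_control d A \<theta> x0 u \<and>
            (x0 \<noteq> zero_state d \<longrightarrow>
               optimal_time d A \<theta> x0 > 0 \<and>
               (\<forall>T>0. gramian_energy A x0 T sums \<theta>\<^sup>2 \<longleftrightarrow> T = optimal_time d A \<theta> x0) \<and>
               (\<forall>i. AE s in lebesgue_on {0..optimal_time d A \<theta> x0}.
                  u s i = gramian_control A x0 (optimal_time d A \<theta> x0) s i))"
    by (rule ballI) (rule optimal)
  with gas null show ?thesis by (intro conjI impI)
qed

end
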